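(* Let $\Omega \subset \mathbb{R}^N$ be a bounded Lipschitz domain. Then $L_\Delta$ satisfies the maximum principle on $\Omega$ if and only if $\lambda_1^L(\Omega)>0$.
   Context: $N\ge1$; $c_N= \pi^{-N/2}\Gamma(N/2)$, $\rho_N=2 \log 2 + \psi(\frac{N}{2}) -\gamma$, with $\psi=\Gamma'/\Gamma$ and $\gamma=-\Gamma'(1)$. Set $$\mathcal{E}(u,w)=\frac{c_N}{2}\iint_{|x-y|\le1}\frac{(u(x)-u(y))(w(x)-w(y))}{|x-y|^N}\,dx\,dy,\quad \mathcal{E}_L(u,w)=\mathcal{E}(u,w)-c_N\iint_{|x-y|\ge1}\frac{u(x)w(y)}{|x-y|^N}\,dx\,dy+\rho_N\int_{\mathbb{R}^N}uw\,dx ,$$ with integrals over $x,y\in\mathbb{R}^N$. $\mathbb{H}(\Omega)$ is the space of measurable $u:\mathbb{R}^N\to\mathbb{R}$ with $u\equiv0$ on $\mathbb{R}^N\setminus\Omega$ and $\iint_{|x-y|\le1}\frac{(u(x)-u(y))^2}{|x-y|^N}\,dx\,dy<\infty$ (it is contained in $L^2(\Omega)$, and $\mathcal{E}_L$ is well defined on it). $\lambda_1^L(\Omega)=\min\{\mathcal{E}_L(u,u):u\in\mathbb{H}(\Omega),\ \|u\|_{L^2(\Omega)}=1\}$ is the first Dirichlet eigenvalue of the logarithmic Laplacian $L_\Delta$. $L^1_0(\mathbb{R}^N)$ is the space of locally integrable $u:\mathbb{R}^N\to\mathbb{R}$ with $\int_{\mathbb{R}^N}\frac{|u(x)|}{(1+|x|)^N}\,dx<\infty$.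 $\mathcal{V}(\Omega)$ is the space of $u\in L^1_0(\mathbb{R}^N)$ with $\iint_{x,y\in\Omega,\,|x-y|\le1}\frac{(u(x)-u(y))^2}{|x-y|^N}\,dx\,dy+\int_\Omega u^2\,dx<\infty$; $\mathcal{E}_L(u,\phi)$ is well defined for $u\in\mathcal{V}(\Omega)$, $\phi\in C_c^\infty(\Omega)$. For $u\in\mathcal{V}(\Omega)$, $L_\Delta u\ge0$ in $\Omega$ (in weak sense) means $\mathcal{E}_L(u,\phi)\ge0$ for all nonnegative $\phi\in C_c^\infty(\Omega)$. $L_\Delta$ satisfies the maximum principle on $\Omega$ if for every $u\in\mathcal{V}(\Omega)$ with $L_\Delta u\ge0$ in $\Omega$ and $u\ge0$ in $\mathbb{R}^N\setminus\Omega$ we have $u\ge0$ a.e. in $\mathbb{R}^N$. *)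

theory Defs
  imports "HOL-Analysis.Analysis"
begin

text \<open>
  The space \<open>\<real>\<^sup>N\<close> is an arbitrary Euclidean space \<open>'a\<close> with \<open>N = DIM('a)\<close>. Then \<open>'a \<times> 'a\<close>
  is a Euclidean space as well, and double integrals over \<open>\<real>\<^sup>N \<times> \<real>\<^sup>N\<close> are taken with respect
  to its Lebesgue measure. ``Measurable'' means Lebesgue measurable. Functions are actual
  functions, not classes modulo null sets, and sign or vanishing conditions outside \<open>\<Omega>\<close>
  are imposed pointwise.
\<close>

section \<open>The bilinear form of the logarithmic Laplacian\<close>

definition log_lap_c :: "nat \<Rightarrow> real" where
  "log_lap_c N = pi powr (- real N / 2) * Gamma (real N / 2)"

definition log_lap_rho :: "nat \<Rightarrow> real" where
  "log_lap_rho N = 2 * ln 2 + Digamma (real N / 2) - euler_mascheroni"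

lemma Digamma_eq_log_deriv_Gamma:
  assumes "0 < (x::real)"
  shows "Digamma x = deriv Gamma x / Gamma x"
proof -
  have "x \<notin> \<int>\<^sub>\<le>\<^sub>0"
    using assms by (auto elim!: nonpos_Ints_cases)
  then have "deriv Gamma x = Gamma x * Digamma x"
    by (intro DERIV_imp_deriv has_field_derivative_Gamma)
  then show ?thesis
    using Gamma_real_pos[OF assms] by simp
qed

lemma euler_mascheroni_eq_deriv_Gamma: "(euler_mascheroni::real) = - deriv Gamma 1"
  using Digamma_eq_log_deriv_Gamma[of 1] by simp

definition near_pairs :: "('a::euclidean_space \<times> 'a) set" where
  "near_pairs = {(x, y). dist x y \<le> 1}"

definition far_pairs :: "('a::euclidean_space \<times> 'a) set" where
  "far_pairs = {(x, y). 1 \<le> dist x y}"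

text \<open>On the diagonal \<open>x = y\<close>, a null set, the quotients over \<open>near_pairs\<close> are \<open>0 / 0 = 0\<close>.\<close>

definition energy :: "('a::euclidean_space \<Rightarrow> real) \<Rightarrow> ('a \<Rightarrow> real) \<Rightarrow> real" where
  "energy u w = log_lap_c DIM('a) / 2 *
     (LINT z:near_pairs|lebesgue.
        (case z of (x, y) \<Rightarrow> (u x - u y) * (w x - w y) / dist x y ^ DIM('a)))"

definition energy_L :: "('a::euclidean_space \<Rightarrow> real) \<Rightarrow> ('a \<Rightarrow> real) \<Rightarrow> real" where
  "energy_L u w = energy u w
     - log_lap_c DIM('a) *
       (LINT z:far_pairs|lebesgue. (case z of (x, y) \<Rightarrow> u x * w y / dist x y ^ DIM('a)))
     + log_lap_rho DIM('a) * (LINT x|lebesgue. u x * w x)"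

definition gagliardo_log :: "('a::euclidean_space \<times> 'a) set \<Rightarrow> ('a \<Rightarrow> real) \<Rightarrow> ennreal" where
  "gagliardo_log A u =
     (\<integral>\<^sup>+z\<in>A. (case z of (x, y) \<Rightarrow> ennreal ((u x - u y)\<^sup>2 / dist x y ^ DIM('a))) \<partial>lebesgue)"


section \<open>Function spaces\<close>

definition H_space :: "'a::euclidean_space set \<Rightarrow> ('a \<Rightarrow> real) set" where
  "H_space \<Omega> = {u. u \<in> borel_measurable lebesgue \<and> (\<forall>x. x \<notin> \<Omega> \<longrightarrow> u x = 0) \<and>
     gagliardo_log near_pairs u < \<infinity>}"

definition L10_space :: "('a::euclidean_space \<Rightarrow> real) set" where
  "L10_space = {u. (\<forall>K. compact K \<longrightarrow> set_integrable lebesgue K u) \<and>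
     (\<integral>\<^sup>+x. ennreal (\<bar>u x\<bar> / (1 + norm x) ^ DIM('a)) \<partial>lebesgue) < \<infinity>}"

definition V_space :: "'a::euclidean_space set \<Rightarrow> ('a \<Rightarrow> real) set" where
  "V_space \<Omega> = {u \<in> L10_space.
     gagliardo_log (near_pairs \<inter> \<Omega> \<times> \<Omega>) u
       + (\<integral>\<^sup>+x\<in>\<Omega>. ennreal ((u x)\<^sup>2) \<partial>lebesgue) < \<infinity>}"

primrec C_diff :: "nat \<Rightarrow> ('a::euclidean_space \<Rightarrow> real) \<Rightarrow> bool" where
  "C_diff 0 f \<longleftrightarrow> continuous_on UNIV f"
| "C_diff (Suc k) f \<longleftrightarrow> (\<forall>x. f differentiable at x) \<and>
     (\<forall>b\<in>Basis. C_diff k (\<lambda>x. frechet_derivative f (at x) b))"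

definition test_functions :: "'a::euclidean_space set \<Rightarrow> ('a \<Rightarrow> real) set" where
  "test_functions \<Omega> = {\<phi>. (\<forall>k. C_diff k \<phi>) \<and>
     compact (closure {x. \<phi> x \<noteq> 0}) \<and> closure {x. \<phi> x \<noteq> 0} \<subseteq> \<Omega>}"


section \<open>First eigenvalue, maximum principle, Lipschitz domains\<close>

text \<open>For a set of reals, \<open>LEAST\<close> denotes its minimum whenever the minimum exists.\<close>

definition first_eigenvalue :: "'a::euclidean_space set \<Rightarrow> real" where
  "first_eigenvalue \<Omega> =
     (LEAST r. r \<in> {energy_L u u | u. u \<in> H_space \<Omega> \<and> sqrt (LINT x:\<Omega>|lebesgue. (u x)\<^sup>2) = 1})"

definition weakly_log_superharmonic :: "'a::euclidean_space set \<Rightarrow> ('a \<Rightarrow> real) \<Rightarrow> bool" where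
  "weakly_log_superharmonic \<Omega> u \<longleftrightarrow>
     (\<forall>\<phi>\<in>test_functions \<Omega>. (\<forall>x. 0 \<le> \<phi> x) \<longrightarrow> 0 \<le> energy_L u \<phi>)"

definition maximum_principle :: "'a::euclidean_space set \<Rightarrow> bool" where
  "maximum_principle \<Omega> \<longleftrightarrow>
     (\<forall>u\<in>V_space \<Omega>. weakly_log_superharmonic \<Omega> u \<longrightarrow> (\<forall>x. x \<notin> \<Omega> \<longrightarrow> 0 \<le> u x) \<longrightarrow>
        (AE x in lebesgue. 0 \<le> u x))"

text \<open>
  Near each boundary point \<open>p\<close>, the set \<open>\<Omega>\<close> is the part above the graph, in the direction of a unit
  vector \<open>e\<close>, of a Lipschitz function \<open>g\<close> on the hyperplane orthogonal to \<open>e\<close>. For \<open>N = 1\<close> this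
  hyperplane is \<open>{0}\<close>, and the condition says that \<open>\<Omega>\<close> is locally a half-line.
\<close>

definition lipschitz_boundary :: "'a::euclidean_space set \<Rightarrow> bool" where
  "lipschitz_boundary \<Omega> \<longleftrightarrow>
     (\<forall>p\<in>frontier \<Omega>. \<exists>r>0. \<exists>e g L. norm e = 1 \<and> L-lipschitz_on {y. y \<bullet> e = 0} g \<and>
        \<Omega> \<inter> ball p r = {x \<in> ball p r. g (x - (x \<bullet> e) *\<^sub>R e) < x \<bullet> e})"

definition bounded_lipschitz_domain :: "'a::euclidean_space set \<Rightarrow> bool" where
  "bounded_lipschitz_domain \<Omega> \<longleftrightarrow>
     \<Omega> \<noteq> {} \<and> open \<Omega> \<and> connected \<Omega> \<and> bounded \<Omega> \<and> lipschitz_boundary \<Omega>"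

end

theory Submission
  imports Defs "HOL-Complex_Analysis.Great_Picard"
begin

text \<open>
  The truncations of the kernel \<open>1 / |z|^N\<close> have divergent integrals. This makes the embedding
  of \<open>H_space \<Omega>\<close> into \<open>L^2\<close> compact, so that the eigenvalue is attained; by the first
  variation a minimiser \<open>u\<close>, which may be replaced by \<open>|u|\<close>, solves the eigenvalue equation.
  If the eigenvalue is not positive, then \<open>- |u|\<close> contradicts the maximum principle.

  Conversely, let \<open>u\<close> be a supersolution with negative part \<open>w\<close>. The inequality for \<open>u\<close>
  is tested with cut-offs near the boundary of the truncations \<open>min k w\<close>. For these bounded
  functions the cut-off can be removed as soon as the integral of \<open>1 / sqrt (dist x (- \<Omega>))\<close> over
  \<open>\<Omega>\<close> is finite, and this is the only use of the Lipschitz boundary. The sign of the cross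
  terms then bounds the energy of \<open>min k w\<close> uniformly in \<open>k\<close>, so that \<open>w\<close> belongs to
  \<open>H_space \<Omega>\<close> and its form is nonpositive; no Hardy inequality is needed. If the eigenvalue
  is positive, then \<open>w\<close> vanishes.
\<close>

section \<open>Square integrable functions\<close>

text \<open>The square root in the boundary integral is a compromise. The kernel misses
  integrability at the diagonal only logarithmically, so any positive power of |x - y| repairs it,
  while the boundary tolerates any power of 1 / dist below the first. The squared increments of the
  cut-offs are bounded, uniformly in the cut-off parameter, by a multiple of (|x - y| / dist)^s for
  every s strictly between 0 and 1; s = 1/2 is taken. The obstacle is that
  \<open>V_space \<Omega>\<close> controls energy over \<Omega> \<times> \<Omega> only. Pairs
  crossing the boundary carry no a priori bound, so neither the energy of the negative part nor its
  pairing with u is known to be finite. As a divergent Bochner integral is 0 by convention, every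
  use of bilinearity has to carry its integrability along. Fubini arguments run on Borel functions,
  with the kernel absorbed into measures on pairs. The statement speaks of Lebesgue measurable
  functions with pointwise conditions outside \<Omega>, so the passage to representatives has to
  preserve these conditions everywhere, not just almost everywhere.\<close>

definition sq_integrable :: "'b measure \<Rightarrow> ('b \<Rightarrow> real) \<Rightarrow> bool" where
  "sq_integrable M f \<longleftrightarrow> f \<in> borel_measurable M \<and> integrable M (\<lambda>x. (f x)\<^sup>2)"

lemma sq_integrable_measurable: "sq_integrable M f \<Longrightarrow> f \<in> borel_measurable M"
  by (simp add: sq_integrable_def)

lemma sq_integrable_sq: "sq_integrable M f \<Longrightarrow> integrable M (\<lambda>x. (f x)\<^sup>2)"
  by (simp add: sq_integrable_def)

lemma sq_integrable_iff_nn: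
  "f \<in> borel_measurable M \<Longrightarrow> sq_integrable M f \<longleftrightarrow> (\<integral>\<^sup>+x. ennreal ((f x)\<^sup>2) \<partial>M) < \<infinity>"
  by (auto simp: sq_integrable_def integrable_iff_bounded)

lemma sq_integrable_mult:
  assumes "sq_integrable M f" "sq_integrable M g"
  shows "integrable M (\<lambda>x. f x * g x)"
proof (rule Bochner_Integration.integrable_bound)
  show "integrable M (\<lambda>x. (f x)\<^sup>2 + (g x)\<^sup>2)"
    using assms by (auto simp: sq_integrable_def)
  show "(\<lambda>x. f x * g x) \<in> borel_measurable M"
    using assms by (auto simp: sq_integrable_def)
  show "AE x in M. norm (f x * g x) \<le> norm ((f x)\<^sup>2 + (g x)\<^sup>2)"
  proof (rule AE_I2)
    fix x
    have "2 * (\<bar>f x\<bar> * \<bar>g x\<bar>) \<le> (f x)\<^sup>2 + (g x)\<^sup>2"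
      using sum_squares_bound[of "\<bar>f x\<bar>" "\<bar>g x\<bar>"] by (simp add: mult.assoc)
    then show "norm (f x * g x) \<le> norm ((f x)\<^sup>2 + (g x)\<^sup>2)"
      by (simp add: abs_mult) (smt (verit) mult_nonneg_nonneg abs_ge_zero)
  qed
qed

lemma sq_integrable_bound:
  assumes "sq_integrable M f" "g \<in> borel_measurable M" "AE x in M. \<bar>g x\<bar> \<le> \<bar>f x\<bar>"
  shows "sq_integrable M g"
  unfolding sq_integrable_def
proof
  show "integrable M (\<lambda>x. (g x)\<^sup>2)"
    by (rule Bochner_Integration.integrable_bound[OF sq_integrable_sq[OF assms(1)]])
       (use assms in \<open>auto simp: abs_le_square_iff elim!: eventually_mono\<close>)
qed fact

lemma sq_integrable_add:
  assumes "sq_integrable M f" "sq_integrable M g"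
  shows "sq_integrable M (\<lambda>x. f x + g x)"
  using assms sq_integrable_mult[OF assms]
  by (auto simp: sq_integrable_def power2_sum mult.assoc)

lemma sq_integrable_scale:
  assumes "sq_integrable M f"
  shows "sq_integrable M (\<lambda>x. c * f x)"
  using assms by (auto simp: sq_integrable_def power_mult_distrib)

lemma sq_integrable_diff:
  assumes "sq_integrable M f" "sq_integrable M g"
  shows "sq_integrable M (\<lambda>x. f x - g x)"
  using sq_integrable_add[OF assms(1) sq_integrable_scale[OF assms(2), of "-1"]] by simp

lemma sq_integrable_abs: "sq_integrable M f \<Longrightarrow> sq_integrable M (\<lambda>x. \<bar>f x\<bar>)"
  by (auto simp: sq_integrable_def)

lemma Cauchy_Schwarz_integral:
  assumes "sq_integrable M f" "sq_integrable M g"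
  shows "(\<integral>x. f x * g x \<partial>M)\<^sup>2 \<le> (\<integral>x. (f x)\<^sup>2 \<partial>M) * (\<integral>x. (g x)\<^sup>2 \<partial>M)"
proof -
  define a b c where "a = (\<integral>x. (f x)\<^sup>2 \<partial>M)" and "b = (\<integral>x. f x * g x \<partial>M)"
    and "c = (\<integral>x. (g x)\<^sup>2 \<partial>M)"
  have q: "0 \<le> a - 2 * t * b + t\<^sup>2 * c" for t
  proof -
    have "0 \<le> (\<integral>x. (f x - t * g x)\<^sup>2 \<partial>M)" by simp
    also have "(\<integral>x. (f x - t * g x)\<^sup>2 \<partial>M)
        = (\<integral>x. ((f x)\<^sup>2 - (2 * t) * (f x * g x)) + t\<^sup>2 * (g x)\<^sup>2 \<partial>M)"
      by (rule Bochner_Integration.integral_cong) (auto simp: power2_eq_square algebra_simps)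
    also have "\<dots> = a - 2 * t * b + t\<^sup>2 * c"
      using sq_integrable_mult[OF assms] assms[THEN sq_integrable_sq]
          by (simp add: a_def b_def c_def)
    finally show ?thesis .
  qed
  have "0 \<le> c" by (simp add: c_def)
  show ?thesis
  proof (cases "c = 0")
    case True
    have "b = 0"
    proof (rule ccontr)
      assume "b \<noteq> 0"
      \<comment> \<open>With c = 0 the quadratic is affine in t, and this t gives it the value
        -1.\<close>
      with q[of "(a + 1) / (2 * b)"] True show False by simp
    qed
    then show ?thesis using True by (simp add: b_def c_def)
  next
    case False
    \<comment> \<open>t = b / c is where the quadratic attains its minimum.\<close>
    then have "0 \<le> a - b\<^sup>2 / c"
      using q[of "b / c"] by (simp add: power2_eq_square field_simps)
    then show ?thesis
      using False \<open>0 \<le> c\<close> pos_divide_le_eq[of c "b\<^sup>2" a]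
      unfolding a_def[symmetric] b_def[symmetric] c_def[symmetric] by simp
  qed
qed

lemma Cauchy_Schwarz_integral_abs:
  assumes "sq_integrable M f" "sq_integrable M g"
  shows "(\<integral>x. \<bar>f x\<bar> * \<bar>g x\<bar> \<partial>M) \<le> sqrt (\<integral>x. (f x)\<^sup>2 \<partial>M) * sqrt (\<integral>x. (g x)\<^sup>2 \<partial>M)"
  using Cauchy_Schwarz_integral[OF assms[THEN sq_integrable_abs]]
  by (simp add: real_sqrt_mult[symmetric] real_le_rsqrt)

lemma integral_square_sum_le:
  assumes "sq_integrable M f" "sq_integrable M g"
  shows "(\<integral>x. (f x + g x)\<^sup>2 \<partial>M) \<le> 2 * (\<integral>x. (f x)\<^sup>2 \<partial>M) + 2 * (\<integral>x. (g x)\<^sup>2 \<partial>M)"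
proof -
  have "(\<integral>x. (f x + g x)\<^sup>2 \<partial>M) \<le> (\<integral>x. 2 * (f x)\<^sup>2 + 2 * (g x)\<^sup>2 \<partial>M)"
  proof (rule integral_mono)
    show "(f x + g x)\<^sup>2 \<le> 2 * (f x)\<^sup>2 + 2 * (g x)\<^sup>2" for x
      using sum_squares_bound[of "f x" "g x"] by (simp add: power2_sum)
  qed (use assms sq_integrable_add[OF assms] in \<open>auto simp: sq_integrable_def\<close>)
  also have "\<dots> = 2 * (\<integral>x. (f x)\<^sup>2 \<partial>M) + 2 * (\<integral>x. (g x)\<^sup>2 \<partial>M)"
    using assms[THEN sq_integrable_sq] by simp
  finally show ?thesis .
qed

text \<open>Cauchy-Schwarz against the indicator of the support. Through it square integrable
  functions on the bounded set \<Omega> get a finite L^1 norm, the norm that controls the far part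
  of the form.\<close>

lemma sq_integrable_imp_integrable_on:
  assumes f: "sq_integrable M f" and A: "A \<in> sets M" "emeasure M A < \<infinity>"
    and z: "\<And>x. x \<in> space M \<Longrightarrow> x \<notin> A \<Longrightarrow> f x = 0"
  shows "integrable M f"
proof -
  have "sq_integrable M (indicator A :: _ \<Rightarrow> real)"
    using A by (auto simp: sq_integrable_def power2_eq_square simp flip: indicator_inter_arith)
  from sq_integrable_mult[OF f this] have "integrable M (\<lambda>x. f x * indicator A x)" .
  then show ?thesis
    by (rule Bochner_Integration.integrable_cong[THEN iffD1, rotated -1])
       (use z in \<open>auto simp: indicator_def\<close>)
qed

section \<open>Integration over pairs\<close>

text \<open>Pairs are integrated against \<open>lborel\<close> on the product type, whose
  \<sigma>-algebra is \<open>borel\<close>, only provably equal to the product \<sigma>-algebra.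
  Projections and pairing are declared for it so that measurability of functions of a pair can be
  automated.\<close>

lemma measurable_fst_borel [measurable]:
  "fst \<in> borel_measurable (borel :: ('a::euclidean_space \<times> 'b::euclidean_space) measure)"
  by (intro borel_measurable_continuous_onI continuous_intros)

lemma measurable_snd_borel [measurable]:
  "snd \<in> borel_measurable (borel :: ('a::euclidean_space \<times> 'b::euclidean_space) measure)"
  by (intro borel_measurable_continuous_onI continuous_intros)

lemma measurable_Pair_borel [measurable]:
  fixes f :: "'c \<Rightarrow> 'a::euclidean_space" and g :: "'c \<Rightarrow> 'b::euclidean_space"
  assumes "f \<in> borel_measurable M" "g \<in> borel_measurable M"
  shows "(\<lambda>x. (f x, g x)) \<in> borel_measurable M"
  using assms by (simp add: borel_prod[symmetric])

lemma nn_integral_lborel_pair: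
  fixes f :: "'a::euclidean_space \<times> 'b::euclidean_space \<Rightarrow> ennreal"
  assumes "f \<in> borel_measurable borel"
  shows "(\<integral>\<^sup>+z. f z \<partial>lborel) = (\<integral>\<^sup>+x. \<integral>\<^sup>+y. f (x, y) \<partial>lborel \<partial>lborel)"
  using lborel.nn_integral_fst[of f lborel] assms by (simp add: lborel_prod)

lemma nn_integral_lborel_pair':
  fixes f :: "'a::euclidean_space \<times> 'b::euclidean_space \<Rightarrow> ennreal"
  assumes "f \<in> borel_measurable borel"
  shows "(\<integral>\<^sup>+z. f z \<partial>lborel) = (\<integral>\<^sup>+y. \<integral>\<^sup>+x. f (x, y) \<partial>lborel \<partial>lborel)"
  using lborel_pair.nn_integral_snd[of f] assms by (simp add: lborel_prod case_prod_beta)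

lemma nn_integral_lborel_affine:
  fixes f :: "'a::euclidean_space \<Rightarrow> ennreal"
  assumes [measurable]: "f \<in> borel_measurable borel" and "c \<noteq> 0"
  shows "(\<integral>\<^sup>+x. f x \<partial>lborel) = ennreal (\<bar>c\<bar> ^ DIM('a)) * (\<integral>\<^sup>+x. f (t + c *\<^sub>R x) \<partial>lborel)"
  by (subst lborel_affine[OF assms(2), of t])
     (simp add: nn_integral_density nn_integral_distr nn_integral_cmult ennreal_power)

lemma nn_integral_lborel_shift:
  fixes f :: "'a::euclidean_space \<Rightarrow> ennreal"
  assumes [measurable]: "f \<in> borel_measurable borel"
  shows "(\<integral>\<^sup>+x. f (x + t) \<partial>lborel) = (\<integral>\<^sup>+x. f x \<partial>lborel)"
  using nn_integral_lborel_affine[OF assms, of 1 t] by (simp add: add.commute)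

lemma nn_integral_lborel_reflect:
  fixes f :: "'a::euclidean_space \<Rightarrow> ennreal"
  assumes [measurable]: "f \<in> borel_measurable borel"
  shows "(\<integral>\<^sup>+x. f (t - x) \<partial>lborel) = (\<integral>\<^sup>+x. f x \<partial>lborel)"
  using nn_integral_lborel_affine[OF assms, of "-1" t] by simp

text \<open>Substitution z = x - y at fixed x. It turns a double integral with a convolution kernel
  into an average over z of translation increments, the form in which energies are estimated
  below.\<close>

lemma nn_integral_lborel_kernel:
  fixes k :: "'a::euclidean_space \<Rightarrow> ennreal"
  assumes [measurable]: "k \<in> borel_measurable borel" "F \<in> borel_measurable borel"
  shows "(\<integral>\<^sup>+p. k (fst p - snd p) * F p \<partial>lborel)
       = (\<integral>\<^sup>+z. k z * (\<integral>\<^sup>+x. F (x, x - z) \<partial>lborel) \<partial>lborel)"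
proof -
  have "(\<integral>\<^sup>+p. k (fst p - snd p) * F p \<partial>lborel) = (\<integral>\<^sup>+x. \<integral>\<^sup>+y. k (x - y) * F (x, y) \<partial>lborel \<partial>lborel)"
    by (subst nn_integral_lborel_pair) auto
  also have "\<dots> = (\<integral>\<^sup>+x. \<integral>\<^sup>+z. k z * F (x, x - z) \<partial>lborel \<partial>lborel)"
  proof (rule nn_integral_cong)
    fix x
    show "(\<integral>\<^sup>+y. k (x - y) * F (x, y) \<partial>lborel) = (\<integral>\<^sup>+z. k z * F (x, x - z) \<partial>lborel)"
      using nn_integral_lborel_reflect[of "\<lambda>z. k z * F (x, x - z)" x] by simp
  qed
  also have "\<dots> = (\<integral>\<^sup>+z. \<integral>\<^sup>+x. k z * F (x, x - z) \<partial>lborel \<partial>lborel)"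
    using nn_integral_lborel_pair[of "\<lambda>p. k (snd p) * F (fst p, fst p - snd p)"]
      nn_integral_lborel_pair'[of "\<lambda>p. k (snd p) * F (fst p, fst p - snd p)"] by simp
  also have "\<dots> = (\<integral>\<^sup>+z. k z * (\<integral>\<^sup>+x. F (x, x - z) \<partial>lborel) \<partial>lborel)"
    by (intro nn_integral_cong nn_integral_cmult) auto
  finally show ?thesis .
qed

text \<open>A null set N excludes only N \<times> R^N and R^N \<times> N, both null. Hence changing
  functions on null sets does not affect the double integrals.\<close>

lemma AE_lborel_pair:
  fixes P :: "'a::euclidean_space \<Rightarrow> bool"
  assumes "AE x in lborel. P x"
  shows "AE z in (lborel :: ('a \<times> 'a) measure). P (fst z) \<and> P (snd z)"
proof -
  from assms obtain N where N: "N \<in> null_sets lborel" "{x. \<not> P x} \<subseteq> N"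
    by (auto elim!: AE_E simp: null_sets_def)
  have [measurable]: "N \<in> sets borel" using N by auto
  have n: "AE x in lborel. x \<notin> N" using N by (simp add: AE_not_in)
  have "AE z in (lborel :: 'a measure) \<Otimes>\<^sub>M (lborel :: 'a measure). fst z \<notin> N"
    by (rule lborel_pair.AE_pair_measure, measurable) (use n in \<open>auto elim: eventually_mono\<close>)
  moreover have "AE z in (lborel :: 'a measure) \<Otimes>\<^sub>M (lborel :: 'a measure). snd z \<notin> N"
    by (rule lborel_pair.AE_pair_measure, measurable) (use n in \<open>auto elim: eventually_mono\<close>)
  ultimately show ?thesis
    unfolding lborel_prod by eventually_elim (use N in auto)
qed

section \<open>The singular kernel\<close>

lemma DIM_ge_1: "1 \<le> DIM('a::euclidean_space)"
  using DIM_positive[where 'a='a] by linarith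

text \<open>At the origin this is 1 / 0 = 0 and not infinity, so comparisons of other kernels with
  it are stated for z \<noteq> 0.\<close>

definition near_kernel :: "'a::euclidean_space \<Rightarrow> real" where
  "near_kernel z = indicator (cball 0 1) z / norm z ^ DIM('a)"

definition far_kernel :: "'a::euclidean_space \<Rightarrow> real" where
  "far_kernel z = indicator {z. 1 \<le> norm z} z / norm z ^ DIM('a)"

text \<open>Absorbing the kernel into the measure makes the energy an inner product of increments in
  L^2, so that Cauchy-Schwarz, Fatou and dominated convergence apply directly.\<close>

definition near_measure :: "('a::euclidean_space \<times> 'a) measure" where
  "near_measure = density lborel (\<lambda>p. ennreal (near_kernel (fst p - snd p)))"

definition far_measure :: "('a::euclidean_space \<times> 'a) measure" where
  "far_measure = density lborel (\<lambda>p. ennreal (far_kernel (fst p - snd p)))"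

lemma near_kernel_measurable [measurable]: "near_kernel \<in> borel_measurable borel"
  unfolding near_kernel_def
  by (intro borel_measurable_divide borel_measurable_indicator borel_measurable_power
      borel_measurable_norm) auto

lemma far_kernel_measurable [measurable]: "far_kernel \<in> borel_measurable borel"
  unfolding far_kernel_def
  by (intro borel_measurable_divide borel_measurable_indicator borel_measurable_power
      borel_measurable_norm) auto

lemma near_kernel_nonneg [simp]: "0 \<le> near_kernel z"
  by (simp add: near_kernel_def)

lemma far_kernel_nonneg [simp]: "0 \<le> far_kernel z"
  by (simp add: far_kernel_def)

lemma near_kernel_minus [simp]: "near_kernel (- z) = near_kernel z"
  by (simp add: near_kernel_def indicator_def)

lemma far_kernel_minus [simp]: "far_kernel (- z) = far_kernel z"
  by (simp add: far_kernel_def indicator_def)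

lemma near_kernel_commute: "near_kernel (x - y) = near_kernel (y - x)"
  by (metis minus_diff_eq near_kernel_minus)

lemma far_kernel_commute: "far_kernel (x - y) = far_kernel (y - x)"
  by (metis minus_diff_eq far_kernel_minus)

lemma far_kernel_le_1: "far_kernel z \<le> 1"
  by (auto simp: far_kernel_def indicator_def divide_le_eq_1 one_le_power)

lemma sets_near_measure [measurable_cong, simp]: "sets near_measure = sets borel"
  by (simp add: near_measure_def)

lemma sets_far_measure [measurable_cong, simp]: "sets far_measure = sets borel"
  by (simp add: far_measure_def)

lemma nn_integral_near_measure:
  "f \<in> borel_measurable borel \<Longrightarrow>
    (\<integral>\<^sup>+p. f p \<partial>near_measure) = (\<integral>\<^sup>+p. ennreal (near_kernel (fst p - snd p)) * f p \<partial>lborel)"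
  unfolding near_measure_def by (subst nn_integral_density) auto

lemma nn_integral_far_measure:
  "f \<in> borel_measurable borel \<Longrightarrow>
    (\<integral>\<^sup>+p. f p \<partial>far_measure) = (\<integral>\<^sup>+p. ennreal (far_kernel (fst p - snd p)) * f p \<partial>lborel)"
  unfolding far_measure_def by (subst nn_integral_density) auto

lemma nn_integral_near_measure_iterated:
  fixes F :: "'a::euclidean_space \<times> 'a \<Rightarrow> ennreal"
  assumes "F \<in> borel_measurable borel"
  shows "(\<integral>\<^sup>+p. F p \<partial>near_measure)
    = (\<integral>\<^sup>+z. ennreal (near_kernel z) * (\<integral>\<^sup>+x. F (x, x - z) \<partial>lborel) \<partial>lborel)"
  using nn_integral_lborel_kernel[of "\<lambda>z. ennreal (near_kernel z)" F] assms
  by (simp add: nn_integral_near_measure)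

lemma nn_integral_lborel_swap:
  fixes F :: "'a::euclidean_space \<times> 'a \<Rightarrow> ennreal"
  assumes [measurable]: "F \<in> borel_measurable borel"
  shows "(\<integral>\<^sup>+p. F (snd p, fst p) \<partial>lborel) = (\<integral>\<^sup>+p. F p \<partial>lborel)"
  by (subst nn_integral_lborel_pair, simp, subst nn_integral_lborel_pair', simp_all)

lemma nn_integral_near_measure_swap:
  fixes F :: "'a::euclidean_space \<times> 'a \<Rightarrow> ennreal"
  assumes [measurable]: "F \<in> borel_measurable borel"
  shows "(\<integral>\<^sup>+p. F (snd p, fst p) \<partial>near_measure) = (\<integral>\<^sup>+p. F p \<partial>near_measure)"
  using nn_integral_lborel_swap[of "\<lambda>p. ennreal (near_kernel (fst p - snd p)) * F p"]
  by (simp add: nn_integral_near_measure near_kernel_commute)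

lemma AE_near_measure:
  "AE p in lborel. P p \<Longrightarrow> AE p in near_measure. P p"
  unfolding near_measure_def by (subst AE_density) auto

lemma half_power_bracket:
  fixes s :: real
  assumes "0 < s" "s \<le> 1"
  obtains j :: nat where "s \<le> (1/2) ^ j" "(1/2) ^ Suc j < s"
proof -
  obtain n where n: "(1/2) ^ n < s"
    using real_arch_pow_inv[of s "1/2"] assms by auto
  define m where "m = (LEAST n. (1/2::real) ^ n < s)"
  have m: "(1/2) ^ m < s" unfolding m_def by (rule LeastI) (rule n)
  have "m \<noteq> 0"
  proof
    assume "m = 0" with m assms show False by simp
  qed
  then obtain j where j: "m = Suc j" by (cases m) auto
  have "\<not> (1/2) ^ j < s"
    using not_less_Least[of j "\<lambda>n. (1/2::real) ^ n < s"] j by (simp add: m_def)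
  then show ?thesis using that[of j] m j by auto
qed

text \<open>Dyadic decomposition: \<open>f powr (-a) \<le> (\<Sum>j. 2 powr (a * (j + 1)))\<close> over those \<open>j\<close> with
  \<open>f \<le> 2 powr (-j)\<close>.\<close>

lemma nn_integral_negative_power_finite:
  fixes f :: "'b \<Rightarrow> real"
  assumes [measurable]: "f \<in> borel_measurable M" and "0 \<le> C" "0 \<le> a" "a < p"
    and small: "\<And>t. 0 < t \<Longrightarrow> t \<le> 1 \<Longrightarrow> emeasure M {x\<in>space M. 0 < f x \<and> f x \<le> t}
        \<le> ennreal (C * t powr p)"
  shows "(\<integral>\<^sup>+x. ennreal (f x powr (-a)) * indicator {x. 0 < f x \<and> f x \<le> 1} x \<partial>M) < \<infinity>"
proof -
  define h :: "nat \<Rightarrow> real" where "h j = (1/2) ^ j" for j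
  have h: "0 < h j" "h j \<le> 1" for j by (auto simp: h_def power_le_one)
  have hS: "h (Suc j) = h j / 2" for j by (simp add: h_def)
  let ?A = "\<lambda>j. {x\<in>space M. 0 < f x \<and> f x \<le> h j}"
  have [measurable]: "?A j \<in> sets M" for j by measurable
  have "(\<integral>\<^sup>+x. ennreal (f x powr (-a)) * indicator {x. 0 < f x \<and> f x \<le> 1} x \<partial>M)
      \<le> (\<integral>\<^sup>+x. (\<Sum>j. ennreal (h (Suc j) powr (-a)) * indicator (?A j) x) \<partial>M)"
  proof (rule nn_integral_mono)
    fix x assume x: "x \<in> space M"
    show "ennreal (f x powr (-a)) * indicator {x. 0 < f x \<and> f x \<le> 1} x
        \<le> (\<Sum>j. ennreal (h (Suc j) powr (-a)) * indicator (?A j) x)"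
    proof (cases "0 < f x \<and> f x \<le> 1")
      case True
      then obtain j where j: "f x \<le> h j" "h (Suc j) < f x"
        using half_power_bracket[of "f x"] unfolding h_def by blast
      have "f x powr (-a) \<le> h (Suc j) powr (-a)"
        using h[of "Suc j"] j \<open>0 \<le> a\<close> by (intro powr_mono2') auto
      then have "ennreal (f x powr (-a)) * indicator {x. 0 < f x \<and> f x \<le> 1} x
          \<le> (\<Sum>j\<in>{j}. ennreal (h (Suc j) powr (-a)) * indicator (?A j) x)"
        using True j x by (simp add: ennreal_leI)
      also have "\<dots> \<le> (\<Sum>j. ennreal (h (Suc j) powr (-a)) * indicator (?A j) x)"
        by (rule sum_le_suminf) auto
      finally show ?thesis .
    qed auto
  qed
  also have "\<dots> = (\<Sum>j. ennreal (h (Suc j) powr (-a)) * emeasure M (?A j))"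
    by (subst nn_integral_suminf) (auto simp: nn_integral_cmult)
  \<comment> \<open>Layer j costs at most \<open>h (Suc j) powr (-a)\<close> times
    \<open>C * h j powr p\<close>, a geometric term of ratio (1/2)^(p - a); this is where a < p
    enters.\<close>
  also have "\<dots> \<le> (\<Sum>j. ennreal ((C * 2 powr a) * ((1/2) powr (p - a)) ^ j))"
  proof (rule suminf_le)
    fix j
    have "ennreal (h (Suc j) powr (-a)) * emeasure M (?A j)
        \<le> ennreal (h (Suc j) powr (-a)) * ennreal (C * h j powr p)"
      using small[OF h] by (rule mult_left_mono) auto
    also have "\<dots> = ennreal (h (Suc j) powr (-a) * (C * h j powr p))"
      using h[of j] \<open>0 \<le> C\<close> by (subst ennreal_mult'[symmetric]) auto
    also have "h (Suc j) powr (-a) * (C * h j powr p) = (C * 2 powr a) * (h j powr (p - a))"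
      using h[of j] by (simp add: hS powr_divide powr_minus powr_diff field_simps)
    also have "h j powr (p - a) = ((1/2) powr (p - a)) ^ j"
      by (simp add: h_def powr_power powr_realpow[symmetric] powr_powr mult.commute)
    finally show "ennreal (h (Suc j) powr (-a)) * emeasure M (?A j)
        \<le> ennreal ((C * 2 powr a) * ((1/2) powr (p - a)) ^ j)" .
  qed auto
  also have "\<dots> < \<infinity>"
  proof -
    have "(1/2::real) powr (p - a) < 1" using \<open>a < p\<close> by (simp add: powr_divide gr_one_powr)
    then have "summable (\<lambda>j. (C * 2 powr a) * ((1/2) powr (p - a)) ^ j)"
      by (intro summable_mult summable_geometric) auto
    then show ?thesis
      using \<open>0 \<le> C\<close> by (subst suminf_ennreal2) auto
  qed
  finally show ?thesis .
qed

text \<open>Balls of radius t have measure of order t^N, while sqrt |z| lowers the singularity to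
  the power N - 1/2. This gain of half a power serves Lipschitz functions as well as the cut-offs at
  the boundary.\<close>

lemma near_kernel_sqrt_finite:
  "(\<integral>\<^sup>+z. ennreal (sqrt (norm z) * near_kernel z) \<partial>(lborel :: 'a::euclidean_space measure)) < \<infinity>"
proof -
  let ?N = "real DIM('a)"
  have N: "1 \<le> ?N" using DIM_ge_1[where 'a='a] by linarith
  have "(\<integral>\<^sup>+z. ennreal (norm z powr (-(?N - 1/2))) * indicator {z. 0 < norm z \<and> norm z \<le> 1} z
      \<partial>(lborel :: 'a measure)) < \<infinity>"
  proof (rule nn_integral_negative_power_finite[where C="unit_ball_vol ?N" and p = ?N])
    fix t :: real assume t: "0 < t" "t \<le> 1"
    have "emeasure lborel {x \<in> space (lborel :: 'a measure). 0 < norm x \<and> norm x \<le> t}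
       \<le> emeasure lborel (cball (0::'a) t)"
      by (rule emeasure_mono) auto
    then show "emeasure lborel {x \<in> space (lborel :: 'a measure). 0 < norm x \<and> norm x \<le> t}
        \<le> ennreal (unit_ball_vol ?N * t powr ?N)"
      using t by (simp add: emeasure_cball powr_realpow)
  qed (use N in \<open>auto simp del: One_nat_def of_nat_Suc\<close>)
  moreover have "sqrt (norm z) * near_kernel z
      = norm z powr (-(?N - 1/2)) * indicator {z. 0 < norm z \<and> norm z \<le> 1} z" for z :: 'a
  proof (cases "z = 0")
    case False
    then have "norm z powr (1/2 - ?N) = sqrt (norm z) / norm z ^ DIM('a)"
      by (simp add: powr_diff powr_realpow powr_half_sqrt)
    moreover have "-(?N - 1/2) = 1/2 - ?N" by simp
    ultimately have "norm z powr (-(?N - 1/2)) = sqrt (norm z) / norm z ^ DIM('a)" by metis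
    then show ?thesis using False by (auto simp: near_kernel_def indicator_def)
  qed (simp add: near_kernel_def)
  then have "(\<integral>\<^sup>+z. ennreal (sqrt (norm z) * near_kernel z) \<partial>(lborel :: 'a measure))
    = (\<integral>\<^sup>+z. ennreal (norm z powr (-(?N - 1/2))) * indicator {z. 0 < norm z \<and> norm z \<le> 1} z
      \<partial>(lborel :: 'a measure))"
    by (intro nn_integral_cong) (auto simp: indicator_def)
  ultimately show ?thesis by simp
qed

section \<open>The forms on Borel functions\<close>

definition increment :: "('a::euclidean_space \<Rightarrow> real) \<Rightarrow> 'a \<times> 'a \<Rightarrow> real" where
  "increment u p = u (fst p) - u (snd p)"

lemma increment_measurable [measurable]:
  assumes [measurable]: "u \<in> borel_measurable borel"
  shows "increment u \<in> borel_measurable borel"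
  unfolding increment_def by measurable

lemma increment_Pair [simp]: "increment u (x, y) = u x - u y"
  by (simp add: increment_def)

lemma log_lap_c_pos: "0 < log_lap_c DIM('a::euclidean_space)"
  using DIM_positive[where 'a='a] by (simp add: log_lap_c_def Gamma_real_pos)

lemma near_pairs_borel [measurable]: "near_pairs \<in> sets borel"
proof -
  have "near_pairs = {p :: 'a \<times> 'a. dist (fst p) (snd p) \<le> 1}" by (auto simp: near_pairs_def)
  also have "\<dots> \<in> sets borel" by measurable
  finally show ?thesis .
qed

lemma far_pairs_borel [measurable]: "far_pairs \<in> sets borel"
proof -
  have "far_pairs = {p :: 'a \<times> 'a. 1 \<le> dist (fst p) (snd p)}" by (auto simp: far_pairs_def)
  also have "\<dots> \<in> sets borel" by measurable
  finally show ?thesis .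
qed

lemma near_kernel_diff: "near_kernel (x - y :: 'a::euclidean_space)
    = indicator near_pairs (x, y) / dist x y ^ DIM('a)"
  by (simp add: near_kernel_def near_pairs_def dist_norm indicator_def norm_minus_commute)

lemma far_kernel_diff: "far_kernel (x - y :: 'a::euclidean_space)
    = indicator far_pairs (x, y) / dist x y ^ DIM('a)"
  by (simp add: far_kernel_def far_pairs_def dist_norm indicator_def)

text \<open>The default value of the kernel on the diagonal agrees with the value 0 / 0 of the
  quotient, and for Borel integrands the integrals for the completed and the uncompleted measure
  coincide.\<close>

lemma energy_eq_near_measure:
  fixes u w :: "'a::euclidean_space \<Rightarrow> real"
  assumes [measurable]: "u \<in> borel_measurable borel" "w \<in> borel_measurable borel"
  shows "energy u w = log_lap_c DIM('a) / 2 * (\<integral>p. increment u p * increment w p \<partial>near_measure)"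
proof -
  have "(LINT z:near_pairs|lebesgue.
        (case z of (x, y) \<Rightarrow> (u x - u y) * (w x - w y) / dist x y ^ DIM('a)))
    = (\<integral>p. near_kernel (fst p - snd p) * (increment u p * increment w p) \<partial>lebesgue)"
    unfolding set_lebesgue_integral_def
    by (intro Bochner_Integration.integral_cong) (auto simp: near_kernel_diff)
  also have "\<dots> = (\<integral>p. near_kernel (fst p - snd p) * (increment u p * increment w p) \<partial>lborel)"
    by (intro integral_completion) measurable
  also have "\<dots> = (\<integral>p. increment u p * increment w p \<partial>near_measure)"
    unfolding near_measure_def by (subst integral_density) auto
  finally show ?thesis by (simp add: energy_def)
qed

lemma energy_L_eq:
  fixes u w :: "'a::euclidean_space \<Rightarrow> real"
  assumes [measurable]: "u \<in> borel_measurable borel" "w \<in> borel_measurable borel"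
  shows "energy_L u w = log_lap_c DIM('a) / 2 * (\<integral>p. increment u p * increment w p \<partial>near_measure)
    - log_lap_c DIM('a) * (\<integral>p. u (fst p) * w (snd p) \<partial>far_measure)
    + log_lap_rho DIM('a) * (\<integral>x. u x * w x \<partial>lborel)"
proof -
  have "(LINT z:far_pairs|lebesgue. (case z of (x, y) \<Rightarrow> u x * w y / dist x y ^ DIM('a)))
    = (\<integral>p. far_kernel (fst p - snd p) * (u (fst p) * w (snd p)) \<partial>lebesgue)"
    unfolding set_lebesgue_integral_def
    by (intro Bochner_Integration.integral_cong) (auto simp: far_kernel_diff)
  also have "\<dots> = (\<integral>p. far_kernel (fst p - snd p) * (u (fst p) * w (snd p)) \<partial>lborel)"
    by (intro integral_completion) measurable
  also have "\<dots> = (\<integral>p. u (fst p) * w (snd p) \<partial>far_measure)"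
    unfolding far_measure_def by (subst integral_density) auto
  finally have 1: "(LINT z:far_pairs|lebesgue. (case z of (x, y) \<Rightarrow> u x * w y / dist x y ^ DIM('a)))
    = (\<integral>p. u (fst p) * w (snd p) \<partial>far_measure)" .
  have 2: "(LINT x|lebesgue. u x * w x) = (\<integral>x. u x * w x \<partial>lborel)"
    by (intro integral_completion) measurable
  show ?thesis
    unfolding energy_L_def energy_eq_near_measure[OF assms] 1 2 ..
qed

lemma gagliardo_log_eq_near_measure:
  fixes u :: "'a::euclidean_space \<Rightarrow> real"
  assumes [measurable]: "u \<in> borel_measurable borel" "A \<in> sets borel"
  shows "gagliardo_log (near_pairs \<inter> A) u
    = (\<integral>\<^sup>+p. ennreal ((increment u p)\<^sup>2) * indicator A p \<partial>near_measure)"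
proof -
  have "gagliardo_log (near_pairs \<inter> A) u = (\<integral>\<^sup>+p. ennreal (near_kernel (fst p - snd p))
      * (ennreal ((increment u p)\<^sup>2) * indicator A p) \<partial>lborel)"
    unfolding gagliardo_log_def nn_integral_completion
    by (intro nn_integral_cong)
       (auto simp: near_kernel_diff indicator_def ennreal_mult'[symmetric])
  then show ?thesis by (simp add: nn_integral_near_measure)
qed

text \<open>The Borel representatives of the elements of \<open>H_space \<Omega>\<close>.\<close>

definition borel_H :: "'a::euclidean_space set \<Rightarrow> ('a \<Rightarrow> real) \<Rightarrow> bool" where
  "borel_H \<Omega> u \<longleftrightarrow> u \<in> borel_measurable borel \<and> (\<forall>x. x \<notin> \<Omega> \<longrightarrow> u x = 0) \<and>
     sq_integrable near_measure (increment u)"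

lemma borel_H_measurable: "borel_H \<Omega> u \<Longrightarrow> u \<in> borel_measurable borel"
  by (simp add: borel_H_def)

lemma borel_H_zero: "borel_H \<Omega> u \<Longrightarrow> x \<notin> \<Omega> \<Longrightarrow> u x = 0"
  by (simp add: borel_H_def)

lemma borel_H_increment: "borel_H \<Omega> u \<Longrightarrow> sq_integrable near_measure (increment u)"
  by (simp add: borel_H_def)

lemma borel_H_add:
  assumes "borel_H \<Omega> u" "borel_H \<Omega> v"
  shows "borel_H \<Omega> (\<lambda>x. u x + v x)"
proof -
  have "increment (\<lambda>x. u x + v x) = (\<lambda>p. increment u p + increment v p)"
    by (auto simp: increment_def)
  then show ?thesis
    using assms sq_integrable_add[of near_measure "increment u" "increment v"]
    by (auto simp: borel_H_def)
qed

lemma borel_H_scale: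
  assumes "borel_H \<Omega> u"
  shows "borel_H \<Omega> (\<lambda>x. c * u x)"
proof -
  have "increment (\<lambda>x. c * u x) = (\<lambda>p. c * increment u p)"
    by (auto simp: increment_def algebra_simps)
  then show ?thesis
    using assms sq_integrable_scale[of near_measure "increment u" c]
    by (auto simp: borel_H_def)
qed

lemma borel_H_diff:
  "borel_H \<Omega> u \<Longrightarrow> borel_H \<Omega> v \<Longrightarrow> borel_H \<Omega> (\<lambda>x. u x - v x)"
  using borel_H_add[of \<Omega> u "\<lambda>x. (-1) * v x"] borel_H_scale[of \<Omega> v "-1"] by simp

text \<open>Closure under normal contractions, the Markov property of the form; it is applied to the
  absolute value.\<close>

lemma borel_H_bound:
  assumes u: "borel_H \<Omega> u" and [measurable]: "v \<in> borel_measurable borel"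
    and le: "\<And>x y. \<bar>v x - v y\<bar> \<le> \<bar>u x - u y\<bar>" and z: "\<And>x. x \<notin> \<Omega> \<Longrightarrow> v x = 0"
  shows "borel_H \<Omega> v"
  unfolding borel_H_def
  using sq_integrable_bound[OF borel_H_increment[OF u], of "increment v"] le z
  by (auto simp: increment_def)

section \<open>A Poincare inequality\<close>

text \<open>For x in the ball of radius R the point x - m z lies outside it, so u(x) telescopes into
  m increments along steps of length |z|. Cauchy-Schwarz for the sum costs one factor m; the other
  counts the m integrals, which are equal by translation.\<close>

lemma nn_integral_square_le_shift:
  fixes u :: "'a::euclidean_space \<Rightarrow> real"
  assumes [measurable]: "u \<in> borel_measurable borel"
    and u0: "\<And>x. R \<le> norm x \<Longrightarrow> u x = 0" and m: "2 * R \<le> real m * norm z"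
  shows "(\<integral>\<^sup>+x. ennreal ((u x)\<^sup>2) \<partial>lborel) \<le> ennreal ((real m)\<^sup>2)
      * (\<integral>\<^sup>+x. ennreal ((u x - u (x - z))\<^sup>2) \<partial>lborel)"
proof -
  define a where "a j x = u (x - real j *\<^sub>R z) - u (x - real (Suc j) *\<^sub>R z)" for j x
  have [measurable]: "a j \<in> borel_measurable borel" for j unfolding a_def by measurable
  have tel: "(\<Sum>j<m. a j x) = u x - u (x - real m *\<^sub>R z)" for x
    unfolding a_def using sum_lessThan_telescope'[of "\<lambda>j. u (x - real j *\<^sub>R z)" m] by simp
  have pt: "(u x)\<^sup>2 \<le> real m * (\<Sum>j<m. (a j x)\<^sup>2)" for x
  proof (cases "norm x < R")
    case True
    have "real m * norm z \<le> norm x + norm (x - real m *\<^sub>R z)"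
      using norm_triangle_ineq4[of x "x - real m *\<^sub>R z"] by simp
    then have "u (x - real m *\<^sub>R z) = 0" using True m by (intro u0) linarith
    then have "(u x)\<^sup>2 = (\<Sum>j<m. a j x)\<^sup>2" by (simp add: tel)
    also have "\<dots> \<le> (\<Sum>j<m. (a j x)\<^sup>2) * real m"
      using sum_squared_le_sum_of_squares[of "\<lambda>j. a j x" "{..<m}"] by simp
    finally show ?thesis by (simp add: mult.commute)
  next
    case False
    then have "u x = 0" by (intro u0) simp
    then show ?thesis by (simp add: sum_nonneg)
  qed
  have sh: "(\<integral>\<^sup>+x. ennreal ((a j x)\<^sup>2) \<partial>lborel) = (\<integral>\<^sup>+x. ennreal ((u x - u (x - z))\<^sup>2) \<partial>lborel)" for j
    using nn_integral_lborel_shift[of "\<lambda>x. ennreal ((u x - u (x - z))\<^sup>2)" "- (real j *\<^sub>R z)"]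
    by (simp add: a_def algebra_simps)
  have "(\<integral>\<^sup>+x. ennreal ((u x)\<^sup>2) \<partial>lborel) \<le> (\<integral>\<^sup>+x. ennreal (real m)
      * (\<Sum>j<m. ennreal ((a j x)\<^sup>2)) \<partial>lborel)"
    by (intro nn_integral_mono) (use pt in \<open>auto simp: sum_ennreal ennreal_mult'[symmetric] intro!:
        ennreal_leI\<close>)
  also have "\<dots> = ennreal (real m) * (\<Sum>j<m. \<integral>\<^sup>+x. ennreal ((a j x)\<^sup>2) \<partial>lborel)"
    by (subst nn_integral_cmult, measurable, subst nn_integral_sum) auto
  also have "\<dots> = ennreal (real m) * (of_nat m * (\<integral>\<^sup>+x. ennreal ((u x - u (x - z))\<^sup>2) \<partial>lborel))"
    unfolding sh by simp
  also have "\<dots> = ennreal ((real m)\<^sup>2) * (\<integral>\<^sup>+x. ennreal ((u x - u (x - z))\<^sup>2) \<partial>lborel)"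
    by (simp add: power2_eq_square ennreal_mult ennreal_of_nat_eq_real_of_nat mult.assoc)
  finally show ?thesis .
qed

text \<open>The shift estimate is averaged over z in a ball away from the origin on which the kernel
  is at least 1. All integrals stay in the extended reals, because square integrability is the
  conclusion.\<close>

lemma square_integrable_of_near_increment:
  fixes u :: "'a::euclidean_space \<Rightarrow> real"
  assumes [measurable]: "u \<in> borel_measurable borel"
    and u0: "\<And>x. R \<le> norm x \<Longrightarrow> u x = 0" and inc: "sq_integrable near_measure (increment u)"
  shows "sq_integrable lborel u"
proof -
  obtain b :: 'a where b: "b \<in> Basis" using nonempty_Basis by blast
  \<comment> \<open>Placed so that 1/2 \<le> |z| \<le> 1 on S: the upper bound puts the kernel above
    1, the lower one fixes a number of steps valid for all z.\<close>
  define S where "S = ball ((3/4) *\<^sub>R b) (1/4)"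
  have S: "1/2 \<le> norm z" "norm z \<le> 1" if "z \<in> S" for z
  proof -
    have "norm ((3/4) *\<^sub>R b) = 3/4" using b by simp
    moreover have "norm ((3/4) *\<^sub>R b - z) < 1/4" using that by (simp add: S_def dist_norm)
    ultimately show "1/2 \<le> norm z" "norm z \<le> 1"
      using norm_triangle_ineq2[of "(3/4) *\<^sub>R b" z] norm_triangle_ineq3[of "(3/4) *\<^sub>R b" z]
          by linarith+
  qed
  have [measurable]: "S \<in> sets borel" by (simp add: S_def)
  have Sk: "1 \<le> near_kernel z" if "z \<in> S" for z
  proof -
    have "0 < norm z" using S[OF that] by linarith
    then show ?thesis
      using S[OF that] by (auto simp: near_kernel_def power_le_one divide_simps)
  qed
  \<comment> \<open>m steps of length at least 1/2 cover the diameter 2 R of the support.\<close>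
  obtain m :: nat where m: "4 * R \<le> real m" using real_arch_simple by blast
  let ?I = "\<integral>\<^sup>+x. ennreal ((u x)\<^sup>2) \<partial>lborel"
  let ?J = "\<lambda>z. \<integral>\<^sup>+x. ennreal ((u x - u (x - z))\<^sup>2) \<partial>lborel"
  have "emeasure lborel S * ?I = (\<integral>\<^sup>+z. ?I * indicator S z \<partial>lborel)"
    by (subst nn_integral_cmult_indicator) (simp_all add: mult.commute)
  also have "\<dots> \<le> (\<integral>\<^sup>+z. ennreal ((real m)\<^sup>2) * (ennreal (near_kernel z) * ?J z) \<partial>lborel)"
  proof (rule nn_integral_mono)
    fix z
    show "?I * indicator S z \<le> ennreal ((real m)\<^sup>2) * (ennreal (near_kernel z) * ?J z)"
    proof (cases "z \<in> S")
      case True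
      have "2 * R \<le> real m * (1/2)" using m by simp
      also have "\<dots> \<le> real m * norm z" using S[OF True] by (intro mult_left_mono) auto
      finally have "?I \<le> ennreal ((real m)\<^sup>2) * ?J z"
        by (intro nn_integral_square_le_shift[where R=R] u0) auto
      also have "\<dots> \<le> ennreal ((real m)\<^sup>2) * (ennreal (near_kernel z) * ?J z)"
        using mult_right_mono[of 1 "ennreal (near_kernel z)" "?J z"] Sk[OF True]
        by (intro mult_left_mono) auto
      finally show ?thesis using True by simp
    qed simp
  qed
  also have "\<dots> = ennreal ((real m)\<^sup>2) * (\<integral>\<^sup>+p. ennreal ((increment u p)\<^sup>2) \<partial>near_measure)"
    by (subst nn_integral_near_measure_iterated) (simp_all add: nn_integral_cmult)
  also have "\<dots> < \<infinity>"
    using inc by (simp add: sq_integrable_iff_nn ennreal_mult_less_top)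
  finally have "emeasure lborel S * ?I < \<infinity>" .
  \<comment> \<open>The integral of u^2 might still be infinite; a finite product with a positive
    factor excludes that.\<close>
  moreover have "0 < emeasure lborel S"
    by (simp add: S_def emeasure_ball)
  ultimately have "?I < \<infinity>"
    by (auto simp: ennreal_mult_less_top)
  then show ?thesis by (simp add: sq_integrable_iff_nn)
qed

lemma borel_H_sq_integrable:
  assumes u: "borel_H \<Omega> u" and "bounded \<Omega>"
  shows "sq_integrable lborel u"
proof -
  from \<open>bounded \<Omega>\<close> obtain R where "\<forall>x\<in>\<Omega>. norm x < R"
    unfolding bounded_pos_less by blast
  then have "\<And>x. R \<le> norm x \<Longrightarrow> u x = 0"
    using borel_H_zero[OF u] by (meson not_less)
  then show ?thesis
    using square_integrable_of_near_increment[of u R] u by (auto simp: borel_H_def)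
qed

lemma borel_H_integrable:
  assumes u: "borel_H \<Omega> u" and "bounded \<Omega>" "open \<Omega>"
  shows "integrable lborel u"
  using sq_integrable_imp_integrable_on[OF borel_H_sq_integrable[OF u \<open>bounded \<Omega>\<close>], of \<Omega>]
    assms borel_H_zero[OF u] emeasure_bounded_finite[of \<Omega>] by auto

section \<open>The far part of the form\<close>

text \<open>The far kernel is at most 1, which leaves the integral of a product of functions of
  separate variables.\<close>

lemma far_product_integrable:
  fixes u w :: "'a::euclidean_space \<Rightarrow> real"
  assumes u: "integrable lborel u" and w: "integrable lborel w"
  shows "integrable far_measure (\<lambda>p. u (fst p) * w (snd p))"
    and "(\<integral>p. \<bar>u (fst p) * w (snd p)\<bar> \<partial>far_measure) \<le> (\<integral>x. \<bar>u x\<bar> \<partial>lborel) * (\<integral>x. \<bar>w x\<bar> \<partial>lborel)"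
proof -
  have [measurable]: "u \<in> borel_measurable borel" "w \<in> borel_measurable borel"
    using borel_measurable_integrable[OF u] borel_measurable_integrable[OF w] by auto
  have "(\<integral>\<^sup>+p. ennreal \<bar>u (fst p) * w (snd p)\<bar> \<partial>far_measure)
      \<le> (\<integral>\<^sup>+p. ennreal \<bar>u (fst p)\<bar> * ennreal \<bar>w (snd p)\<bar> \<partial>lborel)"
    unfolding far_measure_def
    by (subst nn_integral_density)
       (auto intro!: nn_integral_mono mult_left_le_one_le
         simp: far_kernel_le_1 abs_mult ennreal_mult'[symmetric] intro!: ennreal_leI)
  also have "\<dots> = (\<integral>\<^sup>+x. ennreal \<bar>u x\<bar> * (\<integral>\<^sup>+y. ennreal \<bar>w y\<bar> \<partial>lborel) \<partial>lborel)"
    by (subst nn_integral_lborel_pair) (simp_all add: nn_integral_cmult)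
  also have "\<dots> = (\<integral>\<^sup>+x. ennreal \<bar>u x\<bar> \<partial>lborel) * (\<integral>\<^sup>+y. ennreal \<bar>w y\<bar> \<partial>lborel)"
    by (simp add: nn_integral_multc)
  also have "\<dots> = ennreal ((\<integral>x. \<bar>u x\<bar> \<partial>lborel) * (\<integral>x. \<bar>w x\<bar> \<partial>lborel))"
    using u w by (simp add: nn_integral_eq_integral ennreal_mult)
  finally have *: "(\<integral>\<^sup>+p. ennreal \<bar>u (fst p) * w (snd p)\<bar> \<partial>far_measure)
    \<le> ennreal ((\<integral>x. \<bar>u x\<bar> \<partial>lborel) * (\<integral>x. \<bar>w x\<bar> \<partial>lborel))" .
  have **: "(\<integral>\<^sup>+p. ennreal \<bar>u (fst p) * w (snd p)\<bar> \<partial>far_measure) < \<infinity>"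
    using * by (rule le_less_trans) simp
  show i: "integrable far_measure (\<lambda>p. u (fst p) * w (snd p))"
    using ** by (simp add: integrable_iff_bounded)
  show "(\<integral>p. \<bar>u (fst p) * w (snd p)\<bar> \<partial>far_measure) \<le> (\<integral>x. \<bar>u x\<bar> \<partial>lborel) * (\<integral>x. \<bar>w x\<bar> \<partial>lborel)"
    using * i by (subst (asm) nn_integral_eq_integral) (auto simp: ennreal_le_iff)
qed

lemma far_integral_swap:
  fixes u w :: "'a::euclidean_space \<Rightarrow> real"
  assumes [measurable]: "u \<in> borel_measurable borel" "w \<in> borel_measurable borel"
  shows "(\<integral>p. u (fst p) * w (snd p) \<partial>far_measure) = (\<integral>p. w (fst p) * u (snd p) \<partial>far_measure)"
proof -
  let ?f = "\<lambda>p. far_kernel (fst p - snd p) * (u (fst p) * w (snd p))"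
  have "(\<integral>p. u (fst p) * w (snd p) \<partial>far_measure) = (\<integral>p. ?f p \<partial>lborel)"
    unfolding far_measure_def by (subst integral_density) auto
  also have "\<dots> = (\<integral>(x, y). ?f (y, x) \<partial>(lborel \<Otimes>\<^sub>M lborel))"
    using lborel_pair.integral_product_swap[of ?f] by (simp add: lborel_prod)
  also have "\<dots> = (\<integral>p. w (fst p) * u (snd p) \<partial>far_measure)"
    unfolding far_measure_def lborel_prod
    by (subst integral_density)
       (auto simp: case_prod_beta far_kernel_commute mult.commute
           intro!: Bochner_Integration.integral_cong)
  finally show ?thesis .
qed

lemma energy_L_commute:
  "u \<in> borel_measurable borel \<Longrightarrow> w \<in> borel_measurable borel \<Longrightarrow> energy_L u w = energy_L w u"
  by (simp add: energy_L_eq far_integral_swap[of u w] mult.commute)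

text \<open>A divergent Bochner integral is 0, so \<open>energy_L\<close> is additive only where all
  three of its integrals converge. The first argument may be a supersolution that lies in no
  \<open>borel_H \<Omega>\<close>.\<close>

definition form_pair :: "('a::euclidean_space \<Rightarrow> real) \<Rightarrow> ('a \<Rightarrow> real) \<Rightarrow> bool" where
  "form_pair u w \<longleftrightarrow> u \<in> borel_measurable borel \<and> w \<in> borel_measurable borel \<and>
     integrable near_measure (\<lambda>p. increment u p * increment w p) \<and>
     integrable far_measure (\<lambda>p. u (fst p) * w (snd p)) \<and> integrable lborel (\<lambda>x. u x * w x)"

lemma borel_H_form_pair:
  assumes "borel_H \<Omega> u" "borel_H \<Omega> w" "bounded \<Omega>" "open \<Omega>"
  shows "form_pair u w"
  unfolding form_pair_def
proof (intro conjI)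
  show "u \<in> borel_measurable borel" "w \<in> borel_measurable borel"
    using assms borel_H_measurable by auto
  show "integrable near_measure (\<lambda>p. increment u p * increment w p)"
    using assms borel_H_increment by (intro sq_integrable_mult) auto
  show "integrable far_measure (\<lambda>p. u (fst p) * w (snd p))"
    using assms borel_H_integrable by (intro far_product_integrable) auto
  show "integrable lborel (\<lambda>x. u x * w x)"
    using assms borel_H_sq_integrable by (intro sq_integrable_mult) auto
qed

lemma energy_L_add_right:
  assumes "form_pair u v" "form_pair u w"
  shows "energy_L u (\<lambda>x. v x + w x) = energy_L u v + energy_L u w"
    and "form_pair u (\<lambda>x. v x + w x)"
proof -
  have 1: "increment (\<lambda>x. v x + w x) = (\<lambda>p. increment v p + increment w p)"
    by (auto simp: increment_def)
  have m: "(\<lambda>x. v x + w x) \<in> borel_measurable borel"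
    using assms by (auto simp: form_pair_def)
  show "energy_L u (\<lambda>x. v x + w x) = energy_L u v + energy_L u w"
    using assms m unfolding form_pair_def
    by (simp add: energy_L_eq 1 distrib_left)
  show "form_pair u (\<lambda>x. v x + w x)"
    using assms m unfolding form_pair_def by (simp add: 1 distrib_left)
qed

lemma energy_L_scale_right:
  assumes "form_pair u v"
  shows "energy_L u (\<lambda>x. c * v x) = c * energy_L u v" and "form_pair u (\<lambda>x. c * v x)"
proof -
  have 1: "increment (\<lambda>x. c * v x) = (\<lambda>p. c * increment v p)"
    by (auto simp: increment_def algebra_simps)
  have 2: "a * (c * b) = c * (a * b)" for a b :: real by simp
  have m: "(\<lambda>x. c * v x) \<in> borel_measurable borel"
    using assms by (auto simp: form_pair_def)
  show "energy_L u (\<lambda>x. c * v x) = c * energy_L u v"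
    using assms m unfolding form_pair_def
    by (simp add: energy_L_eq 1 2) (simp add: algebra_simps)
  show "form_pair u (\<lambda>x. c * v x)"
    using assms unfolding form_pair_def
    by (auto simp: 1 2)
qed

lemma energy_L_square_expand:
  assumes uu: "form_pair u u" and uw: "form_pair u w" and wu: "form_pair w u"
      and ww: "form_pair w w"
  shows "energy_L (\<lambda>x. u x + t * w x) (\<lambda>x. u x + t * w x)
    = energy_L u u + 2 * t * energy_L u w + t\<^sup>2 * energy_L w w"
proof -
  have m: "u \<in> borel_measurable borel" "w \<in> borel_measurable borel"
    using uw by (auto simp: form_pair_def)
  note r = energy_L_add_right energy_L_scale_right
  let ?v = "\<lambda>x. u x + t * w x"
  have mv: "?v \<in> borel_measurable borel" using m by measurable
  \<comment> \<open>The near and the zero-order integrands are symmetric in the two functions, the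
    far one is not; its integrability is therefore supplied separately.\<close>
  have s: "form_pair b a" if "form_pair a b" "integrable far_measure (\<lambda>p. b (fst p) * a (snd p))"
      for a b :: "'a \<Rightarrow> real"
    using that by (auto simp: form_pair_def mult.commute)
  have f: "integrable far_measure (\<lambda>p. ?v (fst p) * u (snd p))"
      "integrable far_measure (\<lambda>p. ?v (fst p) * w (snd p))"
    using uu uw wu ww by (auto simp: form_pair_def distrib_right mult.assoc)
  have v: "form_pair ?v u" "form_pair ?v w"
    using s[OF r(2)[OF uu r(4)[OF uw]] f(1)] s[OF r(2)[OF wu r(4)[OF ww]] f(2)] by blast+
  have 1: "energy_L ?v ?v = energy_L ?v u + t * energy_L ?v w"
    using r(1)[OF v(1) r(4)[OF v(2), of t]] r(3)[OF v(2), of t] by simp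
  have 2: "energy_L ?v u = energy_L u u + t * energy_L u w"
    using energy_L_commute[OF mv m(1)] r(1)[OF uu r(4)[OF uw, of t]] r(3)[OF uw, of t] by simp
  have 3: "energy_L ?v w = energy_L u w + t * energy_L w w"
    using energy_L_commute[OF mv m(2)] energy_L_commute[OF m]
      r(1)[OF wu r(4)[OF ww, of t]] r(3)[OF ww, of t] by simp
  show ?thesis
    unfolding 1 2 3 by (simp add: power2_eq_square algebra_simps)
qed

section \<open>Compactness of the embedding into square integrable functions\<close>

lemma nn_integral_tendsto_le:
  fixes f :: "nat \<Rightarrow> 'b \<Rightarrow> real"
  assumes [measurable]: "\<And>n. f n \<in> borel_measurable M"
    and lim: "AE x in M. (\<lambda>n. f n x) \<longlonglongrightarrow> g x"
    and le: "\<forall>\<^sub>F n in sequentially. (\<integral>\<^sup>+x. ennreal (f n x) \<partial>M) \<le> C"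
  shows "(\<integral>\<^sup>+x. ennreal (g x) \<partial>M) \<le> C"
proof -
  have "(\<integral>\<^sup>+x. ennreal (g x) \<partial>M) = (\<integral>\<^sup>+x. liminf (\<lambda>n. ennreal (f n x)) \<partial>M)"
    using lim
  proof (intro nn_integral_cong_AE, eventually_elim)
    case (elim x)
    then have "(\<lambda>n. ennreal (f n x)) \<longlonglongrightarrow> ennreal (g x)" by (auto intro: tendsto_ennrealI)
    then show ?case by (rule lim_imp_Liminf[OF sequentially_bot, symmetric])
  qed
  also have "\<dots> \<le> liminf (\<lambda>n. \<integral>\<^sup>+x. ennreal (f n x) \<partial>M)"
    by (rule nn_integral_liminf) auto
  also have "\<dots> \<le> C"
    using Liminf_mono[OF le] Liminf_const[of sequentially C] by simp
  finally show ?thesis .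
qed

lemma integral_abs_le_sqrt:
  assumes f: "sq_integrable M f" and A: "A \<in> sets M" "emeasure M A < \<infinity>"
    and z: "\<And>x. x \<in> space M \<Longrightarrow> x \<notin> A \<Longrightarrow> f x = 0"
  shows "(\<integral>x. \<bar>f x\<bar> \<partial>M) \<le> sqrt (measure M A) * sqrt (\<integral>x. (f x)\<^sup>2 \<partial>M)"
proof -
  have i: "sq_integrable M (indicator A :: _ \<Rightarrow> real)"
    using A by (auto simp: sq_integrable_def power2_eq_square simp flip: indicator_inter_arith)
  have "(\<integral>x. \<bar>f x\<bar> \<partial>M) = (\<integral>x. \<bar>indicator A x\<bar> * \<bar>f x\<bar> \<partial>M)"
    using z by (intro Bochner_Integration.integral_cong) (auto simp: indicator_def)
  also have "\<dots> \<le> sqrt (\<integral>x. (indicator A x)\<^sup>2 \<partial>M) * sqrt (\<integral>x. (f x)\<^sup>2 \<partial>M)"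
    by (rule Cauchy_Schwarz_integral_abs[OF i f])
  also have "(\<integral>x. (indicator A x)\<^sup>2 \<partial>M) = measure M A"
    using A by (simp add: power2_eq_square flip: indicator_inter_arith)
  finally show ?thesis .
qed

text \<open>Riesz-Fischer, in a form that returns one function as mean-square limit of the whole
  sequence and as pointwise limit of a subsequence. Support in a set of finite measure lets the
  increments of the subsequence be summed in L^1.\<close>

lemma square_mean_Cauchy_limit:
  fixes u :: "nat \<Rightarrow> 'b \<Rightarrow> real"
  assumes u: "\<And>n. sq_integrable M (u n)" and A: "A \<in> sets M" "emeasure M A < \<infinity>"
    and z: "\<And>n x. x \<notin> A \<Longrightarrow> u n x = 0"
    and C: "\<And>e. 0 < e \<Longrightarrow> \<exists>k. \<forall>n\<ge>k. \<forall>l\<ge>k. (\<integral>x. (u n x - u l x)\<^sup>2 \<partial>M) \<le> e"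
  obtains v s where "sq_integrable M v" "\<And>x. x \<notin> A \<Longrightarrow> v x = 0" "strict_mono s"
    "AE x in M. (\<lambda>n. u (s n) x) \<longlonglongrightarrow> v x" "(\<lambda>n. \<integral>x. (u n x - v x)\<^sup>2 \<partial>M) \<longlonglongrightarrow> 0"
proof -
  have [measurable]: "u n \<in> borel_measurable M" for n
    using u by (simp add: sq_integrable_def)
  have d: "sq_integrable M (\<lambda>x. u n x - u l x)" for n l
    by (intro sq_integrable_diff u)
  \<comment> \<open>The tolerance is (1/4)^j because its square root has to be summable in
    j.\<close>
  have "\<forall>j. \<exists>k. \<forall>n\<ge>k. \<forall>l\<ge>k. (\<integral>x. (u n x - u l x)\<^sup>2 \<partial>M) \<le> (1/4) ^ j"
    by (intro allI C) simp
  then obtain K where K: "\<And>j n l. K j \<le> n \<Longrightarrow> K j \<le> l \<Longrightarrow> (\<integral>x. (u n x - u l x)\<^sup>2 \<partial>M) \<le> (1/4) ^ j"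
    by metis
  \<comment> \<open>Partial sums make s strictly increasing and keep s j above K j.\<close>
  define s where "s j = (\<Sum>i\<le>j. Suc (K i))" for j
  have s: "strict_mono s" by (intro strict_monoI_Suc) (simp add: s_def)
  have sK: "K j \<le> s j" for j
  proof -
    have "Suc (K j) \<le> s j" unfolding s_def by (rule member_le_sum) auto
    then show ?thesis by simp
  qed
  define g where "g j x = \<bar>u (s (Suc j)) x - u (s j) x\<bar>" for j x
  have g0: "0 \<le> g j x" for j x by (simp add: g_def)
  have gm [measurable]: "g j \<in> borel_measurable M" for j unfolding g_def by measurable
  have gi: "(\<integral>\<^sup>+x. ennreal (g j x) \<partial>M) \<le> ennreal (sqrt (measure M A) * (1/2) ^ j)" for j
  proof -
    have int: "integrable M (g j)"
      unfolding g_def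
      by (rule integrable_abs, rule sq_integrable_imp_integrable_on[OF d A]) (simp add: z)
    have "(\<integral>x. (u (s (Suc j)) x - u (s j) x)\<^sup>2 \<partial>M) \<le> (1/4) ^ j"
      using sK[of j] strict_monoD[OF s, of j "Suc j"] by (intro K) auto
    then have "sqrt (\<integral>x. (u (s (Suc j)) x - u (s j) x)\<^sup>2 \<partial>M) \<le> sqrt ((1/4) ^ j)"
      by simp
    also have "sqrt ((1/4) ^ j) = (1/2) ^ j"
      by (simp add: real_sqrt_power real_sqrt_divide)
    finally have "(\<integral>x. g j x \<partial>M) \<le> sqrt (measure M A) * (1/2) ^ j"
      unfolding g_def using integral_abs_le_sqrt[OF d[of "s (Suc j)" "s j"] A] z
      by (smt (verit) mult_left_mono measure_nonneg real_sqrt_ge_zero)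
    then show ?thesis
      using int by (subst nn_integral_eq_integral) (auto simp: g0 intro!: ennreal_leI)
  qed
  have "(\<integral>\<^sup>+x. (\<Sum>j. ennreal (g j x)) \<partial>M) = (\<Sum>j. \<integral>\<^sup>+x. ennreal (g j x) \<partial>M)"
    by (rule nn_integral_suminf) simp
  also have "\<dots> \<le> (\<Sum>j. ennreal (sqrt (measure M A) * (1/2) ^ j))"
    by (rule suminf_le) (auto intro: gi)
  also have "\<dots> < \<infinity>"
    by (subst suminf_ennreal2) (auto intro!: summable_mult summable_geometric)
  finally have "AE x in M. (\<Sum>j. ennreal (g j x)) \<noteq> \<infinity>"
    by (intro nn_integral_PInf_AE) auto
  then have conv: "AE x in M. convergent (\<lambda>j. u (s j) x)"
  proof eventually_elim
    case (elim x)
    then have "summable (\<lambda>j. g j x)"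
      by (intro summable_suminf_not_top) (auto simp: g_def)
    then have "summable (\<lambda>j. u (s (Suc j)) x - u (s j) x)"
      unfolding g_def by (rule summable_rabs_cancel)
    then have "convergent (\<lambda>n. \<Sum>j<n. u (s (Suc j)) x - u (s j) x)"
      by (simp add: summable_iff_convergent)
    then have "convergent (\<lambda>n. u (s n) x - u (s 0) x)"
      by (simp add: sum_lessThan_telescope[of "\<lambda>j. u (s j) x"])
    then have "convergent (\<lambda>n. (u (s n) x - u (s 0) x) + u (s 0) x)"
      by (intro convergent_add convergent_const)
    then show ?case by simp
  qed
  define v where "v x = lim (\<lambda>j. u (s j) x) * indicator A x" for x
  have [measurable]: "v \<in> borel_measurable M" unfolding v_def using A by measurable
  have lim: "AE x in M. (\<lambda>j. u (s j) x) \<longlonglongrightarrow> v x"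
    using conv by eventually_elim (auto simp: v_def indicator_def z convergent_LIMSEQ_iff)
  \<comment> \<open>Fatou along the subsequence passes the Cauchy bound to the limit.\<close>
  have close: "(\<integral>\<^sup>+x. ennreal ((u n x - v x)\<^sup>2) \<partial>M) \<le> ennreal e"
    if "\<forall>n\<ge>k. \<forall>l\<ge>k. (\<integral>x. (u n x - u l x)\<^sup>2 \<partial>M) \<le> e" "k \<le> n" for n k e
  proof (rule nn_integral_tendsto_le[where f="\<lambda>j x. (u n x - u (s j) x)\<^sup>2"])
    show "AE x in M. (\<lambda>j. (u n x - u (s j) x)\<^sup>2) \<longlonglongrightarrow> (u n x - v x)\<^sup>2"
      using lim by eventually_elim (auto intro!: tendsto_intros)
    show "\<forall>\<^sub>F j in sequentially. (\<integral>\<^sup>+x. ennreal ((u n x - u (s j) x)\<^sup>2) \<partial>M) \<le> ennreal e"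
      using eventually_ge_at_top[of k]
    proof eventually_elim
      case (elim j)
      then have "k \<le> s j" using seq_suble[OF s, of j] by simp
      then show ?case
        using that sq_integrable_sq[OF d]
        by (subst nn_integral_eq_integral) (auto intro!: ennreal_leI)
    qed
  qed measurable
  have dv: "sq_integrable M (\<lambda>x. u n x - v x)" if "\<forall>n\<ge>k. \<forall>l\<ge>k. (\<integral>x. (u n x - u l x)\<^sup>2 \<partial>M) \<le> e" "k
      \<le> n" for n k e
    using close[OF that] by (auto simp: sq_integrable_iff_nn intro: le_less_trans)
  obtain k1 where k1: "\<forall>n\<ge>k1. \<forall>l\<ge>k1. (\<integral>x. (u n x - u l x)\<^sup>2 \<partial>M) \<le> 1"
    using C[of 1] by auto
  have v: "sq_integrable M v"
    using sq_integrable_diff[OF u[of k1] dv[OF k1, of k1]] by simp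
  have "(\<lambda>n. \<integral>x. (u n x - v x)\<^sup>2 \<partial>M) \<longlonglongrightarrow> 0"
  proof (rule LIMSEQ_I)
    fix e :: real assume "0 < e"
    then obtain k where k: "\<forall>n\<ge>k. \<forall>l\<ge>k. (\<integral>x. (u n x - u l x)\<^sup>2 \<partial>M) \<le> e / 2"
      using C[of "e/2"] by auto
    show "\<exists>k. \<forall>n\<ge>k. norm ((\<integral>x. (u n x - v x)\<^sup>2 \<partial>M) - 0) < e"
    proof (intro exI allI impI)
      fix n assume n: "k \<le> n"
      have "ennreal (\<integral>x. (u n x - v x)\<^sup>2 \<partial>M) \<le> ennreal (e/2)"
        using close[OF k n] sq_integrable_sq[OF dv[OF k n]]
            by (subst (asm) nn_integral_eq_integral) auto
      then have "(\<integral>x. (u n x - v x)\<^sup>2 \<partial>M) \<le> e/2" using \<open>0 < e\<close> by (subst (asm) ennreal_le_iff) auto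
      then show "norm ((\<integral>x. (u n x - v x)\<^sup>2 \<partial>M) - 0) < e" using \<open>0 < e\<close> by simp
    qed
  qed
  then show ?thesis
    using that[OF v _ s lim] by (simp add: v_def)
qed

lemma emeasure_cball_finite: "emeasure lborel (cball (a::'a::euclidean_space) r) < top"
  using emeasure_bounded_finite[OF bounded_cball] by auto

text \<open>Truncations of the kernel whose integrals diverge; this divergence is the source of
  compactness.\<close>

definition trunc_kernel :: "nat \<Rightarrow> 'a::euclidean_space \<Rightarrow> real" where
  "trunc_kernel m z = max 0 (1 - norm z) / max ((1/2) ^ m) (norm z) ^ DIM('a)"

lemma trunc_kernel_nonneg: "0 \<le> trunc_kernel m z"
  by (auto simp: trunc_kernel_def le_max_iff_disj intro!: divide_nonneg_nonneg zero_le_power)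

lemma trunc_kernel_continuous: "continuous_on A (trunc_kernel m)"
proof -
  have "max ((1/2) ^ m) (norm z) \<noteq> 0" for z :: 'a
    by (smt (verit) zero_less_power max_def half_gt_zero_iff)
  then show ?thesis
    unfolding trunc_kernel_def by (intro continuous_intros) auto
qed

lemma trunc_kernel_measurable [measurable]: "trunc_kernel m \<in> borel_measurable borel"
  by (intro borel_measurable_continuous_onI trunc_kernel_continuous)

lemma trunc_kernel_le:
  fixes z :: "'a::euclidean_space"
  shows "trunc_kernel m z \<le> 2 ^ (m * DIM('a)) * indicator (cball 0 1) z"
proof -
  have "trunc_kernel m z \<le> indicator (cball 0 1) z / ((1/2) ^ m) ^ DIM('a)"
    unfolding trunc_kernel_def
    by (intro frac_le power_mono) (auto simp: indicator_def)
  then show ?thesis by (simp add: power_mult power_one_over field_simps)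
qed

lemma trunc_kernel_le_near_kernel:
  assumes "z \<noteq> 0" shows "trunc_kernel m z \<le> near_kernel z"
  unfolding trunc_kernel_def near_kernel_def
  using assms by (intro frac_le power_mono) (auto simp: indicator_def)

lemma trunc_kernel_integrable: "integrable lborel (trunc_kernel m :: 'a::euclidean_space \<Rightarrow> real)"
proof (rule Bochner_Integration.integrable_bound)
  show "integrable lborel (\<lambda>z::'a. 2 ^ (m * DIM('a)) * indicator (cball 0 1) z :: real)"
    by (intro integrable_mult_right integrable_real_indicator) (auto simp: emeasure_cball_finite)
  show "AE z in lborel. norm (trunc_kernel m (z::'a))
      \<le> norm (2 ^ (m * DIM('a)) * indicator (cball 0 1) z :: real)"
    using trunc_kernel_le[where 'a='a] trunc_kernel_nonneg[where 'a='a]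
        by (intro AE_I2) (auto simp: abs_mult)
qed simp

text \<open>Halving the truncation radius adds a fixed mass: on the new ball of radius r the kernel
  grows by at least a quarter of r^(-N), and the ball has measure r^N times that of the unit ball.
  This is the logarithmic divergence of the kernel, one dyadic scale at a time.\<close>

lemma trunc_kernel_integral_ge:
  "real m * (unit_ball_vol (real DIM('a)) / 4)
    \<le> (\<integral>z. trunc_kernel m z \<partial>(lborel :: 'a::euclidean_space measure))"
proof (induction m)
  case 0
  show ?case by (simp add: trunc_kernel_nonneg)
next
  case (Suc m)
  let ?N = "DIM('a)" and ?r = "(1/2::real) ^ Suc m"
  let ?B = "2 ^ (Suc m * ?N) / 4 :: real"
  have r: "0 < ?r" "?r \<le> 1/2" "?r \<le> (1/2) ^ m"
    by (auto simp: power_le_one)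
  have pt: "trunc_kernel m z + ?B * indicator (cball 0 ?r) z \<le> trunc_kernel (Suc m) z" for z :: 'a
  proof (cases "norm z \<le> ?r")
    case True
    have e1: "max ?r (norm z) = ?r" "max ((1/2) ^ m) (norm z) = (1/2) ^ m"
      using True r by (intro max_absorb1; linarith)+
    have "trunc_kernel (Suc m) z = max 0 (1 - norm z) * 2 ^ (Suc m * ?N)"
      unfolding trunc_kernel_def e1 by (simp only: power_one_over power_mult) simp
    moreover have "trunc_kernel m z = max 0 (1 - norm z) * 2 ^ (m * ?N)"
      unfolding trunc_kernel_def e1 by (simp only: power_one_over power_mult) simp
    \<comment> \<open>Since N is at least 1, the plateau at least doubles in height. Together with 1
      - |z| \<ge> 1/2 this gives the quarter in \<open>?B\<close>.\<close>
    moreover have "(2::real) ^ (m * ?N) \<le> 2 ^ (Suc m * ?N) / 2"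
    proof -
      have "(2::real) ^ (m * ?N + 1) \<le> 2 ^ (Suc m * ?N)"
        using DIM_ge_1[where 'a='a] by (intro power_increasing) auto
      then show ?thesis by simp
    qed
    moreover have "(1/2) * (2 ^ (Suc m * ?N) / 2)
       \<le> max 0 (1 - norm z) * (2 ^ (Suc m * ?N) - 2 ^ (m * ?N) :: real)"
      using True r calculation(3) by (intro mult_mono) auto
    ultimately show ?thesis using True by (simp add: algebra_simps)
  next
    case False
    then have "0 < norm z" using r by linarith
    then have "trunc_kernel m z \<le> trunc_kernel (Suc m) z"
      unfolding trunc_kernel_def using r False by (intro frac_le power_mono) auto
    then show ?thesis using False by simp
  qed
  have i: "integrable lborel (\<lambda>z::'a. ?B * indicator (cball 0 ?r) z)"
    by (intro integrable_mult_right integrable_real_indicator) (auto simp: emeasure_cball_finite)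
  have "?B * measure lborel (cball (0::'a) ?r) = unit_ball_vol (real ?N) / 4"
    using r by (simp only: content_cball[OF less_imp_le[OF r(1)]] power_mult)
        (simp add: power_one_over power_mult_distrib)
  moreover have "(\<integral>z. trunc_kernel m (z::'a) + ?B * indicator (cball 0 ?r) z \<partial>lborel)
      \<le> (\<integral>z. trunc_kernel (Suc m) (z::'a) \<partial>lborel)"
    by (rule integral_mono[OF Bochner_Integration.integrable_add[OF trunc_kernel_integrable i]
          trunc_kernel_integrable pt])
  moreover have "(\<integral>z. trunc_kernel m (z::'a) + ?B * indicator (cball 0 ?r) z \<partial>lborel)
     = (\<integral>z. trunc_kernel m (z::'a) \<partial>lborel) + ?B * measure lborel (cball (0::'a) ?r)"
    by (subst Bochner_Integration.integral_add[OF trunc_kernel_integrable i]) simp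
  ultimately show ?case using Suc by (simp add: algebra_simps del: power_Suc)
qed

text \<open>Expand (w(x) - w(y))^2 against h(x - y): the squares give the mass of h times the
  squared L^2 norm, the mixed term is the pairing of w with its convolution by h. If h has large
  mass and the convolution is small on the support of w, then bounded energy forces w to be small in
  L^2.\<close>

lemma kernel_square_identity_le:
  fixes h w :: "'a::euclidean_space \<Rightarrow> real"
  assumes [measurable]: "h \<in> borel_measurable borel" "w \<in> borel_measurable borel"
    and h: "\<And>z. 0 \<le> h z" "\<And>z. z \<noteq> 0 \<Longrightarrow> h z \<le> near_kernel z" "integrable lborel h"
    and w: "sq_integrable lborel w" "integrable lborel w"
        and inc: "sq_integrable near_measure (increment w)"
    and s: "\<And>x. w x \<noteq> 0 \<Longrightarrow> \<bar>\<integral>y. h (x - y) * w y \<partial>lborel\<bar> \<le> s"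
  shows "(\<integral>z. h z \<partial>lborel) * (\<integral>x. (w x)\<^sup>2 \<partial>lborel)
    \<le> (\<integral>p. (increment w p)\<^sup>2 \<partial>near_measure) / 2 + s * (\<integral>x. \<bar>w x\<bar> \<partial>lborel)"
proof -
  define \<mu> where "\<mu> = density (lborel :: ('a \<times> 'a) measure) (\<lambda>p. ennreal (h (fst p - snd p)))"
  have [measurable_cong, simp]: "sets \<mu> = sets borel" by (simp add: \<mu>_def)
  define H I where "H = (\<integral>z. h z \<partial>lborel)" and "I = (\<integral>x. (w x)\<^sup>2 \<partial>lborel)"
  have nn: "(\<integral>\<^sup>+p. F p \<partial>\<mu>) = (\<integral>\<^sup>+z. ennreal (h z) * (\<integral>\<^sup>+x. F (x, x - z) \<partial>lborel) \<partial>lborel)"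
    if [measurable]: "F \<in> borel_measurable borel" for F
    unfolding \<mu>_def using nn_integral_lborel_kernel[of "\<lambda>z. ennreal (h z)" F]
    by (subst nn_integral_density) auto
  have I: "(\<integral>\<^sup>+x. ennreal ((w x)\<^sup>2) \<partial>lborel) = ennreal I"
    unfolding I_def using w by (intro nn_integral_eq_integral) (auto simp: sq_integrable_def)
  have H: "(\<integral>\<^sup>+z. ennreal (h z) \<partial>lborel) = ennreal H"
    unfolding H_def using h by (intro nn_integral_eq_integral) auto
  have HI: "0 \<le> H" "0 \<le> I" by (auto simp: H_def I_def h)
  have n1: "(\<integral>\<^sup>+p. ennreal ((w (fst p))\<^sup>2) \<partial>\<mu>) = ennreal (H * I)"
    using HI by (subst nn) (auto simp: I H nn_integral_multc ennreal_mult)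
  have n2: "(\<integral>\<^sup>+p. ennreal ((w (snd p))\<^sup>2) \<partial>\<mu>) = ennreal (H * I)"
  proof -
    have "(\<integral>\<^sup>+x. ennreal ((w (x - z))\<^sup>2) \<partial>lborel) = ennreal I" for z
      using nn_integral_lborel_shift[of "\<lambda>x. ennreal ((w x)\<^sup>2)" "- z"] I by simp
    then show ?thesis
      using HI by (subst nn) (auto simp: H nn_integral_multc ennreal_mult)
  qed
  have s1: "sq_integrable \<mu> (\<lambda>p. w (fst p))" and s2: "sq_integrable \<mu> (\<lambda>p. w (snd p))"
    using n1 n2 by (auto simp: sq_integrable_iff_nn)
  have i1: "(\<integral>p. (w (fst p))\<^sup>2 \<partial>\<mu>) = H * I"
    using n1 HI by (intro integral_eq_nn_integral[THEN trans]) auto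
  have i2: "(\<integral>p. (w (snd p))\<^sup>2 \<partial>\<mu>) = H * I"
    using n2 HI by (intro integral_eq_nn_integral[THEN trans]) auto
  have i12: "integrable \<mu> (\<lambda>p. w (fst p) * w (snd p))" by (rule sq_integrable_mult[OF s1 s2])
  have "(\<integral>p. (increment w p)\<^sup>2 \<partial>\<mu>)
      = (\<integral>p. (w (fst p))\<^sup>2 + (w (snd p))\<^sup>2 - 2 * (w (fst p) * w (snd p)) \<partial>\<mu>)"
    by (intro Bochner_Integration.integral_cong) (auto simp: increment_def power2_diff)
  also have "\<dots> = H * I + H * I - 2 * (\<integral>p. w (fst p) * w (snd p) \<partial>\<mu>)"
    using s1[THEN sq_integrable_sq] s2[THEN sq_integrable_sq] i12 by (simp add: i1 i2)
  finally have 1: "H * I = (\<integral>p. (increment w p)\<^sup>2 \<partial>\<mu>) / 2 + (\<integral>p. w (fst p) * w (snd p) \<partial>\<mu>)"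
    by (simp add: field_simps)
  have "(\<integral>\<^sup>+p. ennreal ((increment w p)\<^sup>2) \<partial>\<mu>) \<le> (\<integral>\<^sup>+p. ennreal ((increment w p)\<^sup>2) \<partial>near_measure)"
    unfolding \<mu>_def near_measure_def
  proof (subst (1 2) nn_integral_density, measurable, intro nn_integral_mono)
    fix p :: "'a \<times> 'a"
    show "ennreal (h (fst p - snd p)) * ennreal ((increment w p)\<^sup>2)
      \<le> ennreal (near_kernel (fst p - snd p)) * ennreal ((increment w p)\<^sup>2)"
    proof (cases "fst p = snd p")
      case False
      then show ?thesis using h(2)[of "fst p - snd p"] by (intro mult_right_mono ennreal_leI) auto
    qed (simp add: increment_def)
  qed
  also have "\<dots> = ennreal (\<integral>p. (increment w p)\<^sup>2 \<partial>near_measure)"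
    using inc by (intro nn_integral_eq_integral) (auto simp: sq_integrable_def)
  finally have 2: "(\<integral>p. (increment w p)\<^sup>2 \<partial>\<mu>) \<le> (\<integral>p. (increment w p)\<^sup>2 \<partial>near_measure)"
    by (intro integral_real_bounded) auto
  have int: "integrable (lborel \<Otimes>\<^sub>M lborel) (\<lambda>p. h (fst p - snd p) * (w (fst p) * w (snd p)))"
    using i12 unfolding \<mu>_def lborel_prod by (subst (asm) integrable_density) (auto simp: h)
  have "(\<integral>p. w (fst p) * w (snd p) \<partial>\<mu>) = (\<integral>p. h (fst p - snd p)
      * (w (fst p) * w (snd p)) \<partial>(lborel \<Otimes>\<^sub>M lborel))"
    unfolding \<mu>_def lborel_prod by (subst integral_density) (auto simp: h)
  also have "\<dots> = (\<integral>x. \<integral>y. h (x - y) * (w x * w y) \<partial>lborel \<partial>lborel)"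
    using lborel_pair.integral_fst'[OF int] by simp
  also have "\<dots> \<le> (\<integral>x. s * \<bar>w x\<bar> \<partial>lborel)"
  proof (rule integral_mono)
    show "integrable lborel (\<lambda>x. \<integral>y. h (x - y) * (w x * w y) \<partial>lborel)"
      using lborel_pair.integrable_fst'[OF int] by simp
    show "integrable lborel (\<lambda>x. s * \<bar>w x\<bar>)" using w by auto
    fix x
    have "(\<integral>y. h (x - y) * (w x * w y) \<partial>lborel) = w x * (\<integral>y. h (x - y) * w y \<partial>lborel)"
      by (subst integral_mult_right_zero[symmetric]) (simp add: mult_ac)
    also have "\<dots> \<le> \<bar>w x\<bar> * s"
    proof (cases "w x = 0")
      case False
      then have "\<bar>w x\<bar> * \<bar>\<integral>y. h (x - y) * w y \<partial>lborel\<bar> \<le> \<bar>w x\<bar> * s"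
        by (intro mult_left_mono s) auto
      then show ?thesis by (metis abs_mult abs_ge_self order_trans)
    qed simp
    finally show "(\<integral>y. h (x - y) * (w x * w y) \<partial>lborel) \<le> s * \<bar>w x\<bar>" by (simp add: mult.commute)
  qed
  also have "\<dots> = s * (\<integral>x. \<bar>w x\<bar> \<partial>lborel)" by simp
  finally show ?thesis using 1 2 by (simp add: H_def[symmetric] I_def[symmetric])
qed

lemma integral_square_diff_le:
  assumes "sq_integrable M f" "sq_integrable M g"
  shows "(\<integral>x. (f x - g x)\<^sup>2 \<partial>M) \<le> 2 * (\<integral>x. (f x)\<^sup>2 \<partial>M) + 2 * (\<integral>x. (g x)\<^sup>2 \<partial>M)"
  using integral_square_sum_le[OF assms(1) sq_integrable_scale[OF assms(2), of "-1"]] by simp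

lemma increment_diff: "increment (\<lambda>x. u x - v x) = (\<lambda>p. increment u p - increment v p)"
  by (auto simp: increment_def)

lemma integral_tendsto_le:
  fixes f :: "nat \<Rightarrow> 'b \<Rightarrow> real"
  assumes f: "\<And>n. integrable M (f n)" "\<And>n x. 0 \<le> f n x"
    and lim: "AE x in M. (\<lambda>n. f n x) \<longlonglongrightarrow> g x"
    and le: "\<forall>\<^sub>F n in sequentially. (\<integral>x. f n x \<partial>M) \<le> C"
    and [measurable]: "g \<in> borel_measurable M"
  shows "integrable M g \<and> (\<integral>x. g x \<partial>M) \<le> C"
proof -
  have C: "0 \<le> C"
  proof (rule ccontr)
    assume "\<not> 0 \<le> C"
    then have "\<forall>\<^sub>F n in sequentially. False"
      by (intro eventually_mono[OF le]) (smt (verit) Bochner_Integration.integral_nonneg f(2))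
    then show False by simp
  qed
  have g0: "AE x in M. 0 \<le> g x"
    using lim by eventually_elim (rule LIMSEQ_le_const, use f(2) in auto)
  have "(\<integral>\<^sup>+x. ennreal (g x) \<partial>M) \<le> ennreal C"
  proof (rule nn_integral_tendsto_le[OF _ lim])
    show "\<forall>\<^sub>F n in sequentially. (\<integral>\<^sup>+x. ennreal (f n x) \<partial>M) \<le> ennreal C"
      using le by eventually_elim (subst nn_integral_eq_integral, use f in \<open>auto intro:
          ennreal_leI\<close>)
  qed (use f in auto)
  moreover from this have i: "integrable M g"
    using g0 by (intro integrableI_nonneg) (auto intro: le_less_trans)
  ultimately show ?thesis
    using g0 C by (subst (asm) nn_integral_eq_integral) (auto simp: ennreal_le_iff)
qed

lemma sqrt_integral_square_triangle:
  assumes f: "sq_integrable M f" and g: "sq_integrable M g"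
  shows "\<bar>sqrt (\<integral>x. (f x)\<^sup>2 \<partial>M) - sqrt (\<integral>x. (g x)\<^sup>2 \<partial>M)\<bar> \<le> sqrt (\<integral>x. (f x - g x)\<^sup>2 \<partial>M)"
proof -
  have *: "sqrt (\<integral>x. (f x)\<^sup>2 \<partial>M) - sqrt (\<integral>x. (g x)\<^sup>2 \<partial>M) \<le> sqrt (\<integral>x. (f x - g x)\<^sup>2 \<partial>M)"
    if f: "sq_integrable M f" and g: "sq_integrable M g" for f g
  proof -
    let ?a = "\<integral>x. (f x - g x)\<^sup>2 \<partial>M" and ?b = "\<integral>x. (g x)\<^sup>2 \<partial>M"
    have d: "sq_integrable M (\<lambda>x. f x - g x)" using f g by (rule sq_integrable_diff)
    have "(\<integral>x. (f x)\<^sup>2 \<partial>M) = (\<integral>x. (f x - g x)\<^sup>2 + 2 * ((f x - g x) * g x) + (g x)\<^sup>2 \<partial>M)"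
      by (rule Bochner_Integration.integral_cong) (auto simp: power2_eq_square algebra_simps)
    also have "\<dots> = ?a + 2 * (\<integral>x. (f x - g x) * g x \<partial>M) + ?b"
      using sq_integrable_mult[OF d g] d g by (simp add: sq_integrable_sq)
    also have "(\<integral>x. (f x - g x) * g x \<partial>M) \<le> sqrt ?a * sqrt ?b"
      using real_le_rsqrt[OF Cauchy_Schwarz_integral[OF d g]] by (simp add: real_sqrt_mult)
    finally have "(\<integral>x. (f x)\<^sup>2 \<partial>M) \<le> (sqrt ?a + sqrt ?b)\<^sup>2" by (simp add: power2_sum)
    then have "sqrt (\<integral>x. (f x)\<^sup>2 \<partial>M) \<le> sqrt ?a + sqrt ?b" by (intro real_le_lsqrt) auto
    then show ?thesis by simp
  qed
  show ?thesis using *[OF f g] *[OF g f] by (simp add: power2_commute[of "g _"] abs_le_iff)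
qed

text \<open>Convolutions with every truncated kernel, evaluated on a countable dense set, converge
  along one diagonal subsequence. Uniform continuity of the kernel spreads the smallness of
  differences from finitely many of these points over \<Omega>, and
  \<open>kernel_square_identity_le\<close> with a truncation of large mass turns it into an L^2
  estimate.\<close>

lemma borel_H_bounded_energy_subsequence:
  fixes u :: "nat \<Rightarrow> 'a::euclidean_space \<Rightarrow> real"
  assumes \<Omega>: "bounded \<Omega>" "open \<Omega>" and u: "\<And>n. borel_H \<Omega> (u n)"
    and u1: "\<And>n. (\<integral>x. (u n x)\<^sup>2 \<partial>lborel) \<le> 1"
    and C: "\<And>n. (\<integral>p. (increment (u n) p)\<^sup>2 \<partial>near_measure) \<le> C"
  obtains r :: "nat \<Rightarrow> nat" where "strict_mono r"
    "\<And>e. 0 < e \<Longrightarrow> \<exists>k. \<forall>n\<ge>k. \<forall>l\<ge>k. (\<integral>x. (u (r n) x - u (r l) x)\<^sup>2 \<partial>lborel) \<le> e"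
proof -
  have um [measurable]: "u n \<in> borel_measurable borel" for n using u by (rule borel_H_measurable)
  have usq: "sq_integrable lborel (u n)" for n using borel_H_sq_integrable[OF u] \<Omega> by simp
  have ui: "integrable lborel (u n)" for n using borel_H_integrable[OF u] \<Omega> by simp
  have u0: "u n x = 0" if "x \<notin> \<Omega>" for n x using borel_H_zero[OF u that] .
  obtain R where R: "0 < R" "\<And>x. x \<in> \<Omega> \<Longrightarrow> norm x < R"
    using \<Omega>(1) unfolding bounded_pos_less by blast
  have fin: "\<Omega> \<in> sets lborel" "emeasure lborel \<Omega> < \<infinity>"
    using \<Omega> emeasure_bounded_finite by auto
  define A where "A = sqrt (measure lborel \<Omega>)"
  have A: "0 \<le> A" by (simp add: A_def)
  have uA: "(\<integral>x. \<bar>u n x\<bar> \<partial>lborel) \<le> A" for n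
  proof -
    have "(\<integral>x. \<bar>u n x\<bar> \<partial>lborel) \<le> A * sqrt (\<integral>x. (u n x)\<^sup>2 \<partial>lborel)"
      unfolding A_def by (rule integral_abs_le_sqrt[OF usq fin]) (rule u0)
    also have "\<dots> \<le> A * 1" using u1[of n] A by (intro mult_left_mono) auto
    finally show ?thesis by simp
  qed
  obtain D :: "'a set" where D: "countable D" "\<And>X. open X \<Longrightarrow> X \<noteq> {} \<Longrightarrow> \<exists>d\<in>D. d \<in> X"
    using countable_dense_exists by (metis (no_types, lifting))
  define B :: "nat \<Rightarrow> real" where "B m = 2 ^ (m * DIM('a))" for m
  have B: "0 < B m" for m by (simp add: B_def)
  define G where "G n m q = (\<integral>y. trunc_kernel m (q - y) * u n y \<partial>lborel)" for n m and q :: 'a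
  have kB: "\<bar>trunc_kernel m z\<bar> \<le> B m" for m and z :: 'a
    using trunc_kernel_le[of m z] trunc_kernel_nonneg[of m z] B[of m]
    by (cases "norm z \<le> 1") (auto simp: B_def)
  have Gi: "integrable lborel (\<lambda>y. trunc_kernel m (q - y) * u n y)" for n m and q :: 'a
  proof (rule Bochner_Integration.integrable_bound)
    show "integrable lborel (\<lambda>y. B m * u n y)" using ui by auto
    show "AE y in lborel. norm (trunc_kernel m (q - y) * u n y) \<le> norm (B m * u n y)"
      using kB B[of m] by (intro AE_I2) (auto simp: abs_mult intro!: mult_right_mono)
  qed measurable
  have GB: "\<bar>G n m q\<bar> \<le> B m * A" for n m and q :: 'a
  proof -
    have "\<bar>G n m q\<bar> \<le> (\<integral>y. \<bar>trunc_kernel m (q - y) * u n y\<bar> \<partial>lborel)"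
      unfolding G_def by (rule integral_abs_bound)
    also have "\<dots> \<le> (\<integral>y. B m * \<bar>u n y\<bar> \<partial>lborel)"
      using integrable_abs[OF Gi[of m q n]] ui kB
      by (intro integral_mono) (auto simp: abs_mult intro!: mult_right_mono)
    also have "\<dots> \<le> B m * A" using uA B[of m] by (simp add: mult_left_mono)
    finally show ?thesis .
  qed
  \<comment> \<open>Dividing by the sup bound \<open>B m\<close> leaves values bounded by the single
    constant A, as the extraction of a diagonal subsequence demands.\<close>
  obtain r :: "nat \<Rightarrow> nat" where r: "strict_mono r"
    and rconv: "\<And>mq. mq \<in> UNIV \<times> D \<Longrightarrow> \<exists>l. (\<lambda>n. G (r n) (fst mq) (snd mq) / B (fst mq)) \<longlonglongrightarrow> l"
  proof (rule function_convergent_subsequence[where S="UNIV \<times> D" and M=A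
        and f="\<lambda>n (mq :: nat \<times> 'a). G n (fst mq) (snd mq) / B (fst mq)"])
    show "countable (UNIV \<times> D :: (nat \<times> 'a) set)" using D(1) by auto
    show "norm (G n (fst mq) (snd mq) / B (fst mq)) \<le> A" for n and mq :: "nat \<times> 'a"
      using GB[of n "fst mq" "snd mq"] B[of "fst mq"] by (simp add: divide_le_eq mult.commute)
  qed blast
  have cauchy: "\<exists>k. \<forall>n\<ge>k. \<forall>l\<ge>k. \<bar>G (r n) m q - G (r l) m q\<bar> \<le> \<delta>"
    if q: "q \<in> D" and "0 < \<delta>" for m q and \<delta> :: real
  proof -
    obtain l where "(\<lambda>n. G (r n) m q / B m) \<longlonglongrightarrow> l" using rconv[of "(m, q)"] q by auto
    then have "(\<lambda>n. B m * (G (r n) m q / B m)) \<longlonglongrightarrow> B m * l" by (rule tendsto_mult_left)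
    then have "Cauchy (\<lambda>n. G (r n) m q)" using B[of m] by (intro LIMSEQ_imp_Cauchy) auto
    then show ?thesis using \<open>0 < \<delta>\<close> unfolding Cauchy_def dist_real_def by (meson less_imp_le)
  qed
  show ?thesis
  proof (rule that[OF r])
    fix e :: real assume e: "0 < e"
    have C0: "0 \<le> C" using C[of 0] by (rule order_trans[rotated]) simp
    define c0 where "c0 = unit_ball_vol (real DIM('a)) / 4"
    have c0: "0 < c0" by (simp add: c0_def)
    \<comment> \<open>Differences have energy at most 4 C, and half of it is to be absorbed in H e /
      2, so H must reach 4 C / e. The added 1 keeps H positive when C = 0.\<close>
    obtain m :: nat where m: "(4 * C / e + 1) / c0 < real m" using reals_Archimedean2 by blast
    define H where "H = (\<integral>z. trunc_kernel m (z::'a) \<partial>lborel)"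
    have "4 * C / e + 1 < real m * c0" using m c0 by (simp add: divide_less_eq)
    also have "\<dots> \<le> H" unfolding H_def c0_def by (rule trunc_kernel_integral_ge)
    finally have H1: "4 * C / e + 1 < H" .
    have "0 \<le> 4 * C / e" using C0 e by simp
    then have H: "0 < H" "4 * C / e \<le> H" using H1 by linarith+
    then have H2: "2 * C \<le> H * (e / 2)" using e by (simp add: divide_le_eq mult.commute)
    \<comment> \<open>Makes the second error, \<delta> (2 A + 1) 2 A, at most H e / 2; A + 1 instead
      of A keeps the denominator positive.\<close>
    define \<delta> where "\<delta> = H * e / (4 * (2 * A + 1) * (A + 1))"
    have \<delta>: "0 < \<delta>" using H e A by (simp add: \<delta>_def)
    have "\<delta> * (2 * A + 1) * (2 * A) \<le> \<delta> * (2 * A + 1) * (2 * (A + 1))"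
      using \<delta> A by (intro mult_left_mono) auto
    also have "\<dots> = 2 * (\<delta> * ((2 * A + 1) * (A + 1)))" by (simp add: algebra_simps)
    also have "\<delta> * ((2 * A + 1) * (A + 1)) = H * e / 4"
    proof -
      have "(2 * A + 1) * (A + 1) \<noteq> 0" using A by (simp add: add_nonneg_eq_0_iff)
      then show ?thesis unfolding \<delta>_def mult.assoc[of 4] by simp
    qed
    also have "2 * (H * e / 4) = H * (e / 2)" by simp
    finally have \<delta>2: "\<delta> * (2 * A + 1) * (2 * A) \<le> H * (e / 2)" .
    \<comment> \<open>The radius 2 R + 1 accommodates x - y for x, y in \<Omega> and also q - y for
      net points q within distance 1 of x, which may lie outside \<Omega>.\<close>
    have "uniformly_continuous_on (cball 0 (2 * R + 1)) (trunc_kernel m :: 'a \<Rightarrow> real)"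
      by (intro compact_uniformly_continuous trunc_kernel_continuous compact_cball)
    then obtain \<rho>0 where \<rho>0: "0 < \<rho>0" "\<And>z z'. z \<in> cball 0 (2 * R + 1) \<Longrightarrow> z' \<in> cball 0 (2 * R + 1) \<Longrightarrow>
        dist z' z < \<rho>0 \<Longrightarrow> dist (trunc_kernel m z') (trunc_kernel m (z::'a)) < \<delta>"
      unfolding uniformly_continuous_on_def using \<delta> by metis
    define \<rho> where "\<rho> = min \<rho>0 1"
    have \<rho>: "0 < \<rho>" "\<rho> \<le> 1" "\<rho> \<le> \<rho>0" using \<rho>0 by (auto simp: \<rho>_def)
    have "closure \<Omega> \<subseteq> (\<Union>q\<in>D. ball q \<rho>)"
    proof
      fix x assume "x \<in> closure \<Omega>"
      obtain d where "d \<in> D" "d \<in> ball x \<rho>" using D(2)[of "ball x \<rho>"] \<rho> by auto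
      then show "x \<in> (\<Union>q\<in>D. ball q \<rho>)" by (auto simp: dist_commute)
    qed
    then obtain Q where Q: "Q \<subseteq> D" "finite Q" "closure \<Omega> \<subseteq> (\<Union>q\<in>Q. ball q \<rho>)"
      using \<Omega> compactE_image[of "closure \<Omega>" D "\<lambda>q. ball q \<rho>"] by (metis compact_closure open_ball)
    have "\<forall>q\<in>Q. \<exists>k. \<forall>n\<ge>k. \<forall>l\<ge>k. \<bar>G (r n) m q - G (r l) m q\<bar> \<le> \<delta>"
      using cauchy Q \<delta> by blast
    then obtain K where K: "\<And>q n l. q \<in> Q \<Longrightarrow> K q \<le> n \<Longrightarrow> K q \<le> l \<Longrightarrow> \<bar>G (r n) m q - G (r l) m q\<bar> \<le> \<delta>"
      by metis
    define k where "k = Max (insert 0 (K ` Q))"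
    have Kk: "K q \<le> k" if "q \<in> Q" for q using Q that by (auto simp: k_def)
    show "\<exists>k. \<forall>n\<ge>k. \<forall>l\<ge>k. (\<integral>x. (u (r n) x - u (r l) x)\<^sup>2 \<partial>lborel) \<le> e"
    proof (intro exI allI impI)
      fix n l assume nl: "k \<le> n" "k \<le> l"
      define w where "w x = u (r n) x - u (r l) x" for x
      have wH: "borel_H \<Omega> w" unfolding w_def by (intro borel_H_diff u)
      have wi: "integrable lborel w" using borel_H_integrable[OF wH] \<Omega> by simp
      have wsq: "sq_integrable lborel w" using borel_H_sq_integrable[OF wH] \<Omega> by simp
      have [measurable]: "w \<in> borel_measurable borel" using wH by (rule borel_H_measurable)
      have w1: "(\<integral>x. \<bar>w x\<bar> \<partial>lborel) \<le> 2 * A"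
      proof -
        have "(\<integral>x. \<bar>w x\<bar> \<partial>lborel) \<le> (\<integral>x. \<bar>u (r n) x\<bar> + \<bar>u (r l) x\<bar> \<partial>lborel)"
          using wi ui by (intro integral_mono) (auto simp: w_def)
        also have "\<dots> \<le> 2 * A" using uA[of "r n"] uA[of "r l"] ui by simp
        finally show ?thesis .
      qed
      have winc: "(\<integral>p. (increment w p)\<^sup>2 \<partial>near_measure) \<le> 4 * C"
        using integral_square_diff_le[OF borel_H_increment[OF u] borel_H_increment[OF u], of "r n"
            "r l"]
          C[of "r n"] C[of "r l"] unfolding w_def increment_diff by linarith
      have "H * (\<integral>x. (w x)\<^sup>2 \<partial>lborel)
        \<le> (\<integral>p. (increment w p)\<^sup>2 \<partial>near_measure) / 2 + \<delta> * (2 * A + 1) * (\<integral>x. \<bar>w x\<bar> \<partial>lborel)"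
        unfolding H_def
      proof (rule kernel_square_identity_le)
        fix x assume "w x \<noteq> 0"
        then have x: "x \<in> \<Omega>" using borel_H_zero[OF wH] by blast
        then obtain q where q: "q \<in> Q" "dist q x < \<rho>" using Q(3) closure_subset[of \<Omega>] by auto
        have wG: "integrable lborel (\<lambda>y. trunc_kernel m (z - y) * w y)"
          "(\<integral>y. trunc_kernel m (z - y) * w y \<partial>lborel) = G (r n) m z - G (r l) m z" for z
          using Gi[of m z "r n"] Gi[of m z "r l"] by (simp_all add: w_def right_diff_distrib G_def)
        have "\<bar>(\<integral>y. trunc_kernel m (x - y) * w y \<partial>lborel)
            - (\<integral>y. trunc_kernel m (q - y) * w y \<partial>lborel)\<bar>
           = \<bar>\<integral>y. (trunc_kernel m (x - y) - trunc_kernel m (q - y)) * w y \<partial>lborel\<bar>"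
          using wG(1)[of x] wG(1)[of q] by (simp add: left_diff_distrib)
        also have "\<dots> \<le> (\<integral>y. \<bar>(trunc_kernel m (x - y) - trunc_kernel m (q - y)) * w y\<bar> \<partial>lborel)"
          by (rule integral_abs_bound)
        also have "\<dots> \<le> (\<integral>y. \<delta> * \<bar>w y\<bar> \<partial>lborel)"
        proof (rule integral_mono)
          show "integrable lborel (\<lambda>y. \<bar>(trunc_kernel m (x - y) - trunc_kernel m (q - y)) * w y\<bar>)"
            using wG(1)[of x] wG(1)[of q] by (simp add: left_diff_distrib)
          show "integrable lborel (\<lambda>y. \<delta> * \<bar>w y\<bar>)" using wi by simp
          fix y
          show "\<bar>(trunc_kernel m (x - y) - trunc_kernel m (q - y)) * w y\<bar> \<le> \<delta> * \<bar>w y\<bar>"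
          proof (cases "y \<in> \<Omega>")
            case True
            have nxy: "norm x < R" "norm y < R" using R True x by auto
            have xy: "norm (x - y) \<le> 2 * R"
              using nxy norm_triangle_ineq4[of x y] by linarith
            have nq: "norm (q - x) < \<rho>" using q by (simp add: dist_norm)
            have qy: "norm (q - y) \<le> 2 * R + 1"
              using nq \<rho> xy norm_triangle_ineq[of "q - x" "x - y"] by simp
            have "dist (trunc_kernel m (x - y)) (trunc_kernel m (q - y)) < \<delta>"
              using xy qy nq \<rho> by (intro \<rho>0(2)) (auto simp: dist_norm norm_minus_commute)
            then show ?thesis by (auto simp: dist_real_def abs_mult intro!: mult_right_mono)
          next
            case False
            then show ?thesis using borel_H_zero[OF wH False] by simp
          qed
        qed
        also have "\<dots> \<le> \<delta> * (2 * A)" using w1 \<delta> by (simp add: mult_left_mono)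
        finally have "\<bar>\<integral>y. trunc_kernel m (x - y) * w y \<partial>lborel\<bar>
          \<le> \<bar>\<integral>y. trunc_kernel m (q - y) * w y \<partial>lborel\<bar> + \<delta> * (2 * A)" by linarith
        also have "\<bar>\<integral>y. trunc_kernel m (q - y) * w y \<partial>lborel\<bar> \<le> \<delta>"
          unfolding wG(2) using K[OF q(1), of n l] Kk[OF q(1)] nl by linarith
        finally show "\<bar>\<integral>y. trunc_kernel m (x - y) * w y \<partial>lborel\<bar> \<le> \<delta> * (2 * A + 1)"
          by (simp add: distrib_left)
      qed (use wi wsq borel_H_increment[OF wH] trunc_kernel_nonneg trunc_kernel_le_near_kernel
          trunc_kernel_integrable in auto)
      also have "\<dots> \<le> 4 * C / 2 + \<delta> * (2 * A + 1) * (2 * A)"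
        using winc w1 \<delta> A by (intro add_mono mult_left_mono) auto
      also have "\<dots> \<le> H * e" using H2 \<delta>2 by (simp add: field_simps)
      finally show "(\<integral>x. (u (r n) x - u (r l) x)\<^sup>2 \<partial>lborel) \<le> e"
        using H(1) unfolding w_def by (rule mult_left_le_imp_le)
    qed
  qed
qed

section \<open>Minimisers\<close>

text \<open>With d = u n - v the two values differ by F(d,d) + F(d,v) + F(v,d), and each of these is
  bounded by a product of L^1 norms.\<close>

lemma far_integral_tendsto:
  fixes u :: "nat \<Rightarrow> 'a::euclidean_space \<Rightarrow> real"
  assumes u: "\<And>n. integrable lborel (u n)" and v: "integrable lborel v"
    and lim: "(\<lambda>n. \<integral>x. \<bar>u n x - v x\<bar> \<partial>lborel) \<longlonglongrightarrow> 0"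
  shows "(\<lambda>n. \<integral>p. u n (fst p) * u n (snd p) \<partial>far_measure)
      \<longlonglongrightarrow> (\<integral>p. v (fst p) * v (snd p) \<partial>far_measure)"
proof -
  let ?d = "\<lambda>n. \<integral>x. \<bar>u n x - v x\<bar> \<partial>lborel" and ?V = "\<integral>x. \<bar>v x\<bar> \<partial>lborel"
  let ?F = "\<lambda>a b. \<integral>p. a (fst p) * b (snd p) \<partial>(far_measure :: ('a \<times> 'a) measure)"
  have m [measurable]: "u n \<in> borel_measurable borel" "v \<in> borel_measurable borel" for n
    using u[of n, THEN borel_measurable_integrable] v[THEN borel_measurable_integrable] by auto
  have bd: "\<bar>?F a b\<bar> \<le> (\<integral>x. \<bar>a x\<bar> \<partial>lborel) * (\<integral>x. \<bar>b x\<bar> \<partial>lborel)"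
    if "integrable lborel a" "integrable lborel b" for a b :: "'a \<Rightarrow> real"
    using far_product_integrable(2)[OF that] integral_abs_bound[of far_measure "\<lambda>p. a (fst p)
        * b (snd p)"]
    by linarith
  have "\<bar>?F (u n) (u n) - ?F v v\<bar> \<le> ?d n * ?d n + 2 * (?d n * ?V)" for n
  proof -
    have d: "integrable lborel (\<lambda>x. u n x - v x)" using u v by simp
    note i = far_product_integrable(1)
    have "?F (u n) (u n) = (\<integral>p. (u n (fst p) - v (fst p)) * (u n (snd p) - v (snd p))
        + ((u n (fst p) - v (fst p)) * v (snd p) + v (fst p) * (u n (snd p) - v (snd p)))
        + v (fst p) * v (snd p) \<partial>far_measure)"
      by (rule Bochner_Integration.integral_cong) (auto simp: algebra_simps)
    also have "\<dots> = ?F (\<lambda>x. u n x - v x) (\<lambda>x. u n x - v x)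
        + (?F (\<lambda>x. u n x - v x) v + ?F v (\<lambda>x. u n x - v x)) + ?F v v"
      by (subst Bochner_Integration.integral_add[OF Bochner_Integration.integrable_add[OF i[OF d d]
            Bochner_Integration.integrable_add[OF i[OF d v] i[OF v d]]] i[OF v v]],
          subst Bochner_Integration.integral_add[OF i[OF d d]
            Bochner_Integration.integrable_add[OF i[OF d v] i[OF v d]]],
          subst Bochner_Integration.integral_add[OF i[OF d v] i[OF v d]]) (rule refl)
    finally have e: "?F (u n) (u n) - ?F v v = ?F (\<lambda>x. u n x - v x) (\<lambda>x. u n x - v x)
        + (?F (\<lambda>x. u n x - v x) v + ?F v (\<lambda>x. u n x - v x))"
      by (simp only: add_diff_cancel_right')
    have "\<bar>?F v (\<lambda>x. u n x - v x)\<bar> \<le> ?d n * ?V"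
      using bd[OF v d] by (simp only: mult.commute)
    with bd[OF d d] bd[OF d v] show ?thesis unfolding e by linarith
  qed
  then have le: "\<forall>\<^sub>F n in sequentially. \<bar>?F (u n) (u n) - ?F v v\<bar> \<le> ?d n * ?d n + 2 * (?d n * ?V)"
    by (rule always_eventually[OF allI])
  have "(\<lambda>n. ?d n * ?d n + 2 * (?d n * ?V)) \<longlonglongrightarrow> 0 * 0 + 2 * (0 * ?V)"
    by (rule tendsto_add[OF tendsto_mult[OF lim lim]
        tendsto_mult_left[OF tendsto_mult_right[OF lim]]])
  then have lim0: "(\<lambda>n. ?d n * ?d n + 2 * (?d n * ?V)) \<longlonglongrightarrow> 0"
    by (simp only: mult_zero_left mult_zero_right add_0)
  have "(\<lambda>n. \<bar>?F (u n) (u n) - ?F v v\<bar>) \<longlonglongrightarrow> 0"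
    by (rule real_tendsto_sandwich[OF always_eventually[OF allI[OF abs_ge_zero]] le tendsto_const
        lim0])
  then have "(\<lambda>n. ?F (u n) (u n) - ?F v v) \<longlonglongrightarrow> 0" by (rule tendsto_rabs_zero_cancel)
  then show ?thesis by (rule LIM_zero_cancel)
qed

text \<open>For normalised u, Cauchy-Schwarz on \<Omega> bounds the squared L^1 norm, hence the far
  term, by the measure of \<Omega>. The estimate serves twice: the form is bounded below, and
  minimising sequences have bounded energy.\<close>

lemma energy_L_lower_bound:
  fixes u :: "'a::euclidean_space \<Rightarrow> real"
  assumes \<Omega>: "bounded \<Omega>" "open \<Omega>" and u: "borel_H \<Omega> u" and u1: "(\<integral>x. (u x)\<^sup>2 \<partial>lborel) = 1"
  shows "log_lap_c DIM('a) / 2 * (\<integral>p. (increment u p)\<^sup>2 \<partial>near_measure)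
    \<le> energy_L u u + log_lap_c DIM('a) * measure lborel \<Omega> + \<bar>log_lap_rho DIM('a)\<bar>"
proof -
  have sq: "sq_integrable lborel u" and i: "integrable lborel u"
    using borel_H_sq_integrable[OF u] borel_H_integrable[OF u] \<Omega> by auto
  let ?F = "\<integral>p. u (fst p) * u (snd p) \<partial>far_measure"
  have "(\<integral>x. \<bar>u x\<bar> \<partial>lborel) \<le> sqrt (measure lborel \<Omega>) * sqrt (\<integral>x. (u x)\<^sup>2 \<partial>lborel)"
    using \<Omega> emeasure_bounded_finite borel_H_zero[OF u] by (intro integral_abs_le_sqrt sq) auto
  then have a: "(\<integral>x. \<bar>u x\<bar> \<partial>lborel) \<le> sqrt (measure lborel \<Omega>)" by (simp add: u1)
  have "\<bar>?F\<bar> \<le> (\<integral>x. \<bar>u x\<bar> \<partial>lborel) * (\<integral>x. \<bar>u x\<bar> \<partial>lborel)"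
    using far_product_integrable(2)[OF i i] integral_abs_bound[of far_measure "\<lambda>p. u (fst p)
        * u (snd p)"]
    by linarith
  also have "\<dots> \<le> sqrt (measure lborel \<Omega>) * sqrt (measure lborel \<Omega>)"
    by (intro mult_mono a) auto
  finally have "?F \<le> measure lborel \<Omega>" by simp
  then have "log_lap_c DIM('a) * ?F \<le> log_lap_c DIM('a) * measure lborel \<Omega>"
    using log_lap_c_pos[where 'a='a] by (intro mult_left_mono) auto
  then show ?thesis
    using u1 borel_H_measurable[OF u] by (simp add: energy_L_eq power2_eq_square)
qed

text \<open>The increment over z is at most L |z| and vanishes unless |x| \<le> R + 1, because |z|
  \<le> 1 on the support of the kernel. It provides a first competitor for the eigenvalue and covers
  all test functions.\<close>

lemma increment_sq_integrable_Lipschitz: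
  fixes f :: "'a::euclidean_space \<Rightarrow> real"
  assumes L: "\<And>x y. \<bar>f x - f y\<bar> \<le> L * norm (x - y)" and f0: "\<And>x. R \<le> norm x \<Longrightarrow> f x = 0"
  shows "f \<in> borel_measurable borel" "sq_integrable near_measure (increment f)"
proof -
  have "\<bar>L\<bar>-lipschitz_on UNIV f"
  proof (rule lipschitz_onI)
    fix x y
    have "\<bar>f x - f y\<bar> \<le> L * norm (x - y)" by (rule L)
    also have "\<dots> \<le> \<bar>L\<bar> * norm (x - y)" by (intro mult_right_mono) auto
    finally show "dist (f x) (f y) \<le> \<bar>L\<bar> * dist x y" by (simp add: dist_norm)
  qed auto
  then show m [measurable]: "f \<in> borel_measurable borel"
    by (intro borel_measurable_continuous_onI) (rule lipschitz_on_continuous_on)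
  let ?B = "cball (0::'a) (R + 1)"
  have [measurable]: "?B \<in> sets borel" by simp
  have "(\<integral>\<^sup>+p. ennreal ((increment f p)\<^sup>2) \<partial>near_measure)
    = (\<integral>\<^sup>+z. ennreal (near_kernel z) * (\<integral>\<^sup>+x. ennreal ((f x - f (x - z))\<^sup>2) \<partial>lborel) \<partial>lborel)"
    by (subst nn_integral_near_measure_iterated) auto
  also have "\<dots> \<le> (\<integral>\<^sup>+z. ennreal (sqrt (norm (z::'a)) * near_kernel z)
      * (\<integral>\<^sup>+x. ennreal (L\<^sup>2) * indicator ?B x \<partial>lborel) \<partial>lborel)"
  proof (rule nn_integral_mono)
    fix z :: 'a
    show "ennreal (near_kernel z) * (\<integral>\<^sup>+x. ennreal ((f x - f (x - z))\<^sup>2) \<partial>lborel)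
      \<le> ennreal (sqrt (norm z) * near_kernel z) * (\<integral>\<^sup>+x. ennreal (L\<^sup>2) * indicator ?B x \<partial>lborel)"
    proof (cases "norm z \<le> 1")
      case True
      have "(\<integral>\<^sup>+x. ennreal ((f x - f (x - z))\<^sup>2) \<partial>lborel)
          \<le> (\<integral>\<^sup>+x. ennreal (sqrt (norm z)) * (ennreal (L\<^sup>2) * indicator ?B x) \<partial>lborel)"
      proof (rule nn_integral_mono)
        fix x
        show "ennreal ((f x - f (x - z))\<^sup>2) \<le> ennreal (sqrt (norm z))
            * (ennreal (L\<^sup>2) * indicator ?B x)"
        proof (cases "x \<in> ?B")
          case xB: True
          \<comment> \<open>Only |z|^2 \<le> sqrt |z| for |z| \<le> 1 is wanted, a crude bound that
            leads back to \<open>near_kernel_sqrt_finite\<close>.\<close>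
          have "norm z * norm z \<le> 1 * norm z"
            using True by (intro mult_right_mono) auto
          then have "(norm z)\<^sup>2 * (norm z)\<^sup>2 \<le> 1 * norm z"
            using True by (smt (verit, best) mult_left_le_one_le norm_ge_zero power2_eq_square
                mult_mono' zero_le_power2)
          then have z: "(norm z)\<^sup>2 \<le> sqrt (norm z)"
            by (intro real_le_rsqrt) (simp add: power2_eq_square)
          have "(f x - f (x - z))\<^sup>2 \<le> (L * norm z)\<^sup>2"
            using L[of x "x - z"] by (intro abs_le_square_iff[THEN iffD1]) auto
          also have "\<dots> \<le> sqrt (norm z) * L\<^sup>2"
            using mult_right_mono[OF z, of "L\<^sup>2"] by (simp add: power_mult_distrib mult.commute)
          finally show ?thesis using xB by (simp add: ennreal_mult'[symmetric] ennreal_leI)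
        next
          case False
          then have "norm x > R + 1" by simp
          moreover then have "R \<le> norm (x - z)" using True norm_triangle_ineq2[of x z] by linarith
          ultimately show ?thesis using f0[of x] f0[of "x - z"] by simp
        qed
      qed
      also have "\<dots> = ennreal (sqrt (norm z)) * (\<integral>\<^sup>+x. ennreal (L\<^sup>2) * indicator ?B x \<partial>lborel)"
        by (rule nn_integral_cmult) measurable
      finally have "ennreal (near_kernel z) * (\<integral>\<^sup>+x. ennreal ((f x - f (x - z))\<^sup>2) \<partial>lborel)
        \<le> ennreal (near_kernel z) * (ennreal (sqrt (norm z))
            * (\<integral>\<^sup>+x. ennreal (L\<^sup>2) * indicator ?B x \<partial>lborel))"
        by (rule mult_left_mono) simp
      then show ?thesis by (simp add: ennreal_mult mult_ac)
    qed (simp add: near_kernel_def)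
  qed
  also have "\<dots> = (\<integral>\<^sup>+z. ennreal (sqrt (norm z) * near_kernel (z::'a)) \<partial>lborel)
      * (ennreal (L\<^sup>2) * emeasure lborel ?B)"
    by (simp add: nn_integral_multc nn_integral_cmult_indicator)
  also have "\<dots> < \<infinity>"
    using near_kernel_sqrt_finite[where 'a='a] emeasure_cball_finite[of "0::'a" "R + 1"]
    by (auto simp: ennreal_mult_less_top)
  finally show "sq_integrable near_measure (increment f)" by (simp add: sq_integrable_iff_nn)
qed

lemma borel_H_normalised_exists:
  fixes \<Omega> :: "'a::euclidean_space set"
  assumes \<Omega>: "bounded \<Omega>" "open \<Omega>" "\<Omega> \<noteq> {}"
  obtains u where "borel_H \<Omega> u" "(\<integral>x. (u x)\<^sup>2 \<partial>lborel) = 1"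
proof -
  obtain a d where a: "0 < d" "cball a d \<subseteq> \<Omega>"
    using \<Omega> open_contains_cball by (metis ex_in_conv)
  \<comment> \<open>A tent over a ball inside \<Omega>: Lipschitz, hence of finite energy, and
    positive on an open set, hence normalisable.\<close>
  define f where "f x = max 0 (d - dist a x)" for x
  have L: "\<bar>f x - f y\<bar> \<le> 1 * norm (x - y)" for x y
    unfolding f_def using dist_triangle3[of x y a] dist_triangle3[of y x a] dist_triangle[of a x y]
        dist_triangle[of a y x]
    by (simp add: dist_commute dist_norm max_def) (smt (verit) norm_minus_commute)
  have f0: "f x = 0" if "norm a + d \<le> norm x" for x
    using that norm_triangle_ineq2[of x a] by (simp add: f_def dist_norm norm_minus_commute)
  note f = increment_sq_integrable_Lipschitz[of f 1, OF L f0]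
  have fH: "borel_H \<Omega> f"
    unfolding borel_H_def using f a by (auto simp: f_def subset_eq)
  have fsq: "sq_integrable lborel f" using borel_H_sq_integrable[OF fH] \<Omega> by simp
  define I where "I = (\<integral>x. (f x)\<^sup>2 \<partial>lborel)"
  have "I \<noteq> 0"
  proof
    assume "I = 0"
    then have "AE x in lborel. (f x)\<^sup>2 = 0"
      unfolding I_def using sq_integrable_sq[OF fsq]
          by (subst (asm) integral_nonneg_eq_0_iff_AE) auto
    then have "AE x in lborel. x \<notin> ball a d" by eventually_elim (auto simp: f_def)
    then have "emeasure lborel (ball a d) = 0"
      by (subst (asm) AE_iff_measurable[of "ball a d"]) auto
    then show False using a unit_ball_vol_pos[of "real DIM('a)"] by (simp add: emeasure_ball)
  qed
  moreover have "0 \<le> I" by (simp add: I_def)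
  ultimately have I: "0 < I" by simp
  show ?thesis
  proof (rule that[of "\<lambda>x. (1 / sqrt I) * f x"])
    show "borel_H \<Omega> (\<lambda>x. (1 / sqrt I) * f x)" by (rule borel_H_scale[OF fH])
    have "(\<integral>x. ((1 / sqrt I) * f x)\<^sup>2 \<partial>lborel) = (1 / I) * I"
      using I unfolding I_def by (simp add: power_mult_distrib power_divide)
    then show "(\<integral>x. ((1 / sqrt I) * f x)\<^sup>2 \<partial>lborel) = 1" using I by simp
  qed
qed

text \<open>The direct method. A minimising sequence has bounded energy, so a subsequence converges
  in L^2 and almost everywhere. The norm constraint and the far term pass to the limit, and Fatou
  makes the near energy lower semicontinuous.\<close>

lemma energy_L_minimiser_exists:
  fixes \<Omega> :: "'a::euclidean_space set"
  assumes \<Omega>: "bounded \<Omega>" "open \<Omega>" "\<Omega> \<noteq> {}"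
  obtains u where "borel_H \<Omega> u" "(\<integral>x. (u x)\<^sup>2 \<partial>lborel) = 1"
    "\<And>v. borel_H \<Omega> v \<Longrightarrow> (\<integral>x. (v x)\<^sup>2 \<partial>lborel) = 1 \<Longrightarrow> energy_L u u \<le> energy_L v v"
proof -
  define c \<rho> where "c = log_lap_c DIM('a)" and "\<rho> = log_lap_rho DIM('a)"
  have c: "0 < c" using log_lap_c_pos by (simp add: c_def)
  define N where "N u \<longleftrightarrow> borel_H \<Omega> u \<and> (\<integral>x. (u x)\<^sup>2 \<partial>lborel) = 1" for u
  define E where "E = {energy_L u u | u. N u}"
  define b where "b = c * measure lborel \<Omega> + \<bar>\<rho>\<bar>"
  have low: "c / 2 * (\<integral>p. (increment u p)\<^sup>2 \<partial>near_measure) \<le> energy_L u u + b" if "N u" for u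
    using energy_L_lower_bound[OF \<Omega>(1,2), of u] that by (simp add: N_def b_def c_def \<rho>_def)
  have "- b \<le> energy_L u u" if "N u" for u
  proof -
    have "0 \<le> c / 2 * (\<integral>p. (increment u p)\<^sup>2 \<partial>near_measure)" using c by simp
    then show ?thesis using low[OF that] by linarith
  qed
  then have bdd: "bdd_below E" by (auto simp: E_def intro!: bdd_belowI)
  have ne: "E \<noteq> {}" using borel_H_normalised_exists[OF \<Omega>] by (auto simp: E_def N_def)
  define m where "m = Inf E"
  have m: "m \<le> energy_L u u" if "N u" for u
    unfolding m_def using that bdd by (auto intro!: cInf_lower simp: E_def)
  have "\<exists>u. N u \<and> energy_L u u < m + 1 / real (Suc n)" for n
  proof -
    have "Inf E < m + 1 / real (Suc n)" by (simp add: m_def)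
    then show ?thesis using cInf_less_iff[OF ne bdd] by (auto simp: E_def)
  qed
  then obtain u where u: "\<And>n. N (u n)" "\<And>n. energy_L (u n) (u n) < m + 1 / real (Suc n)" by metis
  have uH: "borel_H \<Omega> (u n)" and u1: "(\<integral>x. (u n x)\<^sup>2 \<partial>lborel) = 1" for n using u(1)
      by (auto simp: N_def)
  have C: "(\<integral>p. (increment (u n) p)\<^sup>2 \<partial>near_measure) \<le> (m + 1 + b) * 2 / c" for n
  proof -
    have "1 / real (Suc n) \<le> 1" by simp
    then have "c / 2 * (\<integral>p. (increment (u n) p)\<^sup>2 \<partial>near_measure) \<le> m + 1 + b"
      using low[OF u(1)[of n]] u(2)[of n] by linarith
    then show ?thesis using c by (simp add: field_simps)
  qed
  obtain r :: "nat \<Rightarrow> nat" where r: "strict_mono r" and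
    rC: "\<And>e. 0 < e \<Longrightarrow> \<exists>k. \<forall>n\<ge>k. \<forall>l\<ge>k. (\<integral>x. (u (r n) x - u (r l) x)\<^sup>2 \<partial>lborel) \<le> e"
    by (rule borel_H_bounded_energy_subsequence[OF \<Omega>(1,2) uH eq_refl[OF u1] C that])
  have fin: "\<Omega> \<in> sets lborel" "emeasure lborel \<Omega> < \<infinity>"
    using \<Omega> emeasure_bounded_finite by auto
  have usq: "sq_integrable lborel (u n)" and ui: "integrable lborel (u n)" for n
    using borel_H_sq_integrable[OF uH] borel_H_integrable[OF uH] \<Omega> by auto
  have [measurable]: "u n \<in> borel_measurable borel" for n using uH by (rule borel_H_measurable)
  obtain v s where vsq: "sq_integrable lborel v" and v0: "\<And>x. x \<notin> \<Omega> \<Longrightarrow> v x = 0"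
      and s: "strict_mono s"
    and ae: "AE x in lborel. (\<lambda>n. u (r (s n)) x) \<longlonglongrightarrow> v x"
    and L2: "(\<lambda>n. \<integral>x. (u (r n) x - v x)\<^sup>2 \<partial>lborel) \<longlonglongrightarrow> 0"
    by (rule square_mean_Cauchy_limit[of lborel "\<lambda>n. u (r n)" \<Omega>, OF usq fin borel_H_zero[OF uH] rC
        that])
  have [measurable]: "v \<in> borel_measurable borel" using sq_integrable_measurable[OF vsq] by simp
  have vi: "integrable lborel v" using sq_integrable_imp_integrable_on[OF vsq fin] v0 by simp
  define g where "g n = u (r (s n))" for n
  have [measurable]: "g n \<in> borel_measurable borel" for n by (simp add: g_def)
  have gsq: "sq_integrable lborel (g n)" and gi: "integrable lborel (g n)" and gH: "borel_H \<Omega> (g n)"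
    and g1: "(\<integral>x. (g n x)\<^sup>2 \<partial>lborel) = 1" for n
    by (simp_all add: g_def usq ui uH u1)
  have gd: "sq_integrable lborel (\<lambda>x. g n x - v x)" for n by (intro sq_integrable_diff gsq vsq)
  have gL2: "(\<lambda>n. \<integral>x. (g n x - v x)\<^sup>2 \<partial>lborel) \<longlonglongrightarrow> 0"
    unfolding g_def using LIMSEQ_subseq_LIMSEQ[OF L2 s] by (simp add: o_def)
  have gL1: "(\<lambda>n. \<integral>x. \<bar>g n x - v x\<bar> \<partial>lborel) \<longlonglongrightarrow> 0"
  proof (rule tendsto_sandwich[OF _ _ tendsto_const])
    show "\<forall>\<^sub>F n in sequentially. (\<integral>x. \<bar>g n x - v x\<bar> \<partial>lborel)
        \<le> sqrt (measure lborel \<Omega>) * sqrt (\<integral>x. (g n x - v x)\<^sup>2 \<partial>lborel)"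
      using borel_H_zero[OF gH] v0 by (intro always_eventually allI integral_abs_le_sqrt gd fin)
          auto
    show "(\<lambda>n. sqrt (measure lborel \<Omega>) * sqrt (\<integral>x. (g n x - v x)\<^sup>2 \<partial>lborel)) \<longlonglongrightarrow> 0"
      using tendsto_mult_left[OF tendsto_real_sqrt[OF gL2], of "sqrt (measure lborel \<Omega>)"] by simp
  qed auto
  have v1: "(\<integral>x. (v x)\<^sup>2 \<partial>lborel) = 1"
  proof -
    have le: "\<forall>\<^sub>F n in sequentially. \<bar>sqrt (\<integral>x. (g n x)\<^sup>2 \<partial>lborel) - sqrt (\<integral>x. (v x)\<^sup>2 \<partial>lborel)\<bar>
        \<le> sqrt (\<integral>x. (g n x - v x)\<^sup>2 \<partial>lborel)"
      by (rule always_eventually[OF allI]) (rule sqrt_integral_square_triangle[OF gsq vsq])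
    have lim0: "(\<lambda>n. sqrt (\<integral>x. (g n x - v x)\<^sup>2 \<partial>lborel)) \<longlonglongrightarrow> 0"
      using tendsto_real_sqrt[OF gL2] by (simp only: real_sqrt_zero)
    have "(\<lambda>n. \<bar>sqrt (\<integral>x. (g n x)\<^sup>2 \<partial>lborel) - sqrt (\<integral>x. (v x)\<^sup>2 \<partial>lborel)\<bar>) \<longlonglongrightarrow> 0"
      by (rule real_tendsto_sandwich[OF always_eventually[OF allI[OF abs_ge_zero]] le tendsto_const
          lim0])
    then have "(\<lambda>n. sqrt (\<integral>x. (g n x)\<^sup>2 \<partial>lborel) - sqrt (\<integral>x. (v x)\<^sup>2 \<partial>lborel)) \<longlonglongrightarrow> 0"
      by (rule tendsto_rabs_zero_cancel)
    then show ?thesis by (simp add: g1 LIMSEQ_const_iff)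
  qed
  define F where "F w = (\<integral>p. w (fst p) * w (snd p) \<partial>(far_measure :: ('a \<times> 'a) measure))" for w ::
      "'a \<Rightarrow> real"
  have far: "(\<lambda>n. F (g n)) \<longlonglongrightarrow> F v" unfolding F_def by (rule far_integral_tendsto[OF gi vi gL1])
  have El: "energy_L w w = c / 2 * (\<integral>p. (increment w p)\<^sup>2 \<partial>near_measure) - c * F w + \<rho>"
    if "w \<in> borel_measurable borel" "(\<integral>x. (w x)\<^sup>2 \<partial>lborel) = 1" for w
    using that by (simp add: energy_L_eq c_def \<rho>_def F_def power2_eq_square)
  have aep: "AE p in near_measure. (\<lambda>n. (increment (g n) p)\<^sup>2) \<longlonglongrightarrow> (increment v p)\<^sup>2"
    using AE_near_measure[OF AE_lborel_pair[OF ae]]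
    by eventually_elim (auto simp: increment_def g_def intro!: tendsto_intros)
  \<comment> \<open>The slack e makes the bound true from some index on, which is the form that the
    Fatou step accepts; e is sent to 0 at the end. The same step shows that the limit has finite
    energy at all.\<close>
  have key: "integrable near_measure (\<lambda>p. (increment v p)\<^sup>2) \<and> (\<integral>p. (increment v p)\<^sup>2 \<partial>near_measure)
      \<le> 2 / c * (m + e + c * (F v + e) - \<rho>)" if e: "0 < e" for e
  proof (rule integral_tendsto_le[OF _ _ aep])
    have "\<forall>\<^sub>F n in sequentially. F (g n) < F v + e"
      using far e by (intro order_tendstoD) auto
    moreover have "\<forall>\<^sub>F n in sequentially. 1 / real (Suc n) < e"
      using LIMSEQ_inverse_real_of_nat e by (intro order_tendstoD) (auto simp: inverse_eq_divide)
    ultimately show "\<forall>\<^sub>F n in sequentially. (\<integral>p. (increment (g n) p)\<^sup>2 \<partial>near_measure)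
      \<le> 2 / c * (m + e + c * (F v + e) - \<rho>)"
    proof eventually_elim
      case (elim n)
      have "real (Suc n) \<le> real (Suc (r (s n)))"
        using seq_suble[OF strict_mono_o[OF r s], of n] by simp
      then have "1 / real (Suc (r (s n))) \<le> 1 / real (Suc n)" by (intro divide_left_mono) auto
      then have "energy_L (g n) (g n) \<le> m + e"
        using u(2)[of "r (s n)"] elim by (simp add: g_def)
      moreover have "c * F (g n) \<le> c * (F v + e)" using elim c by (intro mult_left_mono) auto
      ultimately have "c / 2 * (\<integral>p. (increment (g n) p)\<^sup>2 \<partial>near_measure) \<le> m + e + c * (F v + e) - \<rho>"
        using El[of "g n"] g1 by simp
      then show ?case using c by (simp add: field_simps)
    qed
    show "integrable near_measure (\<lambda>p. (increment (g n) p)\<^sup>2)" for n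
      using borel_H_increment[OF gH] by (rule sq_integrable_sq)
  qed (simp, measurable)
  have vinc: "sq_integrable near_measure (increment v)"
    using key[of 1] by (simp add: sq_integrable_def)
  have vN: "N v" using vinc v0 v1 by (auto simp: N_def borel_H_def)
  have le: "energy_L v v \<le> m + e * (1 + c)" if e: "0 < e" for e
  proof -
    let ?I = "\<integral>p. (increment v p)\<^sup>2 \<partial>near_measure"
    have "?I \<le> 2 / c * (m + e + c * (F v + e) - \<rho>)" using key[OF e] by blast
    then have "c / 2 * ?I \<le> m + e + c * (F v + e) - \<rho>" using c by (simp add: field_simps)
    then show ?thesis using El[of v] v1 by (simp add: algebra_simps)
  qed
  have "energy_L v v \<le> m"
  proof (rule field_le_epsilon)
    fix e :: real assume "0 < e"
    then show "energy_L v v \<le> m + e" using le[of "e / (1 + c)"] c by simp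
  qed
  then show ?thesis
    using vN m by (intro that[of v]) (auto simp: N_def intro: order_trans)
qed

section \<open>The first eigenvalue\<close>

lemma integral_lebesgue_cong_AE:
  fixes f g :: "'a::euclidean_space \<Rightarrow> real"
  assumes g: "g \<in> borel_measurable borel" and ae: "AE x in lborel. f x = g x"
  shows "integral\<^sup>L lebesgue f = integral\<^sup>L lborel g"
proof -
  have g': "g \<in> borel_measurable lebesgue" using g by (auto intro: measurable_completion)
  have ae': "AE x in lebesgue. g x = f x" using AE_completion[OF ae] by eventually_elim simp
  have f: "f \<in> borel_measurable lebesgue" by (rule borel_measurable_AE[OF g' ae'])
  have "integral\<^sup>L lebesgue f = integral\<^sup>L lebesgue g"
    using ae' f g' by (intro integral_cong_AE) (auto elim: eventually_mono)
  also have "\<dots> = integral\<^sup>L lborel g" using g by (intro integral_completion) simp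
  finally show ?thesis .
qed

text \<open>Transfers values of the form from Lebesgue measurable functions to Borel ones, for which
  the integrals over pairs have been rewritten.\<close>

lemma energy_L_cong_AE:
  fixes u w :: "'a::euclidean_space \<Rightarrow> real"
  assumes [measurable]: "u' \<in> borel_measurable borel" "w' \<in> borel_measurable borel"
    and u: "AE x in lborel. u x = u' x" and w: "AE x in lborel. w x = w' x"
  shows "energy_L u w = energy_L u' w'"
proof -
  have "AE p in (lborel :: ('a \<times> 'a) measure). u (fst p) = u' (fst p) \<and> u (snd p) = u' (snd p)
      \<and> w (fst p) = w' (fst p) \<and> w (snd p) = w' (snd p)"
    using AE_lborel_pair[OF u] AE_lborel_pair[OF w] by eventually_elim auto
  note ae = this
  have "(LINT z:near_pairs|lebesgue. (case z of (x, y) \<Rightarrow> (u x - u y)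
      * (w x - w y) / dist x y ^ DIM('a)))
    = (\<integral>p. near_kernel (fst p - snd p) * (increment u' p * increment w' p) \<partial>lborel)"
    unfolding set_lebesgue_integral_def
  proof (rule integral_lebesgue_cong_AE)
    show "(\<lambda>p. near_kernel (fst p - snd p) * (increment u' p
        * increment w' p)) \<in> borel_measurable borel"
      by measurable
  qed (use ae in eventually_elim, auto simp: near_kernel_diff increment_def case_prod_beta)
  also have "\<dots> = (\<integral>p. increment u' p * increment w' p \<partial>near_measure)"
    unfolding near_measure_def by (subst integral_density) auto
  finally have 1: "energy u w = energy u' w'"
    unfolding energy_eq_near_measure[OF assms(1,2)] energy_def[of u w] by simp
  have "(LINT z:far_pairs|lebesgue. (case z of (x, y) \<Rightarrow> u x * w y / dist x y ^ DIM('a)))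
    = (\<integral>p. far_kernel (fst p - snd p) * (u' (fst p) * w' (snd p)) \<partial>lborel)"
    unfolding set_lebesgue_integral_def
  proof (rule integral_lebesgue_cong_AE)
    show "(\<lambda>p. far_kernel (fst p - snd p) * (u' (fst p) * w' (snd p))) \<in> borel_measurable borel"
      by measurable
  qed (use ae in eventually_elim, auto simp: far_kernel_diff case_prod_beta)
  also have "\<dots> = (\<integral>p. u' (fst p) * w' (snd p) \<partial>far_measure)"
    unfolding far_measure_def by (subst integral_density) auto
  finally have 2: "(LINT z:far_pairs|lebesgue. (case z of (x, y) \<Rightarrow> u x * w y / dist x y ^ DIM('a)))
    = (\<integral>p. u' (fst p) * w' (snd p) \<partial>far_measure)" .
  have "AE x in lborel. u x * w x = u' x * w' x" using u w by eventually_elim simp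
  then have 3: "(LINT x|lebesgue. u x * w x) = (\<integral>x. u' x * w' x \<partial>lborel)"
    by (intro integral_lebesgue_cong_AE) measurable
  show ?thesis
    using energy_L_eq[of u' w'] energy_eq_near_measure[of u' w']
        unfolding energy_L_def[of u w] 1 2 3 by simp
qed

lemma gagliardo_log_cong_AE:
  fixes u :: "'a::euclidean_space \<Rightarrow> real"
  assumes "AE x in lborel. u x = u' x"
  shows "gagliardo_log A u = gagliardo_log A u'"
  unfolding gagliardo_log_def nn_integral_completion
  by (rule nn_integral_cong_AE, use AE_lborel_pair[OF assms] in eventually_elim)
     (auto simp: case_prod_beta)

lemma H_space_borel_representative:
  fixes \<Omega> :: "'a::euclidean_space set"
  assumes "u \<in> H_space \<Omega>" "open \<Omega>"
  obtains v where "borel_H \<Omega> v" "AE x in lborel. u x = v x"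
proof -
  have u: "u \<in> borel_measurable lebesgue" "\<And>x. x \<notin> \<Omega> \<Longrightarrow> u x = 0" "gagliardo_log near_pairs u < \<infinity>"
    using assms by (auto simp: H_space_def)
  obtain g where g: "g \<in> borel_measurable lborel" "AE x in lborel. u x = g x"
    using completion_ex_borel_measurable_real[OF u(1)] by blast
  \<comment> \<open>The representative g agrees with u only up to a null set, which may extend
    outside \<Omega>; the indicator restores the vanishing there at every point.\<close>
  define v where "v x = g x * indicator \<Omega> x" for x
  have [measurable]: "g \<in> borel_measurable borel" "\<Omega> \<in> sets borel" using g assms by auto
  have v [measurable]: "v \<in> borel_measurable borel" unfolding v_def by measurable
  have ae: "AE x in lborel. u x = v x"
    using g(2) by eventually_elim (auto simp: v_def indicator_def u(2))
  have "gagliardo_log (near_pairs \<inter> UNIV) v < \<infinity>"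
    using u(3) gagliardo_log_cong_AE[OF ae] by simp
  then have "sq_integrable near_measure (increment v)"
    by (subst (asm) gagliardo_log_eq_near_measure) (auto simp: sq_integrable_iff_nn)
  then show ?thesis using that[of v] ae v by (auto simp: borel_H_def v_def)
qed

lemma borel_H_imp_H_space: "borel_H \<Omega> u \<Longrightarrow> u \<in> H_space \<Omega>"
  using gagliardo_log_eq_near_measure[of u UNIV]
  by (auto simp: borel_H_def H_space_def sq_integrable_iff_nn intro: measurable_completion)

lemma set_integral_square_borel_H:
  assumes u: "borel_H \<Omega> v" and ae: "AE x in lborel. u x = v x"
  shows "(LINT x:\<Omega>|lebesgue. (u x)\<^sup>2) = (\<integral>x. (v x)\<^sup>2 \<partial>lborel)"
  unfolding set_lebesgue_integral_def
proof (rule integral_lebesgue_cong_AE)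
  show "(\<lambda>x. (v x)\<^sup>2) \<in> borel_measurable borel" using borel_H_measurable[OF u] by measurable
  show "AE x in lborel. indicat_real \<Omega> x *\<^sub>R (u x)\<^sup>2 = (v x)\<^sup>2"
    using ae by eventually_elim (auto simp: indicator_def borel_H_zero[OF u])
qed

text \<open>Restricting the competitors to Borel functions leaves the set of values unchanged, so a
  minimiser found among them realises the \<open>LEAST\<close> over the original set.\<close>

lemma first_eigenvalue_values:
  fixes \<Omega> :: "'a::euclidean_space set"
  assumes "open \<Omega>"
  shows "{energy_L u u | u. u \<in> H_space \<Omega> \<and> sqrt (LINT x:\<Omega>|lebesgue. (u x)\<^sup>2) = 1}
    = {energy_L u u | u. borel_H \<Omega> u \<and> (\<integral>x. (u x)\<^sup>2 \<partial>lborel) = 1}" (is "?A = ?B")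
proof
  show "?A \<subseteq> ?B"
  proof
    fix r assume "r \<in> ?A"
    then obtain u where u: "r = energy_L u u" "u \<in> H_space \<Omega>" "sqrt (LINT x:\<Omega>|lebesgue. (u x)\<^sup>2) = 1"
        by blast
    obtain v where v: "borel_H \<Omega> v" "AE x in lborel. u x = v x"
      using H_space_borel_representative[OF u(2) assms] .
    show "r \<in> ?B"
      using u v set_integral_square_borel_H[OF v] energy_L_cong_AE[OF borel_H_measurable[OF v(1)]
          borel_H_measurable[OF v(1)] v(2) v(2)]
      by auto
  qed
  show "?B \<subseteq> ?A"
  proof
    fix r assume "r \<in> ?B"
    then obtain v where v: "r = energy_L v v" "borel_H \<Omega> v" "(\<integral>x. (v x)\<^sup>2 \<partial>lborel) = 1" by blast
    show "r \<in> ?A"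
      using v set_integral_square_borel_H[OF v(2), of v] borel_H_imp_H_space[OF v(2)] by auto
  qed
qed

text \<open>\<open>LEAST\<close> over the reals is meaningful only because the minimum exists.
  Homogeneity of degree two then extends the Rayleigh inequality to functions that are not
  normalised.\<close>

lemma first_eigenvalue_attained:
  fixes \<Omega> :: "'a::euclidean_space set"
  assumes \<Omega>: "bounded \<Omega>" "open \<Omega>" "\<Omega> \<noteq> {}"
  obtains u where "borel_H \<Omega> u" "(\<integral>x. (u x)\<^sup>2 \<partial>lborel) = 1" "energy_L u u = first_eigenvalue \<Omega>"
    "\<And>v. borel_H \<Omega> v \<Longrightarrow> first_eigenvalue \<Omega> * (\<integral>x. (v x)\<^sup>2 \<partial>lborel) \<le> energy_L v v"
proof -
  obtain u where u: "borel_H \<Omega> u" "(\<integral>x. (u x)\<^sup>2 \<partial>lborel) = 1"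
    "\<And>v. borel_H \<Omega> v \<Longrightarrow> (\<integral>x. (v x)\<^sup>2 \<partial>lborel) = 1 \<Longrightarrow> energy_L u u \<le> energy_L v v"
    using energy_L_minimiser_exists[OF \<Omega>] by blast
  have eq: "first_eigenvalue \<Omega> = energy_L u u"
    unfolding first_eigenvalue_def first_eigenvalue_values[OF \<Omega>(2)]
    by (rule Least_equality) (use u in auto)
  have "first_eigenvalue \<Omega> * (\<integral>x. (v x)\<^sup>2 \<partial>lborel) \<le> energy_L v v" if v: "borel_H \<Omega> v" for v
  proof -
    define I where "I = (\<integral>x. (v x)\<^sup>2 \<partial>lborel)"
    have vv: "form_pair v v" using borel_H_form_pair[OF v v \<Omega>(1,2)] .
    have [measurable]: "v \<in> borel_measurable borel" using v by (rule borel_H_measurable)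
    have "0 \<le> I" by (simp add: I_def)
    show ?thesis
    proof (cases "I = 0")
      case True
      \<comment> \<open>A function that vanishes almost everywhere cannot be normalised, but its
        form is 0.\<close>
      have "AE x in lborel. (v x)\<^sup>2 = 0"
        using True sq_integrable_sq[OF borel_H_sq_integrable[OF v \<Omega>(1)]]
        unfolding I_def by (subst (asm) integral_nonneg_eq_0_iff_AE) auto
      then have "AE x in lborel. v x = 0" by eventually_elim simp
      then have "energy_L v v = energy_L (\<lambda>_::'a. 0) (\<lambda>_::'a. 0)"
        using energy_L_cong_AE[of "\<lambda>_. 0" "\<lambda>_. 0" v v] by simp
      moreover have "energy_L (\<lambda>_::'a. 0) (\<lambda>_::'a. 0) = 0" by (simp add: energy_L_eq increment_def)
      ultimately show ?thesis using True by (simp add: I_def)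
    next
      case False
      with \<open>0 \<le> I\<close> have I: "0 < I" by simp
      let ?t = "1 / sqrt I" let ?w = "\<lambda>x. ?t * v x"
      have "(\<integral>x. (?w x)\<^sup>2 \<partial>lborel) = (1 / I) * I"
        using I unfolding I_def by (simp add: power_mult_distrib power_divide)
      then have "energy_L u u \<le> energy_L ?w ?w"
        using I by (intro u(3) borel_H_scale v) auto
      also have "\<dots> = ?t * energy_L ?w v"
        using borel_H_form_pair[OF borel_H_scale[OF v] v \<Omega>(1,2)] by (rule energy_L_scale_right(1))
      also have "energy_L ?w v = energy_L v ?w" by (rule energy_L_commute) auto
      also have "\<dots> = ?t * energy_L v v" by (rule energy_L_scale_right(1)[OF vv])
      also have "?t * (?t * energy_L v v) = energy_L v v / I"
        using I by (simp add: field_simps flip: power2_eq_square)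
      finally show ?thesis using I unfolding eq I_def[symmetric] by (simp add: field_simps)
    qed
  qed
  then show ?thesis using that[of u] u eq by simp
qed

lemma linear_coefficient_zero:
  fixes b c :: real
  assumes "\<And>t. 0 \<le> t * b + t\<^sup>2 * c"
  shows "b = 0"
proof (rule ccontr)
  assume "b \<noteq> 0"
  define d where "d = \<bar>c\<bar> + 1"
  have d: "0 < d" "c < d" by (auto simp: d_def)
  \<comment> \<open>At t = - b / d the sign is that of c - d, which is negative by the choice of
    d.\<close>
  have "(- b / d) * b + (- b / d)\<^sup>2 * c = (b\<^sup>2 / d\<^sup>2) * (c - d)"
    using d by (simp add: power2_eq_square field_simps)
  also have "\<dots> < 0" using \<open>b \<noteq> 0\<close> d by (intro mult_pos_neg) auto
  finally show False using assms[of "- b / d"] by simp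
qed

text \<open>First variation: along u + t \<phi> the form minus \<mu> times the squared norm is
  minimal at t = 0, so its linear coefficient vanishes.\<close>

lemma first_eigenfunction_equation:
  fixes \<Omega> :: "'a::euclidean_space set"
  assumes \<Omega>: "bounded \<Omega>" "open \<Omega>" and u: "borel_H \<Omega> u" and \<phi>: "borel_H \<Omega> \<phi>"
    and eq: "energy_L u u = \<mu> * (\<integral>x. (u x)\<^sup>2 \<partial>lborel)"
    and min: "\<And>v. borel_H \<Omega> v \<Longrightarrow> \<mu> * (\<integral>x. (v x)\<^sup>2 \<partial>lborel) \<le> energy_L v v"
  shows "energy_L u \<phi> = \<mu> * (\<integral>x. u x * \<phi> x \<partial>lborel)"
proof -
  have p: "form_pair u u" "form_pair u \<phi>" "form_pair \<phi> u" "form_pair \<phi> \<phi>"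
    using borel_H_form_pair \<Omega> u \<phi> by auto
  have sq: "sq_integrable lborel u" "sq_integrable lborel \<phi>"
    using borel_H_sq_integrable u \<phi> \<Omega> by auto
  have "2 * (energy_L u \<phi> - \<mu> * (\<integral>x. u x * \<phi> x \<partial>lborel)) = 0"
  proof (rule linear_coefficient_zero[where c="energy_L \<phi> \<phi> - \<mu> * (\<integral>x. (\<phi> x)\<^sup>2 \<partial>lborel)"])
    fix t :: real
    have "(\<integral>x. (u x + t * \<phi> x)\<^sup>2 \<partial>lborel) = (\<integral>x. (u x)\<^sup>2 + 2 * t * (u x * \<phi> x) + t\<^sup>2 * (\<phi> x)\<^sup>2 \<partial>lborel)"
      by (rule Bochner_Integration.integral_cong) (auto simp: power2_eq_square algebra_simps)
    also have "\<dots> = (\<integral>x. (u x)\<^sup>2 \<partial>lborel) + 2 * t * (\<integral>x. u x * \<phi> x \<partial>lborel) + t\<^sup>2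
        * (\<integral>x. (\<phi> x)\<^sup>2 \<partial>lborel)"
      using sq sq_integrable_mult[OF sq] by (simp add: sq_integrable_sq)
    finally have i: "(\<integral>x. (u x + t * \<phi> x)\<^sup>2 \<partial>lborel)
      = (\<integral>x. (u x)\<^sup>2 \<partial>lborel) + 2 * t * (\<integral>x. u x * \<phi> x \<partial>lborel) + t\<^sup>2 * (\<integral>x. (\<phi> x)\<^sup>2 \<partial>lborel)" .
    have "\<mu> * (\<integral>x. (u x + t * \<phi> x)\<^sup>2 \<partial>lborel) \<le> energy_L (\<lambda>x. u x + t * \<phi> x) (\<lambda>x. u x + t * \<phi> x)"
      by (intro min borel_H_add borel_H_scale u \<phi>)
    then show "0 \<le> t * (2 * (energy_L u \<phi> - \<mu> * (\<integral>x. u x * \<phi> x \<partial>lborel)))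
        + t\<^sup>2 * (energy_L \<phi> \<phi> - \<mu> * (\<integral>x. (\<phi> x)\<^sup>2 \<partial>lborel))"
      unfolding i energy_L_square_expand[OF p] by (simp add: algebra_simps eq)
  qed
  then show ?thesis by simp
qed

text \<open>Near increments shrink under the absolute value, while the far product, which enters
  with a minus sign, grows. As the norm is unchanged, the absolute value of a minimiser is again a
  minimiser.\<close>

lemma energy_L_abs_le:
  fixes \<Omega> :: "'a::euclidean_space set"
  assumes \<Omega>: "bounded \<Omega>" "open \<Omega>" and u: "borel_H \<Omega> u"
  shows "borel_H \<Omega> (\<lambda>x. \<bar>u x\<bar>)" "energy_L (\<lambda>x. \<bar>u x\<bar>) (\<lambda>x. \<bar>u x\<bar>) \<le> energy_L u u"
proof -
  have [measurable]: "u \<in> borel_measurable borel" using u by (rule borel_H_measurable)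
  show a: "borel_H \<Omega> (\<lambda>x. \<bar>u x\<bar>)"
    by (rule borel_H_bound[OF u]) (auto simp: borel_H_zero[OF u])
  have "(\<integral>p. increment (\<lambda>x. \<bar>u x\<bar>) p * increment (\<lambda>x. \<bar>u x\<bar>) p \<partial>near_measure)
    \<le> (\<integral>p. increment u p * increment u p \<partial>near_measure)"
    using sq_integrable_sq[OF borel_H_increment[OF u]] sq_integrable_sq[OF borel_H_increment[OF a]]
    by (intro integral_mono) (auto simp: increment_def abs_le_square_iff[symmetric] simp flip:
        power2_eq_square)
  moreover have "(\<integral>p. u (fst p) * u (snd p) \<partial>far_measure)
      \<le> (\<integral>p. \<bar>u (fst p)\<bar> * \<bar>u (snd p)\<bar> \<partial>far_measure)"
    using far_product_integrable(1)[OF borel_H_integrable[OF u \<Omega>] borel_H_integrable[OF u \<Omega>]]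
      far_product_integrable(1)[OF borel_H_integrable[OF a \<Omega>] borel_H_integrable[OF a \<Omega>]]
    by (intro integral_mono) (auto simp: abs_mult[symmetric])
  moreover have c: "0 < log_lap_c DIM('a)" by (rule log_lap_c_pos)
  ultimately show "energy_L (\<lambda>x. \<bar>u x\<bar>) (\<lambda>x. \<bar>u x\<bar>) \<le> energy_L u u"
    by (simp add: energy_L_eq add_mono diff_mono mult_left_mono)
qed

lemma nonneg_first_eigenfunction_exists:
  fixes \<Omega> :: "'a::euclidean_space set"
  assumes \<Omega>: "bounded \<Omega>" "open \<Omega>" "\<Omega> \<noteq> {}"
  obtains u where "borel_H \<Omega> u" "\<And>x. 0 \<le> u x" "(\<integral>x. (u x)\<^sup>2 \<partial>lborel) = 1"
    "\<And>\<phi>. borel_H \<Omega> \<phi> \<Longrightarrow> energy_L u \<phi> = first_eigenvalue \<Omega> * (\<integral>x. u x * \<phi> x \<partial>lborel)"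
proof -
  obtain u where u: "borel_H \<Omega> u" "(\<integral>x. (u x)\<^sup>2 \<partial>lborel) = 1" "energy_L u u = first_eigenvalue \<Omega>"
    and min: "\<And>v. borel_H \<Omega> v \<Longrightarrow> first_eigenvalue \<Omega> * (\<integral>x. (v x)\<^sup>2 \<partial>lborel) \<le> energy_L v v"
    using first_eigenvalue_attained[OF \<Omega>] by blast
  note a = energy_L_abs_le[OF \<Omega>(1,2) u(1)]
  have "energy_L (\<lambda>x. \<bar>u x\<bar>) (\<lambda>x. \<bar>u x\<bar>) = first_eigenvalue \<Omega> * (\<integral>x. \<bar>u x\<bar>\<^sup>2 \<partial>lborel)"
    using a(2) min[OF a(1)] u by simp
  from first_eigenfunction_equation[OF \<Omega>(1,2) a(1) _ this min] show ?thesis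
    using a(1) u(2) by (intro that[of "\<lambda>x. \<bar>u x\<bar>"]) auto
qed

section \<open>Test functions\<close>

lemma frechet_derivative_zero_off_support:
  fixes f :: "'a::euclidean_space \<Rightarrow> real"
  assumes "closed K" "\<And>x. x \<notin> K \<Longrightarrow> f x = 0" "x \<notin> K"
  shows "frechet_derivative f (at x) h = 0"
proof -
  have "((\<lambda>_. 0::real) has_derivative (\<lambda>_. 0)) (at x)" by simp
  then have "(f has_derivative (\<lambda>_. 0)) (at x)"
    by (rule has_derivative_transform_within_open[of _ _ _ UNIV "- K"]) (use assms in auto)
  then have "(\<lambda>_. 0) = frechet_derivative f (at x)" by (rule frechet_derivative_at)
  then show ?thesis by metis
qed

lemma linear_euclidean_expand:
  fixes f :: "'a::euclidean_space \<Rightarrow> real"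
  assumes "linear f" shows "f h = (\<Sum>b\<in>Basis. (h \<bullet> b) * f b)"
proof -
  have "f h = f (\<Sum>b\<in>Basis. (h \<bullet> b) *\<^sub>R b)" by (simp add: euclidean_representation)
  also have "\<dots> = (\<Sum>b\<in>Basis. (h \<bullet> b) * f b)"
    by (simp add: linear_sum[OF assms] linear_cmul[OF assms])
  finally show ?thesis .
qed

text \<open>The partial derivatives are continuous and vanish off K, hence are bounded. The first
  two hypotheses have the shape that \<open>C_diff (Suc 0)\<close> unfolds to.\<close>

lemma compact_support_C1_bounds:
  fixes f :: "'a::euclidean_space \<Rightarrow> real"
  assumes d: "\<And>x. f differentiable at x"
    and c: "\<And>b. b \<in> Basis \<Longrightarrow> continuous_on UNIV (\<lambda>x. frechet_derivative f (at x) b)"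
    and K: "compact K" "\<And>x. x \<notin> K \<Longrightarrow> f x = 0"
  obtains L where "0 \<le> L" "\<And>x h. \<bar>frechet_derivative f (at x) h\<bar> \<le> L * norm h"
    "\<And>x y. \<bar>f x - f y\<bar> \<le> L * norm (x - y)"
proof -
  let ?D = "\<lambda>x. frechet_derivative f (at x)"
  have der: "(f has_derivative ?D x) (at x)" for x
    using d by (simp add: frechet_derivative_works)
  have "\<exists>B. \<forall>x. \<bar>?D x b\<bar> \<le> B" if b: "b \<in> Basis" for b
  proof -
    have "bounded ((\<lambda>x. ?D x b) ` K)"
      using continuous_on_subset[OF c[OF b]] K(1)
          by (intro compact_imp_bounded compact_continuous_image) auto
    then obtain B where B: "\<And>x. x \<in> K \<Longrightarrow> \<bar>?D x b\<bar> \<le> B" by (auto simp: bounded_iff)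
    have "\<bar>?D x b\<bar> \<le> max B 0" for x
      using B[of x] frechet_derivative_zero_off_support[of K f x b] K(2) compact_imp_closed[OF K(1)]
      by (cases "x \<in> K") auto
    then show ?thesis by blast
  qed
  then obtain B where B: "\<And>b x. b \<in> Basis \<Longrightarrow> \<bar>?D x b\<bar> \<le> B b" by metis
  define L where "L = (\<Sum>b\<in>(Basis::'a set). \<bar>B b\<bar>)"
  have L: "\<bar>?D x h\<bar> \<le> L * norm h" for x h
  proof -
    have "?D x h = (\<Sum>b\<in>Basis. (h \<bullet> b) * ?D x b)"
      using has_derivative_linear[OF der] by (rule linear_euclidean_expand)
    also have "\<bar>\<dots>\<bar> \<le> (\<Sum>b\<in>Basis. norm h * \<bar>B b\<bar>)"
      by (intro order_trans[OF sum_abs] sum_mono)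
         (auto simp: abs_mult intro!: mult_mono Basis_le_norm order_trans[OF B])
    finally show ?thesis by (simp add: L_def sum_distrib_left mult.commute)
  qed
  have "\<bar>f x - f y\<bar> \<le> L * norm (x - y)" for x y
  proof -
    have "norm (f x - f y) \<le> L * norm (x - y)"
    proof (rule differentiable_bound[OF convex_UNIV])
      show "(f has_derivative ?D z) (at z within UNIV)" for z using der by simp
      show "onorm (?D z) \<le> L" for z
        using L by (intro onorm_le) (auto simp: mult.commute)
    qed auto
    then show ?thesis by simp
  qed
  moreover have "0 \<le> L" by (auto simp: L_def intro: sum_nonneg)
  ultimately show ?thesis using that L by blast
qed

lemma test_function_support:
  assumes "\<phi> \<in> test_functions \<Omega>"
  obtains K where "compact K" "K \<subseteq> \<Omega>" "\<And>x. x \<notin> K \<Longrightarrow> \<phi> x = 0"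
  using assms closure_subset[of "{x. \<phi> x \<noteq> 0}"]
  by (intro that[of "closure {x. \<phi> x \<noteq> 0}"]) (auto simp: test_functions_def)

text \<open>A compactly supported C^1 function is Lipschitz, and Lipschitz functions of bounded
  support have finite energy.\<close>

lemma test_function_borel_H:
  fixes \<Omega> :: "'a::euclidean_space set"
  assumes "\<phi> \<in> test_functions \<Omega>"
  shows "borel_H \<Omega> \<phi>"
proof -
  have "C_diff (Suc 0) \<phi>" using assms unfolding test_functions_def by blast
  then have d: "\<And>x. \<phi> differentiable at x"
      "\<And>b. b \<in> Basis \<Longrightarrow> continuous_on UNIV (\<lambda>x. frechet_derivative \<phi> (at x) b)"
    by auto
  obtain K where K: "compact K" "K \<subseteq> \<Omega>" "\<And>x. x \<notin> K \<Longrightarrow> \<phi> x = 0"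
    by (rule test_function_support[OF assms that])
  obtain L where "0 \<le> L" "\<And>x h. \<bar>frechet_derivative \<phi> (at x) h\<bar> \<le> L * norm h"
    and L: "\<And>x y. \<bar>\<phi> x - \<phi> y\<bar> \<le> L * norm (x - y)"
    by (rule compact_support_C1_bounds[OF d K(1,3) that])
  obtain R where "\<And>x. x \<in> K \<Longrightarrow> norm x < R"
    using compact_imp_bounded[OF K(1)] unfolding bounded_pos_less by blast
  then have R: "\<phi> x = 0" if "R \<le> norm x" for x using K(3) that by (meson not_less)
  show ?thesis
    unfolding borel_H_def using increment_sq_integrable_Lipschitz[of \<phi> L R, OF L R] K by auto
qed

section \<open>The maximum principle forces a positive eigenvalue\<close>

lemma borel_H_in_V_space:
  fixes \<Omega> :: "'a::euclidean_space set"
  assumes \<Omega>: "bounded \<Omega>" "open \<Omega>" and u: "borel_H \<Omega> u"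
  shows "u \<in> V_space \<Omega>"
proof -
  have [measurable]: "u \<in> borel_measurable borel" using u by (rule borel_H_measurable)
  have [measurable]: "\<Omega> \<in> sets borel" using \<Omega> by simp
  have A [measurable]: "\<Omega> \<times> \<Omega> \<in> sets borel" using \<Omega> by (intro borel_open open_Times)
  have i: "integrable lborel u" using borel_H_integrable[OF u \<Omega>] .
  have "set_integrable lebesgue K u" if "compact K" for K
  proof -
    have [measurable]: "K \<in> sets borel" using that by (intro borel_compact)
    have "integrable lborel (\<lambda>x. indicator K x *\<^sub>R u x)"
      using i by (intro integrable_mult_indicator) auto
    then show ?thesis unfolding set_integrable_def by (subst integrable_completion) auto
  qed
  moreover have "(\<integral>\<^sup>+x. ennreal (\<bar>u x\<bar> / (1 + norm x) ^ DIM('a)) \<partial>lebesgue) < \<infinity>"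
  proof -
    have "(\<integral>\<^sup>+x. ennreal (\<bar>u x\<bar> / (1 + norm x) ^ DIM('a)) \<partial>lborel) \<le> (\<integral>\<^sup>+x. ennreal \<bar>u x\<bar> \<partial>lborel)"
    proof (intro nn_integral_mono ennreal_leI)
      fix x :: 'a
      have "1 \<le> (1 + norm x) ^ DIM('a)" by (intro one_le_power) auto
      then have "\<bar>u x\<bar> / (1 + norm x) ^ DIM('a) \<le> \<bar>u x\<bar> / 1"
        by (intro divide_left_mono) (auto simp: add_pos_nonneg)
      then show "\<bar>u x\<bar> / (1 + norm x) ^ DIM('a) \<le> \<bar>u x\<bar>" by simp
    qed
    also have "\<dots> < \<infinity>" using i by (simp add: integrable_iff_bounded)
    finally show ?thesis by (simp add: nn_integral_completion)
  qed
  moreover have "gagliardo_log (near_pairs \<inter> \<Omega> \<times> \<Omega>) u < \<infinity>"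
  proof -
    have "gagliardo_log (near_pairs \<inter> \<Omega> \<times> \<Omega>) u \<le> (\<integral>\<^sup>+p. ennreal ((increment u p)\<^sup>2) \<partial>near_measure)"
      by (subst gagliardo_log_eq_near_measure) (auto intro!: nn_integral_mono simp: indicator_def)
    also have "\<dots> < \<infinity>" using borel_H_increment[OF u] by (simp add: sq_integrable_iff_nn)
    finally show ?thesis .
  qed
  moreover have "(\<integral>\<^sup>+x\<in>\<Omega>. ennreal ((u x)\<^sup>2) \<partial>lebesgue) < \<infinity>"
  proof -
    have "(\<integral>\<^sup>+x\<in>\<Omega>. ennreal ((u x)\<^sup>2) \<partial>lborel) \<le> (\<integral>\<^sup>+x. ennreal ((u x)\<^sup>2) \<partial>lborel)"
      by (auto intro!: nn_integral_mono simp: indicator_def)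
    also have "\<dots> < \<infinity>" using borel_H_sq_integrable[OF u \<Omega>(1)] by (simp add: sq_integrable_iff_nn)
    finally show ?thesis by (simp add: nn_integral_completion)
  qed
  ultimately show ?thesis by (simp add: V_space_def L10_space_def)
qed

lemma maximum_principle_imp_pos:
  fixes \<Omega> :: "'a::euclidean_space set"
  assumes \<Omega>: "bounded \<Omega>" "open \<Omega>" "\<Omega> \<noteq> {}" and mp: "maximum_principle \<Omega>"
  shows "0 < first_eigenvalue \<Omega>"
proof (rule ccontr)
  assume "\<not> 0 < first_eigenvalue \<Omega>"
  then have neg: "first_eigenvalue \<Omega> \<le> 0" by simp
  obtain u where u: "borel_H \<Omega> u" "\<And>x. 0 \<le> u x" "(\<integral>x. (u x)\<^sup>2 \<partial>lborel) = 1"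
    "\<And>\<phi>. borel_H \<Omega> \<phi> \<Longrightarrow> energy_L u \<phi> = first_eigenvalue \<Omega> * (\<integral>x. u x * \<phi> x \<partial>lborel)"
    by (rule nonneg_first_eigenfunction_exists[OF \<Omega> that])
  let ?v = "\<lambda>x. (-1) * u x"
  have v: "borel_H \<Omega> ?v" by (rule borel_H_scale[OF u(1)])
  have "weakly_log_superharmonic \<Omega> ?v"
    unfolding weakly_log_superharmonic_def
  proof (intro ballI impI)
    fix \<phi> assume \<phi>: "\<phi> \<in> test_functions \<Omega>" "\<forall>x. 0 \<le> \<phi> x"
    have p: "borel_H \<Omega> \<phi>" using test_function_borel_H[OF \<phi>(1)] .
    have "energy_L ?v \<phi> = energy_L \<phi> ?v"
      using v p by (intro energy_L_commute borel_H_measurable)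
    also have "\<dots> = - energy_L \<phi> u"
      using energy_L_scale_right(1)[OF borel_H_form_pair[OF p u(1) \<Omega>(1,2)], of "-1"] by simp
    also have "energy_L \<phi> u = energy_L u \<phi>"
      using u p by (intro energy_L_commute borel_H_measurable)
    finally have 1: "energy_L ?v \<phi> = - energy_L u \<phi>" .
    \<comment> \<open>By the eigenvalue equation the form is a nonpositive multiple of the integral
      of u \<phi>, and both factors are nonnegative.\<close>
    have "energy_L u \<phi> \<le> 0"
      unfolding u(4)[OF p]
      using neg u(2) \<phi>(2) by (intro mult_nonpos_nonneg Bochner_Integration.integral_nonneg) auto
    then show "0 \<le> energy_L ?v \<phi>" unfolding 1 by linarith
  qed
  moreover have "?v \<in> V_space \<Omega>" by (rule borel_H_in_V_space[OF \<Omega>(1,2) v])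
  moreover have "\<forall>x. x \<notin> \<Omega> \<longrightarrow> 0 \<le> ?v x" using borel_H_zero[OF u(1)] by simp
  \<comment> \<open>The maximum principle forces u \<le> 0, so u = 0 almost everywhere, against the
    normalisation.\<close>
  ultimately have "AE x in lebesgue. 0 \<le> ?v x"
    using mp unfolding maximum_principle_def by blast
  then have "AE x in lborel. 0 \<le> ?v x" by (simp only: AE_completion_iff)
  then have "AE x in lborel. (u x)\<^sup>2 = 0"
    by eventually_elim (use u(2) in \<open>force intro: antisym\<close>)
  then have "(\<integral>x. (u x)\<^sup>2 \<partial>lborel) = (\<integral>x. 0 \<partial>(lborel :: 'a measure))"
    using borel_H_measurable[OF u(1)] by (intro integral_cong_AE) auto
  then show False using u(3) by simp
qed

section \<open>Smooth mollifiers\<close>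

text \<open>The standard flat function exp (- 1 / t) with an additional pole t^(-m). With the
  parameter m the derivative is a combination of members of the same family, so all orders are
  handled at once.\<close>

definition flat_exp :: "nat \<Rightarrow> real \<Rightarrow> real" where
  "flat_exp m t = (if 0 < t then exp (- 1 / t) / t ^ m else 0)"

lemma flat_exp_tendsto_0: "(flat_exp m \<longlongrightarrow> 0) (at_right 0)"
proof -
  have "((\<lambda>s. s ^ m / exp s) \<longlongrightarrow> 0) (at_top :: real filter)" by (rule tendsto_power_div_exp_0)
  then have "((\<lambda>t. (inverse t) ^ m / exp (inverse t)) \<longlongrightarrow> 0) (at_right (0::real))"
    by (rule filterlim_compose) (rule filterlim_inverse_at_top_right)
  then show ?thesis
    by (rule Lim_transform_eventually)
       (auto simp: flat_exp_def eventually_at_right_field exp_minus field_simps intro!: exI[of _ 1])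
qed

lemma flat_exp_has_derivative:
  "(flat_exp m has_field_derivative (flat_exp (m + 2) t - real m * flat_exp (m + 1) t)) (at t)"
proof -
  consider "0 < t" | "t < 0" | "t = 0" by linarith
  then show ?thesis
  proof cases
    case 1
    have p: "((\<lambda>t. t ^ m) has_field_derivative real m * t ^ m / t) (at t)"
      by (rule DERIV_cong[OF DERIV_pow]) (use 1 in \<open>cases m; simp\<close>)
    have e: "((\<lambda>t. exp (- 1 / t)) has_field_derivative exp (- 1 / t) / t\<^sup>2) (at t)"
      using 1 by (auto intro!: derivative_eq_intros simp: power2_eq_square)
    have "((\<lambda>t. exp (- 1 / t) / t ^ m) has_field_derivative
        (flat_exp (m + 2) t - real m * flat_exp (m + 1) t)) (at t)"
      by (rule DERIV_cong[OF DERIV_divide[OF e p]])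
         (use 1 in \<open>auto simp: flat_exp_def power_add field_simps power2_eq_square\<close>)
    then show ?thesis
      by (rule DERIV_cong_ev[THEN iffD1, OF refl _ refl, rotated])
         (use 1 in \<open>auto simp: flat_exp_def intro!: eventually_nhds_in_open[of "{0<..}", THEN
             eventually_mono]\<close>)
  next
    case 2
    have "((\<lambda>t. 0) has_field_derivative 0) (at t)" by simp
    then have "(flat_exp m has_field_derivative 0) (at t)"
      by (rule DERIV_cong_ev[THEN iffD1, OF refl _ refl, rotated])
         (use 2 in \<open>auto simp: flat_exp_def intro!: eventually_nhds_in_open[of "{..<0}", THEN
             eventually_mono]\<close>)
    then show ?thesis using 2 by (simp add: flat_exp_def)
  next
    case 3
    \<comment> \<open>From the right the difference quotient at 0 is
      \<open>flat_exp (Suc m)\<close>, which tends to 0; from the left it is 0.\<close>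
    have "((\<lambda>h. (flat_exp m (0 + h) - flat_exp m 0) / h) \<longlongrightarrow> 0) (at 0)"
    proof (rule filterlim_split_at)
      show "((\<lambda>h. (flat_exp m (0 + h) - flat_exp m 0) / h) \<longlongrightarrow> 0) (at_left 0)"
        by (rule Lim_transform_eventually[OF tendsto_const])
           (auto simp: flat_exp_def eventually_at_left_field intro!: exI[of _ "-1"])
      show "((\<lambda>h. (flat_exp m (0 + h) - flat_exp m 0) / h) \<longlongrightarrow> 0) (at_right 0)"
        by (rule Lim_transform_eventually[OF flat_exp_tendsto_0[of "Suc m"]])
           (auto simp: flat_exp_def eventually_at_right_field intro!: exI[of _ 1])
    qed
    then have "(flat_exp m has_field_derivative 0) (at 0)" by (simp add: DERIV_def)
    then show ?thesis using 3 by (simp add: flat_exp_def)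
  qed
qed

text \<open>A class that contains the radial bump and is stable under directional derivatives.
  Smoothness of every order then follows by induction, without formulas for higher
  derivatives.\<close>

inductive smooth_generated :: "('a::euclidean_space \<Rightarrow> real) \<Rightarrow> bool" where
  const: "smooth_generated (\<lambda>x. c)"
| inner: "smooth_generated (\<lambda>x. x \<bullet> b)"
| flat: "smooth_generated (\<lambda>x. flat_exp m (1 - s * (x \<bullet> x)))"
| add: "smooth_generated f \<Longrightarrow> smooth_generated g \<Longrightarrow> smooth_generated (\<lambda>x. f x + g x)"
| mult: "smooth_generated f \<Longrightarrow> smooth_generated g \<Longrightarrow> smooth_generated (\<lambda>x. f x * g x)"

lemma smooth_generated_derivative:
  assumes "smooth_generated f"
  shows "\<exists>f'. (\<forall>x. (f has_derivative f' x) (at x)) \<and> (\<forall>h. smooth_generated (\<lambda>x. f' x h))"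
  using assms
proof induction
  case (const c)
  show ?case by (rule exI[of _ "\<lambda>x h. 0"]) (auto intro: smooth_generated.const)
next
  case (inner b)
  show ?case
    by (rule exI[of _ "\<lambda>x h. h \<bullet> b"]) (auto intro: smooth_generated.const has_derivative_inner_left)
next
  case (flat m s)
  let ?f' = "\<lambda>x h. (flat_exp (m + 2) (1 - s * (x \<bullet> x)) + (- real m)
      * flat_exp (m + 1) (1 - s * (x \<bullet> x)))
      * ((- 2 * s) * (x \<bullet> h))"
  have "((\<lambda>x. flat_exp m (1 - s * (x \<bullet> x))) has_derivative ?f' x) (at x)" for x :: 'a
  proof -
    have "((\<lambda>x. 1 - s * (x \<bullet> x)) has_derivative (\<lambda>h. (- 2 * s) * (x \<bullet> h))) (at x)"
      by (auto intro!: derivative_eq_intros simp: inner_commute)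
    then have "((\<lambda>x. flat_exp m (1 - s * (x \<bullet> x))) has_derivative
        (\<lambda>h. (flat_exp (m + 2) (1 - s * (x \<bullet> x)) - real m * flat_exp (m + 1) (1 - s * (x \<bullet> x)))
          * ((- 2 * s) * (x \<bullet> h)))) (at x)"
      using has_derivative_compose[OF _ flat_exp_has_derivative[unfolded has_field_derivative_def]]
          by blast
    then show ?thesis by simp
  qed
  moreover have "smooth_generated (\<lambda>x. ?f' x h)" for h
    by (intro smooth_generated.intros)
  ultimately show ?case by (intro exI[of _ ?f']) blast
next
  case (add f g)
  then obtain f' g' where "\<forall>x. (f has_derivative f' x) (at x)" "\<forall>h. smooth_generated (\<lambda>x. f' x h)"
    "\<forall>x. (g has_derivative g' x) (at x)" "\<forall>h. smooth_generated (\<lambda>x. g' x h)" by blast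
  then show ?case
    by (intro exI[of _ "\<lambda>x h. f' x h + g' x h"]) (auto intro: smooth_generated.add
        has_derivative_add)
next
  case (mult f g)
  then obtain f' g' where *: "\<And>x. (f has_derivative f' x) (at x)" "\<forall>h. smooth_generated
      (\<lambda>x. f' x h)"
    "\<And>x. (g has_derivative g' x) (at x)" "\<forall>h. smooth_generated (\<lambda>x. g' x h)" by blast
  show ?case
    using has_derivative_mult[OF *(1,3)] * mult
    by (intro exI[of _ "\<lambda>x h. f x * g' x h + f' x h * g x"])
       (auto intro!: smooth_generated.add smooth_generated.mult)
qed

lemma smooth_generated_C_diff: "smooth_generated f \<Longrightarrow> C_diff k f"
proof (induction k arbitrary: f)
  case 0
  then obtain f' where "\<And>x. (f has_derivative f' x) (at x)"
    using smooth_generated_derivative by blast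
  then show ?case
    by (auto intro!: continuous_at_imp_continuous_on has_derivative_continuous)
next
  case (Suc k)
  obtain f' where f': "\<And>x. (f has_derivative f' x) (at x)" "\<And>h. smooth_generated (\<lambda>x. f' x h)"
    using smooth_generated_derivative[OF Suc.prems] by blast
  have "f' x = frechet_derivative f (at x)" for x using f'(1) by (rule frechet_derivative_at)
  then show ?case using f' Suc.IH by (auto simp: differentiable_def)
qed

definition mollification :: "('a::euclidean_space \<Rightarrow> real) \<Rightarrow> ('a \<Rightarrow> real) \<Rightarrow> 'a \<Rightarrow> real" where
  "mollification g \<rho> x = (\<integral>y. g y * \<rho> (x - y) \<partial>lborel)"

text \<open>Differentiation under the integral sign. The constant L bounds both the derivative and
  the difference quotients of \<rho>, so the remainder quotients are at most 2 L and 2 L |g| is an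
  integrable majorant.\<close>

lemma mollification_has_derivative:
  fixes g \<rho> :: "'a::euclidean_space \<Rightarrow> real"
  assumes g: "integrable lborel g"
    and d: "\<And>x. \<rho> differentiable at x"
    and c: "\<And>b. b \<in> Basis \<Longrightarrow> continuous_on UNIV (\<lambda>x. frechet_derivative \<rho> (at x) b)"
    and K: "compact K" "\<And>x. x \<notin> K \<Longrightarrow> \<rho> x = 0"
  shows "(mollification g \<rho> has_derivative
    (\<lambda>h. mollification g (\<lambda>z. frechet_derivative \<rho> (at z) h) x)) (at x)"
proof -
  let ?D = "\<lambda>x. frechet_derivative \<rho> (at x)"
  have der: "(\<rho> has_derivative ?D x) (at x)" for x
    using d by (simp add: frechet_derivative_works)
  obtain L where L: "0 \<le> L" "\<And>x h. \<bar>?D x h\<bar> \<le> L * norm h" "\<And>x y. \<bar>\<rho> x - \<rho> y\<bar> \<le> L * norm (x - y)"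
    by (rule compact_support_C1_bounds[OF d c K that])
  have gm [measurable]: "g \<in> borel_measurable borel" using borel_measurable_integrable[OF g] by simp
  have rc: "continuous_on UNIV \<rho>"
    using der by (auto intro!: continuous_at_imp_continuous_on has_derivative_continuous)
  have rm [measurable]: "\<rho> \<in> borel_measurable borel" using rc
      by (rule borel_measurable_continuous_onI)
  have lin: "?D z h = (\<Sum>b\<in>Basis. (h \<bullet> b) * ?D z b)" for z h
    using has_derivative_linear[OF der] by (rule linear_euclidean_expand)
  have Dm [measurable]: "(\<lambda>z. ?D z h) \<in> borel_measurable borel" for h
    by (subst lin) (intro borel_measurable_sum borel_measurable_times borel_measurable_const
        borel_measurable_continuous_onI[OF c])
  obtain B where B: "\<And>x. \<bar>\<rho> x\<bar> \<le> B"
  proof -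
    have "bounded (\<rho> ` K)"
      using continuous_on_subset[OF rc] K(1) by (intro compact_imp_bounded compact_continuous_image)
          auto
    then obtain B where B: "\<And>x. x \<in> K \<Longrightarrow> \<bar>\<rho> x\<bar> \<le> B" by (auto simp: bounded_iff)
    have "\<bar>\<rho> x\<bar> \<le> max B 0" for x using B[of x] K(2)[of x] by (cases "x \<in> K") auto
    then show ?thesis by (rule that)
  qed
  have gi: "integrable lborel (\<lambda>y. g y * k y)"
    if [measurable]: "k \<in> borel_measurable borel" and k: "\<And>y. \<bar>k y\<bar> \<le> C" for k :: "'a \<Rightarrow> real" and C
  proof (rule Bochner_Integration.integrable_bound)
    show "integrable lborel (\<lambda>y. g y * C)" using g by simp
    show "AE y in lborel. norm (g y * k y) \<le> norm (g y * C)"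
      by (intro AE_I2) (auto simp: abs_mult intro!: mult_left_mono order_trans[OF k])
  qed measurable
  have gr: "integrable lborel (\<lambda>y. g y * \<rho> (z - y))" for z by (rule gi[of _ B]) (auto simp: B)
  have gD: "integrable lborel (\<lambda>y. g y * ?D (z - y) h)" for z h
      by (rule gi[of _ "L * norm h"]) (auto simp: L)
  let ?M = "\<lambda>h. mollification g (\<lambda>z. ?D z h) x"
  show ?thesis
    unfolding has_derivative_at
  proof
    show "bounded_linear ?M"
    proof (rule bounded_linear_intro[where K="(\<integral>y. \<bar>g y\<bar> \<partial>lborel) * L"])
      show "?M (h + k) = ?M h + ?M k" for h k
        using gD[of x h] gD[of x k] linear_add[OF has_derivative_linear[OF der]]
        by (simp add: mollification_def distrib_left)
      show "?M (r *\<^sub>R h) = r *\<^sub>R ?M h" for r h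
        using linear_cmul[OF has_derivative_linear[OF der]]
        by (simp add: mollification_def mult.left_commute)
      fix h
      have "norm (?M h) \<le> (\<integral>y. \<bar>g y * ?D (x - y) h\<bar> \<partial>lborel)"
        unfolding mollification_def real_norm_def by (rule integral_abs_bound)
      also have "\<dots> \<le> (\<integral>y. \<bar>g y\<bar> * (L * norm h) \<partial>lborel)"
        using integrable_abs[OF gD[of x h]] g
        by (intro integral_mono) (auto simp: abs_mult intro!: mult_left_mono L)
      finally show "norm (?M h) \<le> norm h * ((\<integral>y. \<bar>g y\<bar> \<partial>lborel) * L)" by (simp add: mult_ac)
    qed
    show "(\<lambda>h. norm (mollification g \<rho> (x + h) - mollification g \<rho> x - ?M h) / norm h) \<midarrow>0\<rightarrow> 0"
      \<comment> \<open>Passing to sequences makes dominated convergence applicable.\<close>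
      unfolding tendsto_at_iff_sequentially
    proof (intro allI impI)
      fix X :: "nat \<Rightarrow> 'a" assume X: "\<forall>i. X i \<in> UNIV - {0}" "X \<longlonglongrightarrow> 0"
      define q where "q n y = norm (\<rho> ((x - y) + X n) - \<rho> (x - y)
          - ?D (x - y) (X n)) / norm (X n)" for n y
      have [measurable]: "q n \<in> borel_measurable borel" for n unfolding q_def by measurable
      have X0: "X n \<noteq> 0" for n using X by auto
      have q0: "(\<lambda>n. q n y) \<longlonglongrightarrow> 0" for y
      proof -
        have "(\<lambda>h. norm (\<rho> ((x - y) + h) - \<rho> (x - y) - ?D (x - y) h) / norm h) \<midarrow>0\<rightarrow> 0"
          using der[of "x - y"] unfolding has_derivative_at by blast
        then show ?thesis
          using X unfolding tendsto_at_iff_sequentially q_def by (auto simp: o_def)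
      qed
      have qb: "q n y \<le> 2 * L" "0 \<le> q n y" for n y
      proof -
        have "norm (\<rho> ((x - y) + X n) - \<rho> (x - y) - ?D (x - y) (X n)) \<le> L * norm (X n) + L
            * norm (X n)"
          using L(2)[of "x - y" "X n"] L(3)[of "(x - y) + X n" "x - y"] by simp
        then show "q n y \<le> 2 * L" unfolding q_def using X0[of n] by (simp add: divide_le_eq)
        show "0 \<le> q n y" by (simp add: q_def)
      qed
      have int: "(\<lambda>n. \<integral>y. \<bar>g y\<bar> * q n y \<partial>lborel) \<longlonglongrightarrow> (\<integral>y. \<bar>g y\<bar> * 0 \<partial>lborel)"
      proof (rule integral_dominated_convergence[where w="\<lambda>y. \<bar>g y\<bar> * (2 * L)"])
        show "AE y in lborel. (\<lambda>n. \<bar>g y\<bar> * q n y) \<longlonglongrightarrow> \<bar>g y\<bar> * 0"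
          by (intro AE_I2 tendsto_mult_left q0)
        show "AE y in lborel. norm (\<bar>g y\<bar> * q n y) \<le> \<bar>g y\<bar> * (2 * L)" for n
          using qb by (intro AE_I2) (auto simp: abs_mult intro!: mult_left_mono)
      qed (use g in auto)
      have le: "norm (mollification g \<rho> (x + X n) - mollification g \<rho> x - ?M (X n)) / norm (X n)
        \<le> (\<integral>y. \<bar>g y\<bar> * q n y \<partial>lborel)" for n
      proof -
        have eq: "mollification g \<rho> (x + X n) - mollification g \<rho> x - ?M (X n)
          = (\<integral>y. g y * \<rho> (x + X n - y) - g y * \<rho> (x - y) - g y * ?D (x - y) (X n) \<partial>lborel)"
          using gr[of "x + X n"] gr[of x] gD[of x "X n"] by (simp add: mollification_def)
        have "norm (mollification g \<rho> (x + X n) - mollification g \<rho> x - ?M (X n))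
          \<le> (\<integral>y. \<bar>g y * \<rho> (x + X n - y) - g y * \<rho> (x - y) - g y * ?D (x - y) (X n)\<bar> \<partial>lborel)"
          unfolding eq real_norm_def by (rule integral_abs_bound)
        also have "\<dots> = (\<integral>y. (\<bar>g y\<bar> * q n y) * norm (X n) \<partial>lborel)"
        proof (rule Bochner_Integration.integral_cong[OF refl])
          fix y
          have "x + X n - y = (x - y) + X n" by simp
          then have "g y * \<rho> (x + X n - y) - g y * \<rho> (x - y) - g y * ?D (x - y) (X n)
            = g y * (\<rho> ((x - y) + X n) - \<rho> (x - y) - ?D (x - y) (X n))"
            by (simp only: right_diff_distrib)
          then have "\<bar>g y * \<rho> (x + X n - y) - g y * \<rho> (x - y) - g y * ?D (x - y) (X n)\<bar>
            = \<bar>g y\<bar> * \<bar>\<rho> ((x - y) + X n) - \<rho> (x - y) - ?D (x - y) (X n)\<bar>"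
            by (simp only: abs_mult)
          then show "\<bar>g y * \<rho> (x + X n - y) - g y * \<rho> (x - y) - g y * ?D (x - y) (X n)\<bar>
            = (\<bar>g y\<bar> * q n y) * norm (X n)" using X0[of n] by (simp add: q_def)
        qed
        also have "\<dots> = (\<integral>y. \<bar>g y\<bar> * q n y \<partial>lborel) * norm (X n)" by simp
        finally show ?thesis using X0[of n] by (simp add: divide_le_eq)
      qed
      have int0: "(\<lambda>n. \<integral>y. \<bar>g y\<bar> * q n y \<partial>lborel) \<longlonglongrightarrow> 0" using int by simp
      have nn: "0 \<le> norm (mollification g \<rho> (x + X n) - mollification g \<rho> x
          - ?M (X n)) / norm (X n)" for n
        by simp
      show "((\<lambda>h. norm (mollification g \<rho> (x + h) - mollification g \<rho> x - ?M h) / norm h) \<circ> X) \<longlonglongrightarrow> 0"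
        unfolding o_def
        by (rule real_tendsto_sandwich[OF always_eventually[OF allI[OF nn]]
            always_eventually[OF allI[OF le]]
              tendsto_const int0])
    qed
  qed
qed

text \<open>Induction over all \<rho> at once: a partial derivative of the mollification is the
  mollification by the partial derivative of \<rho>, which is again smooth and vanishes off
  K.\<close>

lemma mollification_C_diff:
  fixes g \<rho> :: "'a::euclidean_space \<Rightarrow> real"
  assumes g: "integrable lborel g" and K: "compact K"
  shows "(\<And>j. C_diff j \<rho>) \<Longrightarrow> (\<And>x. x \<notin> K \<Longrightarrow> \<rho> x = 0) \<Longrightarrow> C_diff k (mollification g \<rho>)"
proof (induction k arbitrary: \<rho>)
  case 0
  have "C_diff (Suc 0) \<rho>" by (rule 0)
  then have "(mollification g \<rho> has_derivative
    (\<lambda>h. mollification g (\<lambda>z. frechet_derivative \<rho> (at z) h) x)) (at x)" for x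
    by (intro mollification_has_derivative[OF g _ _ K 0(2)]) auto
  then show ?case
    by (auto intro!: continuous_at_imp_continuous_on has_derivative_continuous)
next
  case (Suc k)
  have "C_diff (Suc 0) \<rho>" by (rule Suc)
  then have d: "(mollification g \<rho> has_derivative
    (\<lambda>h. mollification g (\<lambda>z. frechet_derivative \<rho> (at z) h) x)) (at x)" for x
    by (intro mollification_has_derivative[OF g _ _ K Suc.prems(2)]) auto
  have f: "frechet_derivative (mollification g \<rho>) (at x) b
    = mollification g (\<lambda>z. frechet_derivative \<rho> (at z) b) x" for x b
    using frechet_derivative_at[OF d] by metis
  have "C_diff k (mollification g (\<lambda>z. frechet_derivative \<rho> (at z) b))" if b: "b \<in> Basis" for b
  proof (rule Suc.IH)
    show "C_diff j (\<lambda>z. frechet_derivative \<rho> (at z) b)" for j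
      using Suc.prems(1)[of "Suc j"] b by simp
    show "x \<notin> K \<Longrightarrow> frechet_derivative \<rho> (at x) b = 0" for x
      using frechet_derivative_zero_off_support[OF compact_imp_closed[OF K], of \<rho> x b] Suc.prems(2)
          by blast
  qed
  then show ?case using d by (auto simp: f differentiable_def)
qed

text \<open>The point is the last bound, with C independent of \<epsilon>: a bump of radius
  \<epsilon> and mass 1 has height of order \<epsilon>^(-N), which the kernel matches up to a
  constant on |z| < \<epsilon>. This lets the energy control the mollification error.\<close>

lemma mollifiers_exist:
  obtains C where "0 < C" "\<And>\<epsilon>. 0 < \<epsilon> \<Longrightarrow> \<epsilon> \<le> 1 \<Longrightarrow>
    \<exists>\<rho> :: 'a::euclidean_space \<Rightarrow> real. (\<forall>k. C_diff k \<rho>) \<and> (\<forall>z. 0 \<le> \<rho> z)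
        \<and> (\<forall>z. \<epsilon> \<le> norm z \<longrightarrow> \<rho> z = 0) \<and>
      integrable lborel \<rho> \<and> (\<integral>z. \<rho> z \<partial>lborel) = 1 \<and> (\<forall>z. z \<noteq> 0 \<longrightarrow> \<rho> z \<le> C * near_kernel z)"
proof -
  define V where "V = unit_ball_vol (real DIM('a))"
  have V: "0 < V" by (simp add: V_def)
  \<comment> \<open>The profile exp (- 1 / s) at s = 3/4, its value where |z| = \<epsilon> /
    2.\<close>
  define a where "a = exp (- (4 / 3) :: real)"
  have a: "0 < a" by (simp add: a_def)
  \<comment> \<open>The bump is at least a on the ball of radius \<epsilon> / 2, so its mass is at
    least a V (\<epsilon> / 2)^N; C is the reciprocal without the power of \<epsilon>.\<close>
  define C where "C = 2 ^ DIM('a) / (a * V)"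
  have C: "0 < C" using a V by (simp add: C_def)
  show ?thesis
  proof (rule that[OF C])
    fix \<epsilon> :: real assume \<epsilon>: "0 < \<epsilon>" "\<epsilon> \<le> 1"
    define \<beta> where "\<beta> z = flat_exp 0 (1 - (1 / \<epsilon>\<^sup>2) * (z \<bullet> z))" for z :: 'a
    have s: "smooth_generated \<beta>" unfolding \<beta>_def by (rule smooth_generated.flat)
    have [measurable]: "\<beta> \<in> borel_measurable borel"
      using smooth_generated_C_diff[OF s, of 0] by (simp add: borel_measurable_continuous_onI)
    have nn: "z \<bullet> z = (norm z)\<^sup>2" for z :: 'a by (simp add: power2_norm_eq_inner)
    have b0: "0 \<le> \<beta> z" for z by (simp add: \<beta>_def flat_exp_def)
    have b1: "\<beta> z \<le> 1" for z by (simp add: \<beta>_def flat_exp_def)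
    have bz: "\<beta> z = 0" if "\<epsilon> \<le> norm z" for z
    proof -
      have "1 \<le> norm z / \<epsilon>" using that \<epsilon> by simp
      then have "1 \<le> (norm z / \<epsilon>)\<^sup>2" by (rule one_le_power)
      then have "\<not> 0 < 1 - (1 / \<epsilon>\<^sup>2) * (z \<bullet> z)" by (simp add: nn power_divide)
      then show ?thesis unfolding \<beta>_def flat_exp_def by (simp only: if_False)
    qed
    have bl: "a \<le> \<beta> z" if "norm z \<le> \<epsilon> / 2" for z
    proof -
      have "(norm z)\<^sup>2 \<le> (\<epsilon> / 2)\<^sup>2" using that by (intro power_mono) auto
      define s where "s = 1 - (1 / \<epsilon>\<^sup>2) * (z \<bullet> z)"
      have t: "3 / 4 \<le> s"
        using \<epsilon> \<open>(norm z)\<^sup>2 \<le> (\<epsilon> / 2)\<^sup>2\<close> by (simp add: s_def nn power_divide field_simps)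
      then have "1 / s \<le> 1 / (3 / 4)" by (intro divide_left_mono) auto
      moreover have "\<beta> z = flat_exp 0 s" by (simp add: \<beta>_def s_def)
      ultimately show ?thesis using t by (simp add: flat_exp_def a_def)
    qed
    have bi: "integrable lborel \<beta>"
    proof (rule Bochner_Integration.integrable_bound)
      show "integrable lborel (indicator (cball (0::'a) 1) :: 'a \<Rightarrow> real)"
        by (intro integrable_real_indicator) (auto simp: emeasure_cball_finite)
      show "AE z in lborel. norm (\<beta> z) \<le> norm (indicator (cball 0 1) z :: real)"
        using b0 b1 bz \<epsilon> by (intro AE_I2) (auto simp: indicator_def)
    qed simp
    define I where "I = (\<integral>z. \<beta> z \<partial>lborel)"
    have "a * (V * (\<epsilon> / 2) ^ DIM('a)) = (\<integral>z. a * indicator (cball (0::'a) (\<epsilon> / 2)) z \<partial>lborel)"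
      using \<epsilon> by (simp add: content_cball V_def)
    also have "\<dots> \<le> I"
      unfolding I_def
    proof (rule integral_mono)
      show "integrable lborel (\<lambda>z. a * indicator (cball (0::'a) (\<epsilon> / 2)) z)"
        by (intro integrable_mult_right integrable_real_indicator)
            (auto simp: emeasure_cball_finite)
      show "a * indicator (cball 0 (\<epsilon> / 2)) z \<le> \<beta> z" for z
        using bl[of z] b0[of z] by (auto simp: indicator_def)
    qed (rule bi)
    finally have I: "a * (V * (\<epsilon> / 2) ^ DIM('a)) \<le> I" .
    have I0: "0 < a * (V * (\<epsilon> / 2) ^ DIM('a))" using a V \<epsilon> by simp
    have Ipos: "0 < I" using I I0 by linarith
    have Ib: "1 / I \<le> C / \<epsilon> ^ DIM('a)"
    proof -
      have "1 / I \<le> 1 / (a * (V * (\<epsilon> / 2) ^ DIM('a)))"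
        using I I0 Ipos by (intro divide_left_mono) auto
      also have "\<dots> = C / \<epsilon> ^ DIM('a)" by (simp add: C_def power_divide)
      finally show ?thesis .
    qed
    let ?\<rho> = "\<lambda>z. (1 / I) * \<beta> z"
    have "smooth_generated ?\<rho>" by (intro smooth_generated.mult smooth_generated.const s)
    then have "\<forall>k. C_diff k ?\<rho>" using smooth_generated_C_diff by blast
    moreover have "?\<rho> z \<le> C * near_kernel z" if "z \<noteq> 0" for z
    proof (cases "\<epsilon> \<le> norm z")
      case True
      then show ?thesis using bz C by simp
    next
      case False
      have "?\<rho> z \<le> (1 / I) * 1" using b1 Ipos by (intro mult_left_mono) auto
      also have "\<dots> \<le> C / \<epsilon> ^ DIM('a)" using Ib by simp
      also have "\<dots> \<le> C / norm z ^ DIM('a)"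
        using False C that \<epsilon> by (intro divide_left_mono power_mono) auto
      finally show ?thesis using False \<epsilon> by (simp add: near_kernel_def)
    qed
    moreover have "(\<integral>z. ?\<rho> z \<partial>lborel) = 1" using Ipos by (simp add: I_def)
    moreover have "integrable lborel ?\<rho>" using bi by (rule integrable_mult_right)
    ultimately show "\<exists>\<rho> :: 'a \<Rightarrow> real. (\<forall>k. C_diff k \<rho>) \<and> (\<forall>z. 0 \<le> \<rho> z)
        \<and> (\<forall>z. \<epsilon> \<le> norm z \<longrightarrow> \<rho> z = 0) \<and>
      integrable lborel \<rho> \<and> (\<integral>z. \<rho> z \<partial>lborel) = 1 \<and> (\<forall>z. z \<noteq> 0 \<longrightarrow> \<rho> z \<le> C * near_kernel z)"
      using b0 bz Ipos by (intro exI[of _ ?\<rho>]) auto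
  qed
qed

section \<open>The boundary layer of a Lipschitz domain\<close>

text \<open>The layer is thin because about \<open>1 / t\<close> disjoint translates of it, in the direction
  transversal to the graph, fit into a ball.\<close>

lemma graph_layer_measure:
  fixes p e :: "'a::euclidean_space"
  assumes e: "norm e = 1" and g: "L-lipschitz_on {y. y \<bullet> e = 0} g" and t: "0 < t"
  defines "h \<equiv> \<lambda>x. x \<bullet> e - g (x - (x \<bullet> e) *\<^sub>R e)"
  shows "{x \<in> ball p r. 0 < h x \<and> h x < t} \<in> sets borel"
    and "emeasure lborel {x \<in> ball p r. 0 < h x \<and> h x < t}
      \<le> ennreal (2 * measure lborel (ball p (r + 1)) * t)"
proof -
  define S where "S = {x \<in> ball p r. 0 < h x \<and> h x < t}"
  have ee: "e \<bullet> e = 1" using e by (simp add: dot_square_norm)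
  have "continuous_on UNIV h"
    unfolding h_def
    by (intro continuous_intros continuous_on_compose2[OF lipschitz_on_continuous_on[OF g]])
       (auto simp: inner_diff_left ee)
  then have hm [measurable]: "h \<in> borel_measurable borel" by (rule borel_measurable_continuous_onI)
  have [measurable]: "ball p r \<in> sets borel" by simp
  show Sm: "{x \<in> ball p r. 0 < h x \<and> h x < t} \<in> sets borel" by measurable
  then have [measurable]: "S \<in> sets borel" by (simp add: S_def)
  have hs: "h (x + s *\<^sub>R e) = h x + s" for x s
    by (simp add: h_def inner_add_left ee algebra_simps)
  define B where "B = ball p (r + 1)"
  have [measurable]: "B \<in> sets borel" by (simp add: B_def)
  have Bf: "emeasure lborel B = ennreal (measure lborel B)"
    using emeasure_bounded_finite[of B] by (intro emeasure_eq_ennreal_measure) (auto simp: B_def)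
  have SB: "S \<subseteq> B" by (auto simp: S_def B_def)
  have Sf: "emeasure lborel S = ennreal (measure lborel S)"
    using emeasure_bounded_finite[of S] bounded_subset[OF bounded_ball, of S p "r + 1"] SB
    by (intro emeasure_eq_ennreal_measure) (auto simp: B_def)
  have mono: "measure lborel S \<le> measure lborel B"
    using SB Bf by (intro measure_mono_fmeasurable) (auto simp: fmeasurable_def)
  have "measure lborel S \<le> 2 * measure lborel B * t"
  proof (cases "1 \<le> t")
    case True
    have "measure lborel B * 1 \<le> measure lborel B * (2 * t)"
      using True by (intro mult_left_mono) auto
    then show ?thesis using mono by (simp add: mult_ac)
  next
    case False
    \<comment> \<open>The translates by j t with j < M are disjoint, since h increases by t with
      each shift, and they move points by at most 1, whence the ball of radius r + 1.\<close>
    define M where "M = nat \<lfloor>1 / t\<rfloor>"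
    have "1 \<le> 1 / t" using False t by (simp add: le_divide_eq)
    then have f1: "1 \<le> \<lfloor>1 / t\<rfloor>" by (simp add: le_floor_iff)
    then have M: "1 \<le> real M" "real M \<le> 1 / t" "1 / t < real M + 1"
      unfolding M_def using of_int_floor_le[of "1/t"] real_of_int_floor_add_one_gt[of "1/t"]
          by linarith+
    define T where "T j = {x. x - (real j * t) *\<^sub>R e \<in> S}" for j :: nat
    have Tm [measurable]: "T j \<in> sets borel" for j unfolding T_def by measurable
    have Te: "emeasure lborel (T j) = emeasure lborel S" for j
    proof -
      have "emeasure lborel (T j) = (\<integral>\<^sup>+x. indicator S (x + (- (real j * t)) *\<^sub>R e) \<partial>lborel)"
      proof -
        have "indicator (T j) x = (indicator S (x + (- (real j * t)) *\<^sub>R e) :: ennreal)" for x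
          by (simp add: T_def indicator_def)
        then show ?thesis using nn_integral_indicator[of "T j" lborel] by simp
      qed
      also have "\<dots> = (\<integral>\<^sup>+x. indicator S x \<partial>lborel)" by (rule nn_integral_lborel_shift) simp
      finally show ?thesis by simp
    qed
    have Th: "real j * t < h x \<and> h x < real (Suc j) * t" if "x \<in> T j" for j x
    proof -
      have "h (x - (real j * t) *\<^sub>R e) = h x - real j * t" using hs[of x "- (real j * t)"] by simp
      then show ?thesis using that by (simp add: T_def S_def algebra_simps)
    qed
    have "disjoint_family_on T {..<M}"
      unfolding disjoint_family_on_def
    proof (intro ballI impI)
      fix i j :: nat assume ij: "i \<noteq> j"
      have False if "x \<in> T a" "x \<in> T b" "a < b" for x a b
      proof -
        have "real (Suc a) * t \<le> real b * t" using that t by (intro mult_right_mono) auto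
        then show False using Th[OF that(1)] Th[OF that(2)] by linarith
      qed
      then show "T i \<inter> T j = {}" using ij by (metis disjoint_iff linorder_neqE_nat)
    qed
    then have "(\<Sum>j<M. emeasure lborel (T j)) = emeasure lborel (\<Union>j<M. T j)"
      by (intro sum_emeasure) auto
    also have "\<dots> \<le> emeasure lborel B"
    proof (rule emeasure_mono)
      show "(\<Union>j<M. T j) \<subseteq> B"
      proof
        fix x assume "x \<in> (\<Union>j<M. T j)"
        then obtain j where j: "j < M" "x \<in> T j" by auto
        have "real j * t \<le> real M * t" using j t by (intro mult_right_mono) auto
        also have "\<dots> \<le> 1" using M t by (simp add: le_divide_eq)
        finally have "norm ((real j * t) *\<^sub>R e) \<le> 1" using e t by simp
        moreover have "norm (p - (x - (real j * t) *\<^sub>R e)) < r"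
          using j by (simp add: T_def S_def dist_norm)
        ultimately show "x \<in> B"
          using norm_triangle_ineq4[of "p - (x - (real j * t) *\<^sub>R e)" "(real j * t) *\<^sub>R e"]
          by (simp add: B_def dist_norm)
      qed
    qed simp
    finally have "ennreal (real M * measure lborel S) \<le> ennreal (measure lborel B)"
      unfolding Te Sf Bf by (simp add: ennreal_mult ennreal_of_nat_eq_real_of_nat)
    then have 1: "real M * measure lborel S \<le> measure lborel B" by (simp add: ennreal_le_iff)
    \<comment> \<open>M \<ge> 1 and M + 1 > 1 / t give 2 M t \<ge> 1, the origin of the factor 2 in
      the estimate.\<close>
    have "1 * t \<le> real M * t" by (rule mult_right_mono[OF M(1) less_imp_le[OF t]])
    moreover have "1 < (real M + 1) * t" using M(3) t by (simp only: pos_divide_less_eq)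
    ultimately have "1 \<le> 2 * (real M * t)" unfolding distrib_right by linarith
    then have "measure lborel S * 1 \<le> measure lborel S * (2 * (real M * t))"
      by (intro mult_left_mono) auto
    also have "\<dots> = 2 * (real M * measure lborel S) * t" by simp
    also have "\<dots> \<le> 2 * measure lborel B * t" using 1 t
        by (intro mult_right_mono mult_left_mono) auto
    finally show ?thesis by simp
  qed
  then show "emeasure lborel {x \<in> ball p r. 0 < h x \<and> h x < t}
      \<le> ennreal (2 * measure lborel (ball p (r + 1)) * t)"
    using Sf unfolding S_def[symmetric] B_def[symmetric] by (simp add: ennreal_leI)
qed

text \<open>The height h above the graph is positive in \<Omega>, at most 0 at frontier points, and
  Lipschitz with constant 1 + 2 L, where the 2 bounds the projection along e by the triangle
  inequality. So points of \<Omega> close to the frontier lie in a graph layer of comparable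
  width.\<close>

lemma lipschitz_boundary_local_layer:
  fixes \<Omega> :: "'a::euclidean_space set"
  assumes "open \<Omega>" "lipschitz_boundary \<Omega>" "p \<in> frontier \<Omega>"
  shows "\<exists>\<delta>>0. \<exists>C\<ge>0. \<forall>t. 0 < t \<longrightarrow> t \<le> \<delta> \<longrightarrow>
    emeasure lborel {x\<in>\<Omega>. \<exists>q\<in>frontier \<Omega> \<inter> ball p \<delta>. dist q x < t} \<le> ennreal (C * t)"
proof -
  obtain r e g L where r: "0 < r" and e: "norm e = 1" and g: "L-lipschitz_on {y. y \<bullet> e = 0} g"
    and \<Omega>: "\<Omega> \<inter> ball p r = {x \<in> ball p r. g (x - (x \<bullet> e) *\<^sub>R e) < x \<bullet> e}"
    using assms(2,3) unfolding lipschitz_boundary_def by blast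
  have L: "0 \<le> L" using g by (rule lipschitz_on_nonneg)
  have ee: "e \<bullet> e = 1" using e by (simp add: dot_square_norm)
  define h where "h x = x \<bullet> e - g (x - (x \<bullet> e) *\<^sub>R e)" for x
  define V where "V = measure lborel (ball p (r + 1))"
  have hL: "h x - h q \<le> (1 + 2 * L) * dist q x" for x q
  proof -
    let ?P = "\<lambda>x. x - (x \<bullet> e) *\<^sub>R e"
    have xe: "\<bar>(x - q) \<bullet> e\<bar> \<le> dist q x"
      using Cauchy_Schwarz_ineq2[of "x - q" e] e by (simp add: dist_norm norm_minus_commute)
    have "dist (g (?P x)) (g (?P q)) \<le> L * dist (?P x) (?P q)"
      by (rule lipschitz_onD[OF g]) (auto simp: inner_diff_left ee)
    also have "dist (?P x) (?P q) = norm ((x - q) - ((x - q) \<bullet> e) *\<^sub>R e)"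
      by (simp add: dist_norm inner_diff_left algebra_simps)
    also have "\<dots> \<le> norm (x - q) + \<bar>(x - q) \<bullet> e\<bar>"
      using norm_triangle_ineq4[of "x - q" "((x - q) \<bullet> e) *\<^sub>R e"] e by simp
    also have "\<dots> \<le> 2 * dist q x" using xe by (simp add: dist_norm norm_minus_commute)
    finally have "\<bar>g (?P x) - g (?P q)\<bar> \<le> L * (2 * dist q x)"
      using L by (simp add: dist_real_def mult_left_mono)
    then show ?thesis using xe by (simp add: h_def inner_diff_left algebra_simps)
  qed
  \<comment> \<open>The radius r / 2 for q and t \<le> r / 2 keep x inside the ball in which
    \<Omega> lies above the graph.\<close>
  have "emeasure lborel {x\<in>\<Omega>. \<exists>q\<in>frontier \<Omega> \<inter> ball p (r / 2). dist q x < t}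
      \<le> ennreal (2 * V * (1 + 2 * L) * t)" if t: "0 < t" "t \<le> r / 2" for t
  proof -
    let ?s = "(1 + 2 * L) * t"
    have s: "0 < ?s" using t L by simp
    note gl = graph_layer_measure[OF e g s, of p r, folded h_def V_def]
    have "{x\<in>\<Omega>. \<exists>q\<in>frontier \<Omega> \<inter> ball p (r / 2). dist q x < t} \<subseteq> {x \<in> ball p r. 0 < h x \<and> h x < ?s}"
    proof
      fix x assume "x \<in> {x\<in>\<Omega>. \<exists>q\<in>frontier \<Omega> \<inter> ball p (r / 2). dist q x < t}"
      then obtain q where x: "x \<in> \<Omega>" and q: "q \<in> frontier \<Omega>" "dist p q < r / 2" "dist q x < t"
          by auto
      have xb: "x \<in> ball p r" using q t dist_triangle[of p x q] by simp
      have "q \<notin> \<Omega>" using q(1) assms(1) by (simp add: frontier_def interior_open)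
      moreover have "q \<in> ball p r" using q r by simp
      ultimately have "q \<notin> {x \<in> ball p r. g (x - (x \<bullet> e) *\<^sub>R e) < x \<bullet> e}" "q \<in> ball p r"
        unfolding \<Omega>[symmetric] by blast+
      then have hq: "h q \<le> 0" unfolding h_def by simp
      have "x \<in> \<Omega> \<inter> ball p r" using x xb by blast
      then have hx: "0 < h x" unfolding \<Omega> h_def by simp
      have "(1 + 2 * L) * dist q x < ?s" using q L by (intro mult_strict_left_mono) auto
      then show "x \<in> {x \<in> ball p r. 0 < h x \<and> h x < ?s}" using hL[of x q] hq hx xb by auto
    qed
    then have "emeasure lborel {x\<in>\<Omega>. \<exists>q\<in>frontier \<Omega> \<inter> ball p (r / 2). dist q x < t}
      \<le> emeasure lborel {x \<in> ball p r. 0 < h x \<and> h x < ?s}"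
      using gl(1) by (intro emeasure_mono) auto
    also have "\<dots> \<le> ennreal (2 * V * ?s)" by (rule gl(2))
    finally show ?thesis by (simp add: mult.assoc)
  qed
  moreover have "0 \<le> 2 * V * (1 + 2 * L)" using L by (simp add: V_def)
  ultimately show ?thesis using r by (intro exI[of _ "r / 2"] conjI exI[of _ "2 * V
      * (1 + 2 * L)"]) auto
qed

text \<open>For small t, compactness of the frontier reduces the estimate to finitely many local
  layers; for large t the total measure of \<Omega> is enough.\<close>

lemma lipschitz_boundary_layer:
  fixes \<Omega> :: "'a::euclidean_space set"
  assumes \<Omega>: "open \<Omega>" "bounded \<Omega>" "lipschitz_boundary \<Omega>"
  obtains C where "0 \<le> C" "\<And>t. 0 < t \<Longrightarrow> emeasure lborel {x\<in>\<Omega>. infdist x (- \<Omega>) \<le> t} \<le> ennreal (C * t)"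
proof -
  define Q where "Q p \<delta> t = {x\<in>\<Omega>. \<exists>q\<in>frontier \<Omega> \<inter> ball p \<delta>. dist q x < t}" for p \<delta> t
  have "\<forall>p\<in>frontier \<Omega>. \<exists>\<delta> C. 0 < \<delta> \<and> 0 \<le> C \<and> (\<forall>t. 0 < t \<longrightarrow> t \<le> \<delta> \<longrightarrow> emeasure lborel (Q p \<delta> t)
      \<le> ennreal (C * t))"
    using lipschitz_boundary_local_layer[OF \<Omega>(1,3)] unfolding Q_def by blast
  then obtain \<delta> C where dC: "\<And>p. p \<in> frontier \<Omega> \<Longrightarrow> 0 < \<delta> p" "\<And>p. p \<in> frontier \<Omega> \<Longrightarrow> 0 \<le> C p"
    "\<And>p t. p \<in> frontier \<Omega> \<Longrightarrow> 0 < t \<Longrightarrow> t \<le> \<delta> p \<Longrightarrow> emeasure lborel (Q p (\<delta> p) t) \<le> ennreal (C p * t)"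
    by metis
  have Qo: "open (Q p d t)" for p d t
  proof -
    have "Q p d t = \<Omega> \<inter> (\<Union>q\<in>frontier \<Omega> \<inter> ball p d. ball q t)" by (auto simp: Q_def)
    then show ?thesis using \<Omega>(1) by auto
  qed
  have "frontier \<Omega> \<subseteq> (\<Union>p\<in>frontier \<Omega>. ball p (\<delta> p))" using dC(1) by fastforce
  then obtain P where P: "P \<subseteq> frontier \<Omega>" "finite P" "frontier \<Omega> \<subseteq> (\<Union>p\<in>P. ball p (\<delta> p))"
    using compactE_image[OF compact_frontier_bounded[OF \<Omega>(2)], of "frontier \<Omega>" "\<lambda>p. ball p (\<delta> p)"]
    by (metis open_ball)
  define t0 where "t0 = Min (insert 1 (\<delta> ` P)) / 2"
  have t0: "0 < t0" "\<And>p. p \<in> P \<Longrightarrow> 2 * t0 \<le> \<delta> p"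
    using P dC(1) by (auto simp: t0_def)
  \<comment> \<open>The first summand serves t \<le> t0, with 2 t in place of t; the second serves t
    > t0.\<close>
  define K where "K = (\<Sum>p\<in>P. C p) * 2 + measure lborel \<Omega> / t0"
  have S0: "0 \<le> (\<Sum>p\<in>P. C p)" using P dC(2) by (intro sum_nonneg) auto
  have K0: "0 \<le> K" using S0 t0 by (simp add: K_def)
  have of: "emeasure lborel \<Omega> = ennreal (measure lborel \<Omega>)"
    using emeasure_bounded_finite[OF \<Omega>(2)] by (intro emeasure_eq_ennreal_measure) auto
  show ?thesis
  proof (rule that[OF K0])
    fix t :: real assume t: "0 < t"
    let ?D = "{x\<in>\<Omega>. infdist x (- \<Omega>) \<le> t}"
    show "emeasure lborel ?D \<le> ennreal (K * t)"
    proof (cases "t \<le> t0")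
      case True
      have "?D \<subseteq> (\<Union>p\<in>P. Q p (\<delta> p) (2 * t))"
      proof
        fix x assume x: "x \<in> ?D"
        have "- \<Omega> \<noteq> {}" using \<Omega>(2) not_bounded_UNIV[where 'a='a]
            by (metis Compl_empty_eq double_complement)
        \<comment> \<open>Doubling the width gives a strict inequality and thus an actual point of
          the complement; the segment from x to it has to meet the frontier.\<close>
        moreover have "infdist x (- \<Omega>) < 2 * t" using x t by auto
        ultimately obtain y where y: "y \<notin> \<Omega>" "dist x y < 2 * t"
          unfolding infdist_def by (auto simp: cInf_less_iff)
        have "closed_segment x y \<inter> frontier \<Omega> \<noteq> {}"
          using x y by (intro connected_Int_frontier) auto
        then obtain q where q: "q \<in> closed_segment x y" "q \<in> frontier \<Omega>" by auto
        have "dist q x < 2 * t"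
          using segment_bound[OF q(1)] y by (simp add: dist_norm norm_minus_commute)
        moreover obtain p where p: "p \<in> P" "q \<in> ball p (\<delta> p)" using P(3) q(2) by auto
        ultimately have "x \<in> Q p (\<delta> p) (2 * t)" using x q(2) unfolding Q_def by blast
        then show "x \<in> (\<Union>p\<in>P. Q p (\<delta> p) (2 * t))" using p(1) by blast
      qed
      then have "emeasure lborel ?D \<le> emeasure lborel (\<Union>p\<in>P. Q p (\<delta> p) (2 * t))"
        using Qo P(2) by (intro emeasure_mono) auto
      also have "\<dots> \<le> (\<Sum>p\<in>P. emeasure lborel (Q p (\<delta> p) (2 * t)))"
        using Qo P(2) by (intro emeasure_subadditive_finite) auto
      also have "\<dots> \<le> (\<Sum>p\<in>P. ennreal (C p * (2 * t)))"
      proof (rule sum_mono)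
        fix p assume p: "p \<in> P"
        then show "emeasure lborel (Q p (\<delta> p) (2 * t)) \<le> ennreal (C p * (2 * t))"
          using P(1) t True t0(2)[OF p] by (intro dC(3)) auto
      qed
      also have "\<dots> = ennreal (\<Sum>p\<in>P. C p * (2 * t))"
        using P(1) dC(2) t by (intro sum_ennreal) auto
      also have "\<dots> \<le> ennreal (K * t)"
      proof (rule ennreal_leI)
        have "(\<Sum>p\<in>P. C p * (2 * t)) = (\<Sum>p\<in>P. C p) * 2 * t"
            by (simp add: sum_distrib_right mult.assoc)
        also have "\<dots> \<le> K * t" using t t0 by (intro mult_right_mono) (auto simp: K_def)
        finally show "(\<Sum>p\<in>P. C p * (2 * t)) \<le> K * t" .
      qed
      finally show ?thesis .
    next
      case False
      have "emeasure lborel ?D \<le> emeasure lborel \<Omega>" using \<Omega>(1) by (intro emeasure_mono) auto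
      also have "\<dots> = ennreal (measure lborel \<Omega>)" by (rule of)
      also have "\<dots> \<le> ennreal (K * t)"
      proof (rule ennreal_leI)
        have "measure lborel \<Omega> * t0 \<le> measure lborel \<Omega> * t" using False
            by (intro mult_left_mono) auto
        then have "measure lborel \<Omega> \<le> measure lborel \<Omega> / t0 * t" using t0 by (simp add: field_simps)
        also have "\<dots> \<le> K * t" using t S0 by (intro mult_right_mono) (auto simp: K_def)
        finally show "measure lborel \<Omega> \<le> K * t" .
      qed
      finally show ?thesis .
    qed
  qed
qed

lemma infdist_compl_pos:
  fixes \<Omega> :: "'a::euclidean_space set"
  assumes "open \<Omega>" "bounded \<Omega>" "x \<in> \<Omega>"
  shows "0 < infdist x (- \<Omega>)"
proof -
  have "- \<Omega> \<noteq> {}" using assms(2) not_bounded_UNIV[where 'a='a]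
      by (metis Compl_empty_eq double_complement)
  then have "infdist x (- \<Omega>) \<noteq> 0"
    using assms in_closed_iff_infdist_zero[of "- \<Omega>" x] by auto
  then show ?thesis using infdist_nonneg[of x "- \<Omega>"] by linarith
qed

text \<open>The sublevel sets of the distance have measure O(t), which beats the exponent 1/2.
  Points farther than 1 from the complement contribute at most the measure of \<Omega>.\<close>

lemma boundary_distance_power_integrable:
  fixes \<Omega> :: "'a::euclidean_space set"
  assumes \<Omega>: "open \<Omega>" "bounded \<Omega>" "lipschitz_boundary \<Omega>"
  shows "(\<integral>\<^sup>+x. ennreal (1 / sqrt (infdist x (- \<Omega>))) * indicator \<Omega> x \<partial>lborel) < \<infinity>"
proof -
  have [measurable]: "\<Omega> \<in> sets borel" using \<Omega> by simp
  have dm [measurable]: "(\<lambda>x. infdist x (- \<Omega>)) \<in> borel_measurable borel"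
    by (intro borel_measurable_continuous_onI continuous_intros)
  define f where "f x = infdist x (- \<Omega>) * indicator \<Omega> x" for x
  have [measurable]: "f \<in> borel_measurable borel" unfolding f_def by measurable
  obtain C where C: "0 \<le> C" "\<And>t. 0 < t \<Longrightarrow> emeasure lborel {x\<in>\<Omega>. infdist x (- \<Omega>) \<le> t}
      \<le> ennreal (C * t)"
    by (rule lipschitz_boundary_layer[OF \<Omega> that])
  have "(\<integral>\<^sup>+x. ennreal (f x powr (-(1/2))) * indicator {x. 0 < f x \<and> f x \<le> 1} x \<partial>lborel) < \<infinity>"
  proof (rule nn_integral_negative_power_finite[where p=1 and C=C])
    fix t :: real assume t: "0 < t" "t \<le> 1"
    have "emeasure lborel {x \<in> space lborel. 0 < f x \<and> f x \<le> t}
        \<le> emeasure lborel {x\<in>\<Omega>. infdist x (- \<Omega>) \<le> t}"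
      by (rule emeasure_mono) (auto simp: f_def indicator_def split: if_splits)
    also have "\<dots> \<le> ennreal (C * t powr 1)" using C(2)[OF t(1)] t by simp
    finally show "emeasure lborel {x \<in> space lborel. 0 < f x \<and> f x \<le> t} \<le> ennreal (C * t powr 1)" .
  qed (use C in auto)
  moreover have "emeasure lborel \<Omega> < \<infinity>" by (rule emeasure_bounded_finite[OF \<Omega>(2)])
  ultimately have "(\<integral>\<^sup>+x. ennreal (f x powr (-(1/2))) * indicator {x. 0 < f x \<and> f x \<le> 1} x \<partial>lborel)
      + (\<integral>\<^sup>+x. indicator \<Omega> x \<partial>lborel) < \<infinity>" by simp
  moreover have "(\<integral>\<^sup>+x. ennreal (1 / sqrt (infdist x (- \<Omega>))) * indicator \<Omega> x \<partial>lborel)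
    \<le> (\<integral>\<^sup>+x. ennreal (f x powr (-(1/2))) * indicator {x. 0 < f x \<and> f x \<le> 1} x
        + indicator \<Omega> x \<partial>lborel)"
  proof (rule nn_integral_mono)
    fix x
    show "ennreal (1 / sqrt (infdist x (- \<Omega>))) * indicator \<Omega> x
      \<le> ennreal (f x powr (-(1/2))) * indicator {x. 0 < f x \<and> f x \<le> 1} x + indicator \<Omega> x"
    proof (cases "x \<in> \<Omega>")
      case True
      have p: "0 < infdist x (- \<Omega>)" by (rule infdist_compl_pos[OF \<Omega>(1,2) True])
      show ?thesis
      proof (cases "infdist x (- \<Omega>) \<le> 1")
        case le: True
        have "f x powr (-(1/2)) = 1 / sqrt (infdist x (- \<Omega>))"
          using p True by (simp add: f_def powr_minus powr_half_sqrt inverse_eq_divide)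
        then show ?thesis using p le True by (simp add: f_def)
      next
        case False
        then have "1 / sqrt (infdist x (- \<Omega>)) \<le> 1" by simp
        then show ?thesis using True by (auto simp: ennreal_le_1 intro: add_increasing)
      qed
    qed simp
  qed
  ultimately show ?thesis by (subst (asm) nn_integral_add) (auto intro: le_less_trans)
qed

text \<open>After symmetrisation, and up to a constant, a majorant for the squared increments of all
  cut-offs used below. It splits into a factor in x - y, absorbed by the kernel, and a factor in x,
  absorbed by the thinness of the boundary layer.\<close>

definition boundary_weight :: "'a::euclidean_space set \<Rightarrow> 'a \<times> 'a \<Rightarrow> real" where
  "boundary_weight \<Omega> p = indicator \<Omega> (fst p) * sqrt (norm (fst p - snd p) / infdist (fst p) (- \<Omega>))"

lemma boundary_weight_measurable:
  assumes "open \<Omega>" shows "boundary_weight \<Omega> \<in> borel_measurable borel"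
proof -
  have [measurable]: "\<Omega> \<in> sets borel" using assms by simp
  have dm [measurable]: "(\<lambda>x. infdist x (- \<Omega>)) \<in> borel_measurable borel"
    by (intro borel_measurable_continuous_onI continuous_intros)
  have [measurable]: "(\<lambda>p :: 'a \<times> 'a. infdist (fst p) (- \<Omega>)) \<in> borel_measurable borel"
    using measurable_compose[OF measurable_fst_borel dm] .
  show ?thesis unfolding boundary_weight_def by measurable
qed

lemma boundary_weight_near_integrable:
  fixes \<Omega> :: "'a::euclidean_space set"
  assumes \<Omega>: "open \<Omega>" "bounded \<Omega>" "lipschitz_boundary \<Omega>"
  shows "integrable near_measure (\<lambda>p. boundary_weight \<Omega> p + boundary_weight \<Omega> (snd p, fst p))"
proof -
  note [measurable] = boundary_weight_measurable[OF \<Omega>(1)]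
  have [measurable]: "\<Omega> \<in> sets borel" using \<Omega> by simp
  have dm [measurable]: "(\<lambda>x. infdist x (- \<Omega>)) \<in> borel_measurable borel"
    by (intro borel_measurable_continuous_onI continuous_intros)
  have nn: "0 \<le> boundary_weight \<Omega> p" for p by (simp add: boundary_weight_def infdist_nonneg)
  have "(\<integral>\<^sup>+p. ennreal (boundary_weight \<Omega> p) \<partial>near_measure)
    = (\<integral>\<^sup>+z. ennreal (near_kernel z) * (\<integral>\<^sup>+x. ennreal (sqrt (norm z)) *
        (ennreal (1 / sqrt (infdist x (- \<Omega>))) * indicator \<Omega> x) \<partial>lborel) \<partial>(lborel :: 'a measure))"
    by (subst nn_integral_near_measure_iterated, simp)
       (intro nn_integral_cong arg_cong2[of _ _ _ _ "(*)"] refl,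
        auto simp: boundary_weight_def indicator_def ennreal_mult'[symmetric] real_sqrt_divide)
  also have "\<dots> = (\<integral>\<^sup>+z. ennreal (sqrt (norm z) * near_kernel z) * (\<integral>\<^sup>+x.
        ennreal (1 / sqrt (infdist x (- \<Omega>))) * indicator \<Omega> x \<partial>lborel) \<partial>(lborel :: 'a measure))"
    by (intro nn_integral_cong, subst nn_integral_cmult) (simp_all add: ennreal_mult mult_ac)
  also have "\<dots> = (\<integral>\<^sup>+z. ennreal (sqrt (norm z) * near_kernel z) \<partial>(lborel :: 'a measure)) * (\<integral>\<^sup>+x.
        ennreal (1 / sqrt (infdist x (- \<Omega>))) * indicator \<Omega> x \<partial>lborel)"
    by (rule nn_integral_multc) simp
  also have "\<dots> < \<infinity>"
    using near_kernel_sqrt_finite[where 'a='a] boundary_distance_power_integrable[OF \<Omega>]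
    by (auto simp: ennreal_mult_less_top)
  finally have fin: "(\<integral>\<^sup>+p. ennreal (boundary_weight \<Omega> p) \<partial>near_measure) < \<infinity>" .
  have i1: "integrable near_measure (boundary_weight \<Omega>)"
    using fin nn by (intro integrableI_nonneg) auto
  have "(\<integral>\<^sup>+p. ennreal (boundary_weight \<Omega> (snd p, fst p)) \<partial>near_measure) < \<infinity>"
    using fin nn_integral_near_measure_swap[of "\<lambda>p. ennreal (boundary_weight \<Omega> p)"] by simp
  then have "integrable near_measure (\<lambda>p. boundary_weight \<Omega> (snd p, fst p))"
    using nn by (intro integrableI_nonneg) auto
  then show ?thesis using i1 by simp
qed

section \<open>Pairing supersolutions with compactly supported functions\<close>

definition borel_V :: "'a::euclidean_space set \<Rightarrow> ('a \<Rightarrow> real) \<Rightarrow> bool" where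
  "borel_V \<Omega> u \<longleftrightarrow> u \<in> borel_measurable borel \<and>
     integrable lborel (\<lambda>x. u x / (1 + norm x) ^ DIM('a)) \<and>
     sq_integrable near_measure (\<lambda>p. indicator (\<Omega> \<times> \<Omega>) p * increment u p) \<and>
     sq_integrable lborel (\<lambda>x. indicator \<Omega> x * u x)"

text \<open>On the ball of radius R the weight in the tail condition is bounded below by (1 +
  R)^(-N).\<close>

lemma borel_V_locally_integrable:
  fixes u :: "'a::euclidean_space \<Rightarrow> real"
  assumes u: "borel_V \<Omega> u" and R: "0 \<le> R"
  shows "integrable lborel (\<lambda>x. indicator (cball 0 R) x * u x)"
proof (rule Bochner_Integration.integrable_bound)
  have [measurable]: "u \<in> borel_measurable borel" using u by (simp add: borel_V_def)
  have [measurable]: "cball (0::'a) R \<in> sets borel" by simp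
  show "integrable lborel (\<lambda>x. (1 + R) ^ DIM('a) * (u x / (1 + norm x) ^ DIM('a)))"
    using u by (intro integrable_mult_right) (simp add: borel_V_def)
  show "(\<lambda>x. indicator (cball 0 R) x * u x) \<in> borel_measurable lborel" by measurable
  show "AE x in lborel. norm (indicator (cball 0 R) x * u x)
      \<le> norm ((1 + R) ^ DIM('a) * (u x / (1 + norm x) ^ DIM('a)))"
  proof (rule AE_I2)
    fix x :: 'a
    show "norm (indicator (cball 0 R) x * u x)
        \<le> norm ((1 + R) ^ DIM('a) * (u x / (1 + norm x) ^ DIM('a)))"
    proof (cases "norm x \<le> R")
      case True
      have p: "0 < (1 + norm x) ^ DIM('a)" by (intro zero_less_power) (simp add: add_pos_nonneg)
      have "(1 + norm x) ^ DIM('a) \<le> (1 + R) ^ DIM('a)" using True by (intro power_mono) auto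
      then have "\<bar>u x\<bar> * (1 + norm x) ^ DIM('a) \<le> \<bar>u x\<bar> * (1 + R) ^ DIM('a)"
          by (intro mult_left_mono) auto
      then show ?thesis using True R p by (simp add: abs_mult field_simps)
    qed simp
  qed
qed

lemma nn_integral_product:
  fixes a b :: "'a::euclidean_space \<Rightarrow> real"
  assumes a: "integrable lborel a" and b: "integrable lborel b"
  shows "(\<integral>\<^sup>+p. ennreal (\<bar>a (fst p)\<bar> * \<bar>b (snd p)\<bar>) \<partial>lborel)
    = ennreal ((\<integral>x. \<bar>a x\<bar> \<partial>lborel) * (\<integral>x. \<bar>b x\<bar> \<partial>lborel))"
proof -
  have [measurable]: "a \<in> borel_measurable borel" "b \<in> borel_measurable borel"
    using borel_measurable_integrable[OF a] borel_measurable_integrable[OF b] by auto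
  have "(\<integral>\<^sup>+p. ennreal (\<bar>a (fst p)\<bar> * \<bar>b (snd p)\<bar>) \<partial>lborel)
    = (\<integral>\<^sup>+x. ennreal \<bar>a x\<bar> * (\<integral>\<^sup>+y. ennreal \<bar>b y\<bar> \<partial>lborel) \<partial>lborel)"
    by (subst nn_integral_lborel_pair) (simp_all add: nn_integral_cmult ennreal_mult)
  also have "\<dots> = (\<integral>\<^sup>+x. ennreal \<bar>a x\<bar> \<partial>lborel) * (\<integral>\<^sup>+y. ennreal \<bar>b y\<bar> \<partial>lborel)"
    by (rule nn_integral_multc) simp
  also have "\<dots> = ennreal ((\<integral>x. \<bar>a x\<bar> \<partial>lborel) * (\<integral>x. \<bar>b x\<bar> \<partial>lborel))"
    using a b by (simp add: nn_integral_eq_integral ennreal_mult)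
  finally show ?thesis .
qed

lemma integrable_of_nn_bound:
  fixes f :: "'b \<Rightarrow> real"
  assumes "f \<in> borel_measurable M" "(\<integral>\<^sup>+x. ennreal \<bar>f x\<bar> \<partial>M) \<le> ennreal C" "0 \<le> C"
  shows "integrable M f" "\<bar>\<integral>x. f x \<partial>M\<bar> \<le> C"
proof -
  show i: "integrable M f"
    using assms by (auto simp: integrable_iff_bounded intro: le_less_trans)
  have "(\<integral>x. \<bar>f x\<bar> \<partial>M) \<le> C"
    using assms i by (subst (asm) nn_integral_eq_integral) (auto simp: ennreal_le_iff)
  then show "\<bar>\<integral>x. f x \<partial>M\<bar> \<le> C" using integral_abs_bound[of M f] by linarith
qed

text \<open>For y in the support of h and |x - y| \<ge> 1 one has 1 + |x| \<le> (2 + R) |x - y|, so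
  the far kernel decays at least as fast as the weight in the tail condition on u.\<close>

lemma far_pairing_bound:
  fixes u h :: "'a::euclidean_space \<Rightarrow> real"
  assumes [measurable]: "u \<in> borel_measurable borel"
    and u: "integrable lborel (\<lambda>x. u x / (1 + norm x) ^ DIM('a))" and h: "integrable lborel h"
    and h0: "\<forall>x. R < norm x \<longrightarrow> h x = 0" and R: "0 \<le> R"
  shows "integrable far_measure (\<lambda>p. u (fst p) * h (snd p))"
    and "\<bar>\<integral>p. u (fst p) * h (snd p) \<partial>far_measure\<bar>
      \<le> (\<integral>x. \<bar>(2 + R) ^ DIM('a) * (u x / (1 + norm x) ^ DIM('a))\<bar> \<partial>lborel) * (\<integral>x. \<bar>h x\<bar> \<partial>lborel)"
proof -
  have [measurable]: "h \<in> borel_measurable borel" using borel_measurable_integrable[OF h] by auto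
  let ?v = "\<lambda>x. (2 + R) ^ DIM('a) * (u x / (1 + norm x) ^ DIM('a))"
  have v: "integrable lborel ?v" using u by (rule integrable_mult_right)
  have pt: "far_kernel (x - y) * \<bar>u x * h y\<bar> \<le> \<bar>?v x\<bar> * \<bar>h y\<bar>" for x y
  proof (cases "norm y \<le> R \<and> 1 \<le> norm (x - y)")
    case True
    have "norm x \<le> norm y + norm (x - y)" using norm_triangle_ineq[of y "x - y"] by simp
    then have "1 + norm x \<le> (1 + R) * 1 + norm (x - y)" using True by simp
    also have "\<dots> \<le> (1 + R) * norm (x - y) + norm (x - y)"
      using True R by (intro add_mono mult_left_mono) auto
    finally have "1 + norm x \<le> (2 + R) * norm (x - y)" by (simp add: algebra_simps)
    then have "(1 + norm x) ^ DIM('a) \<le> ((2 + R) * norm (x - y)) ^ DIM('a)"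
      by (intro power_mono) auto
    then have le: "(1 + norm x) ^ DIM('a) \<le> (2 + R) ^ DIM('a) * norm (x - y) ^ DIM('a)"
      by (simp add: power_mult_distrib)
    have p: "0 < (1 + norm x) ^ DIM('a)" by (intro zero_less_power) (simp add: add_pos_nonneg)
    have q: "0 < norm (x - y) ^ DIM('a)" using True by (intro zero_less_power) linarith
    have "1 / norm (x - y) ^ DIM('a) \<le> (2 + R) ^ DIM('a) / (1 + norm x) ^ DIM('a)"
      using le p q by (simp add: divide_simps mult.commute)
    then have "far_kernel (x - y) * \<bar>u x * h y\<bar> \<le> ((2 + R) ^ DIM('a) / (1 + norm x) ^ DIM('a))
        * \<bar>u x * h y\<bar>"
      using True by (intro mult_right_mono) (auto simp: far_kernel_def)
    also have "\<dots> = \<bar>?v x\<bar> * \<bar>h y\<bar>" using R by (simp add: abs_mult)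
    finally show ?thesis .
  next
    case False
    then have "far_kernel (x - y) * \<bar>u x * h y\<bar> = 0"
      using h0[rule_format, of y] by (auto simp: far_kernel_def indicator_def)
    moreover have "0 \<le> \<bar>?v x\<bar> * \<bar>h y\<bar>" by (intro mult_nonneg_nonneg abs_ge_zero)
    ultimately show ?thesis by linarith
  qed
  have "(\<integral>\<^sup>+p. ennreal \<bar>u (fst p) * h (snd p)\<bar> \<partial>far_measure)
    \<le> (\<integral>\<^sup>+p. ennreal (\<bar>?v (fst p)\<bar> * \<bar>h (snd p)\<bar>) \<partial>lborel)"
  proof -
    have m: "(\<lambda>p. ennreal \<bar>u (fst p) * h (snd p)\<bar>) \<in> borel_measurable borel" by measurable
    show ?thesis
      unfolding nn_integral_far_measure[OF m]
      by (intro nn_integral_mono, simp only: ennreal_mult'[OF far_kernel_nonneg, symmetric])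
         (rule ennreal_leI[OF pt])
  qed
  also have "\<dots> = ennreal ((\<integral>x. \<bar>?v x\<bar> \<partial>lborel) * (\<integral>x. \<bar>h x\<bar> \<partial>lborel))"
    by (rule nn_integral_product[OF v h])
  finally have b: "(\<integral>\<^sup>+p. ennreal \<bar>u (fst p) * h (snd p)\<bar> \<partial>far_measure)
    \<le> ennreal ((\<integral>x. \<bar>?v x\<bar> \<partial>lborel) * (\<integral>x. \<bar>h x\<bar> \<partial>lborel))" .
  have m: "(\<lambda>p. u (fst p) * h (snd p)) \<in> borel_measurable far_measure" by measurable
  have n: "0 \<le> (\<integral>x. \<bar>?v x\<bar> \<partial>lborel) * (\<integral>x. \<bar>h x\<bar> \<partial>lborel)"
    by (intro mult_nonneg_nonneg Bochner_Integration.integral_nonneg) auto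
  show "integrable far_measure (\<lambda>p. u (fst p) * h (snd p))"
    by (rule integrable_of_nn_bound(1)[OF m b n])
  show "\<bar>\<integral>p. u (fst p) * h (snd p) \<partial>far_measure\<bar> \<le> (\<integral>x. \<bar>?v x\<bar> \<partial>lborel) * (\<integral>x. \<bar>h x\<bar> \<partial>lborel)"
    by (rule integrable_of_nn_bound(2)[OF m b n])
qed

text \<open>At distance at least \<delta> the kernel is bounded. One point lies in the ball outside
  which h vanishes and the other within distance 1 of it, so expanding the product leaves four
  integrals that factorise.\<close>

lemma off_diagonal_pairing_bound:
  fixes u h :: "'a::euclidean_space \<Rightarrow> real"
  assumes [measurable]: "u \<in> borel_measurable borel"
    and R: "0 \<le> R" and \<delta>: "0 < \<delta>" and uB: "integrable lborel (\<lambda>x. indicator (cball 0 (R + 1)) x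
        * u x)"
    and h: "integrable lborel h" and uh: "integrable lborel (\<lambda>x. u x * h x)"
    and h0: "\<forall>x. R < norm x \<longrightarrow> h x = 0"
  shows "(\<integral>\<^sup>+p. ennreal \<bar>indicator {p. \<delta> \<le> norm (fst p - snd p)} p
      * (increment u p * increment h p)\<bar> \<partial>near_measure)
    \<le> ennreal ((1 / \<delta> ^ DIM('a)) * (2 * (measure lborel (cball (0::'a) (R + 1))
        * (\<integral>x. \<bar>u x * h x\<bar> \<partial>lborel)
        + (\<integral>x. \<bar>indicator (cball 0 (R + 1)) x * u x\<bar> \<partial>lborel) * (\<integral>x. \<bar>h x\<bar> \<partial>lborel))))"
proof -
  have [measurable]: "h \<in> borel_measurable borel" using borel_measurable_integrable[OF h] by auto
  let ?B = "cball (0::'a) (R + 1)"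
  have [measurable]: "?B \<in> sets borel" by simp
  define b where "b = (indicator ?B :: 'a \<Rightarrow> real)"
  define v where "v x = b x * u x" for x
  define k where "k = 1 / \<delta> ^ DIM('a)"
  have k: "0 \<le> k" using \<delta> by (simp add: k_def)
  have [measurable]: "b \<in> borel_measurable borel" "v \<in> borel_measurable borel"
    unfolding v_def b_def by measurable
  have bi: "integrable lborel b"
    unfolding b_def by (intro integrable_real_indicator) (auto simp: emeasure_cball_finite)
  have "v = (\<lambda>x. indicator ?B x * u x)" by (auto simp: v_def b_def)
  then have vi: "integrable lborel v" using uB by simp
  have b0: "\<bar>b x\<bar> = b x" for x by (simp add: b_def)
  let ?uh = "\<lambda>x. u x * h x"
  \<comment> \<open>The expansion of (|u x| + |u y|) (|h x| + |h y|), given that b = 1 and v = u at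
    both points of a contributing pair.\<close>
  define F where "F p = \<bar>?uh (fst p)\<bar> * \<bar>b (snd p)\<bar> + \<bar>v (fst p)\<bar> * \<bar>h (snd p)\<bar>
      + (\<bar>h (fst p)\<bar> * \<bar>v (snd p)\<bar> + \<bar>b (fst p)\<bar> * \<bar>?uh (snd p)\<bar>)" for p
  have F0: "0 \<le> F p" for p by (simp add: F_def)
  have pt: "near_kernel (x - y) * \<bar>indicator {p. \<delta> \<le> norm (fst p - snd p)} (x, y)
      * (increment u (x, y) * increment h (x, y))\<bar>
      \<le> k * F (x, y)" for x y
  proof (cases "\<delta> \<le> norm (x - y) \<and> norm (x - y) \<le> 1 \<and> (norm x \<le> R \<or> norm y \<le> R)")
    case True
    have xB: "b x = 1" "b y = 1"
      using True norm_triangle_ineq2[of x y] norm_triangle_ineq3[of x y] by (auto simp: b_def)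
    have "near_kernel (x - y) \<le> k"
      using True \<delta> by (auto simp: near_kernel_def k_def intro!: divide_left_mono power_mono
          mult_pos_pos zero_less_power)
    moreover have "\<bar>(u x - u y) * (h x - h y)\<bar> \<le> F (x, y)"
    proof -
      have "\<bar>(u x - u y) * (h x - h y)\<bar> \<le> (\<bar>u x\<bar> + \<bar>u y\<bar>) * (\<bar>h x\<bar> + \<bar>h y\<bar>)"
        unfolding abs_mult by (intro mult_mono) auto
      also have "\<dots> = F (x, y)" by (simp add: F_def v_def xB abs_mult algebra_simps)
      finally show ?thesis .
    qed
    ultimately have "near_kernel (x - y) * \<bar>(u x - u y) * (h x - h y)\<bar> \<le> k * F (x, y)"
      using k by (intro mult_mono) auto
    then show ?thesis using True by simp
  next
    case False
    then have "near_kernel (x - y) * \<bar>indicator {p. \<delta> \<le> norm (fst p - snd p)} (x, y)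
        * (increment u (x, y) * increment h (x, y))\<bar> = 0"
      using h0[rule_format, of x] h0[rule_format, of y]
          by (auto simp: near_kernel_def indicator_def)
    moreover have "0 \<le> k * F (x, y)" by (intro mult_nonneg_nonneg k F0)
    ultimately show ?thesis by linarith
  qed
  have [measurable]: "{p :: 'a \<times> 'a. \<delta> \<le> norm (fst p - snd p)} \<in> sets borel" by measurable
  have "(\<integral>\<^sup>+p. ennreal \<bar>indicator {p. \<delta> \<le> norm (fst p - snd p)} p
      * (increment u p * increment h p)\<bar> \<partial>near_measure)
    \<le> (\<integral>\<^sup>+p. ennreal k * ennreal (F p) \<partial>lborel)"
  proof (subst nn_integral_near_measure, measurable, rule nn_integral_mono)
    fix p :: "'a \<times> 'a"
    show "ennreal (near_kernel (fst p - snd p)) * ennreal \<bar>indicator {p. \<delta> \<le> norm (fst p - snd p)} p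
        * (increment u p * increment h p)\<bar>
      \<le> ennreal k * ennreal (F p)"
      using pt[of "fst p" "snd p"] k F0[of p]
          by (simp add: ennreal_mult'[symmetric] ennreal_leI del: increment_Pair)
  qed
  also have "\<dots> = ennreal k * (\<integral>\<^sup>+p. ennreal (F p) \<partial>lborel)"
    unfolding F_def by (rule nn_integral_cmult) measurable
  also have "(\<integral>\<^sup>+p. ennreal (F p) \<partial>lborel) = (\<integral>\<^sup>+p. ennreal (\<bar>?uh (fst p)\<bar> * \<bar>b (snd p)\<bar>) \<partial>lborel)
      + (\<integral>\<^sup>+p. ennreal (\<bar>v (fst p)\<bar> * \<bar>h (snd p)\<bar>) \<partial>lborel)
      + ((\<integral>\<^sup>+p. ennreal (\<bar>h (fst p)\<bar> * \<bar>v (snd p)\<bar>) \<partial>lborel)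
          + (\<integral>\<^sup>+p. ennreal (\<bar>b (fst p)\<bar> * \<bar>?uh (snd p)\<bar>) \<partial>lborel))"
    unfolding F_def by (simp add: ennreal_plus nn_integral_add)
  also have "\<dots> = ennreal (2 * (measure lborel ?B * (\<integral>x. \<bar>?uh x\<bar> \<partial>lborel) + (\<integral>x. \<bar>v x\<bar> \<partial>lborel)
      * (\<integral>x. \<bar>h x\<bar> \<partial>lborel)))"
  proof -
    have bI: "(\<integral>x. \<bar>b x\<bar> \<partial>lborel) = measure lborel ?B" unfolding b0 by (simp add: b_def)
    show ?thesis
      unfolding nn_integral_product[OF uh bi] nn_integral_product[OF vi h]
          nn_integral_product[OF h vi]
        nn_integral_product[OF bi uh] bI
      by (simp add: ennreal_plus[symmetric] del: ennreal_plus)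
  qed
  also have "ennreal k * ennreal (2 * (measure lborel ?B * (\<integral>x. \<bar>?uh x\<bar> \<partial>lborel)
      + (\<integral>x. \<bar>v x\<bar> \<partial>lborel) * (\<integral>x. \<bar>h x\<bar> \<partial>lborel)))
    = ennreal (k * (2 * (measure lborel ?B * (\<integral>x. \<bar>?uh x\<bar> \<partial>lborel) + (\<integral>x. \<bar>v x\<bar> \<partial>lborel)
        * (\<integral>x. \<bar>h x\<bar> \<partial>lborel))))"
    by (rule ennreal_mult'[OF k, symmetric])
  finally show ?thesis unfolding v_def b_def k_def .
qed

text \<open>Wide enough to contain the truncated negative parts after cut-off as well as their
  differences with mollifications, the latter for a slightly larger K.\<close>

definition paired_class :: "'a::euclidean_space set \<Rightarrow> ('a \<Rightarrow> real) \<Rightarrow> bool" where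
  "paired_class K h \<longleftrightarrow> sq_integrable lborel h \<and> sq_integrable near_measure (increment h)
      \<and> (\<forall>x. x \<notin> K \<longrightarrow> h x = 0)"

text \<open>Pairs are split at distance \<delta>. Closer pairs with a nonzero increment of h lie in
  \<Omega> \<times> \<Omega>, where u has finite energy; everything else is controlled by the L^2
  norm of h, with M depending on \<delta>. Since the factor in front of the energy of h vanishes
  with \<delta>, bounded energy and L^2 convergence suffice to pass to the limit in the
  pairing.\<close>

lemma paired_class_form_bound:
  fixes u :: "'a::euclidean_space \<Rightarrow> real"
  assumes u: "borel_V \<Omega> u" and \<Omega>: "open \<Omega>" and K: "compact K" and \<delta>: "0 < \<delta>"
    and K\<delta>: "\<And>x y. x \<in> K \<Longrightarrow> norm (x - y) < \<delta> \<Longrightarrow> y \<in> \<Omega>"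
  shows "\<exists>M. \<forall>h. paired_class K h \<longrightarrow> form_pair u h \<and>
    \<bar>energy_L u h\<bar> \<le> log_lap_c DIM('a) / 2 *
      (sqrt (\<integral>p. (indicator {p. norm (fst p - snd p) < \<delta>} p
          * (indicator (\<Omega> \<times> \<Omega>) p * increment u p))\<^sup>2 \<partial>near_measure)
        * sqrt (\<integral>p. (increment h p)\<^sup>2 \<partial>near_measure))
      + M * sqrt (\<integral>x. (h x)\<^sup>2 \<partial>lborel)"
proof -
  have um [measurable]: "u \<in> borel_measurable borel" using u by (simp add: borel_V_def)
  have [measurable]: "\<Omega> \<in> sets borel" "K \<in> sets borel" using \<Omega> K by (auto intro: borel_compact)
  have [measurable]: "\<Omega> \<times> \<Omega> \<in> sets borel" using \<Omega> by (intro borel_open open_Times)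
  have KO: "K \<subseteq> \<Omega>" using K\<delta>[of x x for x] \<delta> by auto
  obtain R0 where R0: "\<And>x. x \<in> K \<Longrightarrow> norm x \<le> R0"
    using compact_imp_bounded[OF K] unfolding bounded_iff by blast
  define R where "R = max R0 0"
  have R: "0 \<le> R" "\<And>x. x \<in> K \<Longrightarrow> norm x \<le> R" using R0 by (auto simp: R_def intro: max.coboundedI1)
  define B where "B = cball (0::'a) (R + 1)"
  define c \<rho> where "c = log_lap_c DIM('a)" and "\<rho> = log_lap_rho DIM('a)"
  have c: "0 < c" using log_lap_c_pos by (simp add: c_def)
  define w where "w p = indicator {p. norm (fst p - snd p) < \<delta>} p
      * (indicator (\<Omega> \<times> \<Omega>) p * increment u p)" for p
  have [measurable]: "{p :: 'a \<times> 'a. norm (fst p - snd p) < \<delta>} \<in> sets borel" by measurable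
  have [measurable]: "w \<in> borel_measurable borel" unfolding w_def by measurable
  have wsq: "sq_integrable near_measure w"
    by (rule sq_integrable_bound[of _ "\<lambda>p. indicator (\<Omega> \<times> \<Omega>) p * increment u p"])
       (use u in \<open>auto simp: borel_V_def w_def indicator_def\<close>)
  have osq: "sq_integrable lborel (\<lambda>x. indicator \<Omega> x * u x)" using u by (simp add: borel_V_def)
  have uB: "integrable lborel (\<lambda>x. indicator (cball 0 (R + 1)) x * u x)"
    using R by (intro borel_V_locally_integrable[OF u]) auto
  have ui: "integrable lborel (\<lambda>x. u x / (1 + norm x) ^ DIM('a))" using u by (simp add: borel_V_def)
  have Kf: "K \<in> sets lborel" "emeasure lborel K < \<infinity>"
      using emeasure_bounded_finite[OF compact_imp_bounded[OF K]] by auto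
  define a where "a = sqrt (\<integral>x. (indicator \<Omega> x * u x)\<^sup>2 \<partial>lborel)"
  define A where "A = sqrt (measure lborel K)"
  define U1 where "U1 = (\<integral>x. \<bar>indicator B x * u x\<bar> \<partial>lborel)"
  define U2 where "U2 = (\<integral>x. \<bar>(2 + R) ^ DIM('a) * (u x / (1 + norm x) ^ DIM('a))\<bar> \<partial>lborel)"
  define V where "V = measure lborel B"
  define k where "k = 1 / \<delta> ^ DIM('a)"
  have pos: "0 \<le> a" "0 \<le> A" "0 \<le> U1" "0 \<le> U2" "0 \<le> V" "0 \<le> k"
    using \<delta> by (auto simp: a_def A_def U1_def U2_def V_def k_def)
  \<comment> \<open>The L^2 norm of h bounds its L^1 norm with factor A and the integral of |u h|
    with factor a; M collects these over the parts of the form.\<close>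
  define M where "M = c / 2 * (k * (2 * (V * a + U1 * A))) + c * (U2 * A) + \<bar>\<rho>\<bar> * a"
  show ?thesis
    unfolding w_def[symmetric] c_def[symmetric]
  proof (intro exI[of _ M] allI impI)
    fix h :: "'a \<Rightarrow> real" assume h: "paired_class K h"
    have hsq: "sq_integrable lborel h" and hinc: "sq_integrable near_measure (increment h)"
      and hK: "\<And>x. x \<notin> K \<Longrightarrow> h x = 0" using h by (auto simp: paired_class_def)
    have hm [measurable]: "h \<in> borel_measurable borel" using sq_integrable_measurable[OF hsq]
        by simp
    have hi: "integrable lborel h" using sq_integrable_imp_integrable_on[OF hsq Kf] hK by simp
    have h0: "\<forall>x. R < norm x \<longrightarrow> h x = 0" using hK R(2) by (meson not_less)
    define s where "s = sqrt (\<integral>x. (h x)\<^sup>2 \<partial>lborel)"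
    have s: "0 \<le> s" by (simp add: s_def)
    have uh_eq: "u x * h x = (indicator \<Omega> x * u x) * h x" for x using hK[of x] KO
        by (cases "x \<in> \<Omega>") auto
    have uhi: "integrable lborel (\<lambda>x. u x * h x)" unfolding uh_eq
        by (rule sq_integrable_mult[OF osq hsq])
    have uh1: "(\<integral>x. \<bar>u x * h x\<bar> \<partial>lborel) \<le> a * s"
      unfolding uh_eq abs_mult[of "indicator \<Omega> _ * u _"] a_def s_def
          by (rule Cauchy_Schwarz_integral_abs[OF osq hsq])
    have h1: "(\<integral>x. \<bar>h x\<bar> \<partial>lborel) \<le> A * s"
      unfolding A_def s_def by (rule integral_abs_le_sqrt[OF hsq Kf]) (rule hK)
    note far = far_pairing_bound[OF um ui hi h0 R(1)]
    note off = off_diagonal_pairing_bound[OF um R(1) \<delta> uB hi uhi h0]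
    let ?o = "\<lambda>p. indicator {p. \<delta> \<le> norm (fst p - snd p)} p * (increment u p * increment h p)"
    have [measurable]: "{p :: 'a \<times> 'a. \<delta> \<le> norm (fst p - snd p)} \<in> sets borel" by measurable
    have om: "?o \<in> borel_measurable near_measure" by measurable
    have V0: "0 \<le> 1 / \<delta> ^ DIM('a) * (2 * (measure lborel (cball (0::'a) (R + 1))
        * (\<integral>x. \<bar>u x * h x\<bar> \<partial>lborel)
        + (\<integral>x. \<bar>indicator (cball 0 (R + 1)) x * u x\<bar> \<partial>lborel) * (\<integral>x. \<bar>h x\<bar> \<partial>lborel)))"
      using \<delta> by (intro mult_nonneg_nonneg add_nonneg_nonneg Bochner_Integration.integral_nonneg)
          auto
    note o = integrable_of_nn_bound[OF om off V0]
    have o2: "\<bar>\<integral>p. ?o p \<partial>near_measure\<bar> \<le> k * (2 * (V * (a * s) + U1 * (A * s)))"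
      using o(2) unfolding k_def[symmetric] B_def[symmetric] U1_def[symmetric] V_def[symmetric]
      by (rule order_trans) (intro mult_left_mono add_mono uh1 h1, use pos in auto)
    \<comment> \<open>Within distance \<delta> of a point of K one stays in \<Omega>, so a close
      pair outside \<Omega> \<times> \<Omega> has both points off K.\<close>
    have split: "increment u p * increment h p = w p * increment h p + ?o p" for p
    proof -
      have "increment h p = 0" if "p \<notin> \<Omega> \<times> \<Omega>" "norm (fst p - snd p) < \<delta>"
      proof -
        have "fst p \<notin> K" "snd p \<notin> K"
          using that K\<delta>[of "fst p" "snd p"] K\<delta>[of "snd p" "fst p"] KO
          by (auto simp: mem_Times_iff norm_minus_commute)
        then show ?thesis by (simp add: increment_def hK)
      qed
      then show ?thesis by (auto simp: w_def indicator_def not_less)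
    qed
    have wi: "integrable near_measure (\<lambda>p. w p * increment h p)"
        by (rule sq_integrable_mult[OF wsq hinc])
    have eq: "(\<lambda>p. increment u p * increment h p) = (\<lambda>p. w p * increment h p + ?o p)"
      by (rule ext) (rule split)
    have ni: "integrable near_measure (\<lambda>p. increment u p * increment h p)"
      by (subst eq) (rule Bochner_Integration.integrable_add[OF wi o(1)])
    let ?S = "sqrt (\<integral>p. (w p)\<^sup>2 \<partial>near_measure) * sqrt (\<integral>p. (increment h p)\<^sup>2 \<partial>near_measure)"
    have w2: "\<bar>\<integral>p. w p * increment h p \<partial>near_measure\<bar> \<le> ?S"
      using Cauchy_Schwarz_integral_abs[OF wsq hinc] integral_abs_bound[of near_measure "\<lambda>p. w p
          * increment h p"]
      by (simp add: abs_mult)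
    have n2: "\<bar>\<integral>p. increment u p * increment h p \<partial>near_measure\<bar> \<le> ?S + k
        * (2 * (V * (a * s) + U1 * (A * s)))"
    proof -
      have "(\<integral>p. increment u p * increment h p \<partial>near_measure)
        = (\<integral>p. w p * increment h p \<partial>near_measure) + (\<integral>p. ?o p \<partial>near_measure)"
        by (subst eq) (rule Bochner_Integration.integral_add[OF wi o(1)])
      then show ?thesis using w2 o2 by linarith
    qed
    have f2: "\<bar>\<integral>p. u (fst p) * h (snd p) \<partial>far_measure\<bar> \<le> U2 * (A * s)"
      using far(2) unfolding U2_def[symmetric] using mult_left_mono[OF h1 pos(4)] by linarith
    have r2: "\<bar>\<integral>x. u x * h x \<partial>lborel\<bar> \<le> a * s"
      using uh1 integral_abs_bound[of lborel "\<lambda>x. u x * h x"] by linarith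
    have "form_pair u h" unfolding form_pair_def using ni far(1) uhi um hm by blast
    moreover have "\<bar>energy_L u h\<bar> \<le> c / 2 * ?S + M * s"
    proof -
      have "\<bar>energy_L u h\<bar> \<le> \<bar>c / 2 * (\<integral>p. increment u p * increment h p \<partial>near_measure)\<bar>
          + \<bar>c * (\<integral>p. u (fst p) * h (snd p) \<partial>far_measure)\<bar> + \<bar>\<rho> * (\<integral>x. u x * h x \<partial>lborel)\<bar>"
        unfolding energy_L_eq[OF um hm] c_def[symmetric] \<rho>_def[symmetric] by linarith
      also have "\<dots> \<le> c / 2 * (?S + k * (2 * (V * (a * s) + U1 * (A * s)))) + c * (U2 * (A * s))
          + \<bar>\<rho>\<bar> * (a * s)"
        unfolding abs_mult using c n2 f2 r2
        by (intro add_mono mult_mono) (auto intro: order_trans[OF abs_ge_zero])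
      also have "\<dots> = c / 2 * ?S + M * s" by (simp add: M_def algebra_simps)
      finally show ?thesis .
    qed
    ultimately show "form_pair u h \<and> \<bar>energy_L u h\<bar> \<le> c / 2 * (sqrt (\<integral>p. (w p)\<^sup>2 \<partial>near_measure)
        * sqrt (\<integral>p. (increment h p)\<^sup>2 \<partial>near_measure)) + M * sqrt (\<integral>x. (h x)\<^sup>2 \<partial>lborel)"
      by (simp add: s_def)
  qed
qed

text \<open>Dominated convergence: the strips shrink to the diagonal, where f vanishes.\<close>

lemma near_diagonal_tendsto_0:
  fixes f :: "'a::euclidean_space \<times> 'a \<Rightarrow> real"
  assumes f: "sq_integrable near_measure f" and d: "\<And>x. f (x, x) = 0"
  shows "(\<lambda>n. \<integral>p. (indicator {p. norm (fst p - snd p) < 1 / real (Suc n)} p * f p)\<^sup>2 \<partial>near_measure)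
      \<longlonglongrightarrow> 0"
proof -
  have [measurable]: "f \<in> borel_measurable borel" using sq_integrable_measurable[OF f]
      by (simp add: measurable_cong_sets[OF sets_near_measure refl])
  let ?A = "\<lambda>n. {p :: 'a \<times> 'a. norm (fst p - snd p) < 1 / real (Suc n)}"
  have [measurable]: "?A n \<in> sets borel" for n by measurable
  have "(\<lambda>n. \<integral>p. (indicator (?A n) p * f p)\<^sup>2 \<partial>near_measure)
      \<longlonglongrightarrow> (\<integral>p. 0 \<partial>(near_measure :: ('a \<times> 'a) measure))"
  proof (rule integral_dominated_convergence[where w="\<lambda>p. (f p)\<^sup>2"])
    show "integrable near_measure (\<lambda>p. (f p)\<^sup>2)" using f by (rule sq_integrable_sq)
    show "AE p in near_measure. (\<lambda>n. (indicator (?A n) p * f p)\<^sup>2) \<longlonglongrightarrow> 0"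
    proof (rule AE_I2)
      fix p :: "'a \<times> 'a"
      show "(\<lambda>n. (indicator (?A n) p * f p)\<^sup>2) \<longlonglongrightarrow> 0"
      proof (cases "fst p = snd p")
        case True
        then have "f p = 0" using d[of "fst p"] by (cases p) auto
        then show ?thesis by simp
      next
        case False
        then have "0 < norm (fst p - snd p)" by simp
        then have "\<forall>\<^sub>F n in sequentially. inverse (real (Suc n)) < norm (fst p - snd p)"
          using LIMSEQ_inverse_real_of_nat by (intro order_tendstoD(2))
        then have "\<forall>\<^sub>F n in sequentially. (indicator (?A n) p * f p)\<^sup>2 = 0"
          by (rule eventually_mono) (auto simp: inverse_eq_divide)
        then show ?thesis by (rule tendsto_eventually)
      qed
    qed
    show "AE p in near_measure. norm ((indicator (?A n) p * f p)\<^sup>2) \<le> (f p)\<^sup>2" for n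
      by (intro AE_I2) (auto simp: indicator_def)
  qed measurable
  then show ?thesis by simp
qed

section \<open>Mollification of bounded functions\<close>

lemma Jensen_square:
  fixes \<rho> f :: "'a::euclidean_space \<Rightarrow> real"
  assumes [measurable]: "\<rho> \<in> borel_measurable borel" "f \<in> borel_measurable borel"
    and \<rho>: "\<And>z. 0 \<le> \<rho> z" "integrable lborel \<rho>" "(\<integral>z. \<rho> z \<partial>lborel) = 1" and f: "\<And>z. \<bar>f z\<bar> \<le> M"
  shows "ennreal ((\<integral>z. \<rho> z * f z \<partial>lborel)\<^sup>2) \<le> (\<integral>\<^sup>+z. ennreal (\<rho> z) * ennreal ((f z)\<^sup>2) \<partial>lborel)"
proof -
  have s: "(sqrt (\<rho> z))\<^sup>2 = \<rho> z" for z using \<rho> by simp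
  have s1: "sq_integrable lborel (\<lambda>z. sqrt (\<rho> z))"
    using \<rho> by (simp add: sq_integrable_def)
  have s2: "sq_integrable lborel (\<lambda>z. sqrt (\<rho> z) * f z)"
  proof (rule sq_integrable_bound)
    show "sq_integrable lborel (\<lambda>z. M * sqrt (\<rho> z))" by (rule sq_integrable_scale[OF s1])
    have "\<bar>f z\<bar> \<le> \<bar>M\<bar>" for z using f[of z] by simp
    then show "AE z in lborel. \<bar>sqrt (\<rho> z) * f z\<bar> \<le> \<bar>M * sqrt (\<rho> z)\<bar>"
      using \<rho> by (intro AE_I2) (auto simp: abs_mult mult.commute intro!: mult_right_mono)
  qed measurable
  have e: "sqrt (\<rho> z) * f z * sqrt (\<rho> z) = \<rho> z * f z" for z using s[of z]
      by (simp add: power2_eq_square mult_ac)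
  have e2: "(sqrt (\<rho> z) * f z)\<^sup>2 = \<rho> z * (f z)\<^sup>2" for z by (simp add: power_mult_distrib \<rho>)
  have "(\<integral>z. \<rho> z * f z \<partial>lborel)\<^sup>2 \<le> (\<integral>z. \<rho> z * (f z)\<^sup>2 \<partial>lborel)"
    using Cauchy_Schwarz_integral[OF s2 s1] unfolding e e2 s \<rho>(3) by simp
  then have "ennreal ((\<integral>z. \<rho> z * f z \<partial>lborel)\<^sup>2) \<le> ennreal (\<integral>z. \<rho> z * (f z)\<^sup>2 \<partial>lborel)"
      by (rule ennreal_leI)
  also have "\<dots> = (\<integral>\<^sup>+z. ennreal (\<rho> z * (f z)\<^sup>2) \<partial>lborel)"
    using sq_integrable_sq[OF s2] unfolding e2
        by (intro nn_integral_eq_integral[symmetric]) (auto simp: \<rho>)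
  also have "\<dots> = (\<integral>\<^sup>+z. ennreal (\<rho> z) * ennreal ((f z)\<^sup>2) \<partial>lborel)"
    by (intro nn_integral_cong) (simp add: ennreal_mult \<rho>)
  finally show ?thesis .
qed

lemma integral_lborel_reflect:
  fixes f :: "'a::euclidean_space \<Rightarrow> real"
  assumes [measurable]: "f \<in> borel_measurable borel"
  shows "(\<integral>x. f (t - x) \<partial>lborel) = (\<integral>x. f x \<partial>lborel)"
proof -
  have "(lborel :: 'a measure) = distr lborel borel (\<lambda>x. t + (-1) *\<^sub>R x)"
    using lborel_affine[of "-1" t] by (simp add: density_1)
  then have "(\<integral>x. f x \<partial>lborel) = (\<integral>x. f x \<partial>distr lborel borel (\<lambda>x. t + (-1) *\<^sub>R x))" by simp
  also have "\<dots> = (\<integral>x. f (t - x) \<partial>lborel)" by (subst integral_distr) auto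
  finally show ?thesis by simp
qed

lemma mollification_eq:
  assumes [measurable]: "g \<in> borel_measurable borel" "\<rho> \<in> borel_measurable borel"
  shows "mollification g \<rho> x = (\<integral>z. \<rho> z * g (x - z) \<partial>lborel)"
  using integral_lborel_reflect[of "\<lambda>z. \<rho> z * g (x - z)" x]
  by (simp add: mollification_def mult.commute)

locale mollifier =
  fixes \<rho> g :: "'a::euclidean_space \<Rightarrow> real" and M :: real
  assumes \<rho>_smooth: "\<And>k. C_diff k \<rho>" and \<rho>_nonneg: "\<And>z. 0 \<le> \<rho> z"
      and \<rho>_integrable: "integrable lborel \<rho>"
    and \<rho>_integral: "(\<integral>z. \<rho> z \<partial>lborel) = 1"
    and g_borel [measurable]: "g \<in> borel_measurable borel" and g_bound: "\<And>x. \<bar>g x\<bar> \<le> M"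
begin

lemma \<rho>_borel [measurable]: "\<rho> \<in> borel_measurable borel"
  using \<rho>_smooth[of 0] by (simp add: borel_measurable_continuous_onI)

lemma product_integrable: "integrable lborel (\<lambda>z. \<rho> z * g (x - z))"
proof (rule Bochner_Integration.integrable_bound)
  show "integrable lborel (\<lambda>z. \<rho> z * M)" using \<rho>_integrable by simp
  show "AE z in lborel. norm (\<rho> z * g (x - z)) \<le> norm (\<rho> z * M)"
  proof (rule AE_I2)
    fix z
    have "\<bar>g (x - z)\<bar> \<le> \<bar>M\<bar>" using g_bound[of "x - z"] by simp
    then show "norm (\<rho> z * g (x - z)) \<le> norm (\<rho> z * M)" by (simp add: abs_mult mult_left_mono)
  qed
qed measurable

lemma mollification_minus:
  "mollification g \<rho> x - g x = (\<integral>z. \<rho> z * (g (x - z) - g x) \<partial>lborel)"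
proof -
  have "(\<integral>z. \<rho> z * (g (x - z) - g x) \<partial>lborel) = (\<integral>z. \<rho> z * g (x - z) - \<rho> z * g x \<partial>lborel)"
    by (simp add: right_diff_distrib)
  also have "\<dots> = (\<integral>z. \<rho> z * g (x - z) \<partial>lborel) - (\<integral>z. \<rho> z * g x \<partial>lborel)"
    by (rule Bochner_Integration.integral_diff[OF product_integrable]) (use \<rho>_integrable in auto)
  also have "(\<integral>z. \<rho> z * g x \<partial>lborel) = g x" by (simp add: \<rho>_integral)
  finally show ?thesis by (simp add: mollification_eq)
qed

lemma mollification_shift_minus:
  "mollification g \<rho> x - mollification g \<rho> (x - w)
      = (\<integral>z. \<rho> z * (g (x - z) - g (x - w - z)) \<partial>lborel)"
  using Bochner_Integration.integral_diff[OF product_integrable[of x] product_integrable[of "x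
      - w"]]
  by (simp add: mollification_eq right_diff_distrib)

lemma bounds2: "\<bar>g x - g y\<bar> \<le> 2 * M"
  using g_bound[of x] g_bound[of y] by linarith

text \<open>Jensen's inequality moves the square inside the average over z, and the bound of \<rho>
  by the kernel turns the average into an energy. Only pairs closer than \<epsilon> contribute, so
  for g of finite energy the error tends to 0 with \<epsilon>.\<close>

lemma mollification_error:
  assumes C: "0 \<le> C" "\<And>z. z \<noteq> 0 \<Longrightarrow> \<rho> z \<le> C * near_kernel z" and \<epsilon>: "\<And>z. \<epsilon> \<le> norm z \<Longrightarrow> \<rho> z = 0"
  shows "(\<integral>\<^sup>+x. ennreal ((mollification g \<rho> x - g x)\<^sup>2) \<partial>lborel)
    \<le> ennreal C * (\<integral>\<^sup>+p. ennreal ((indicator {p. norm (fst p - snd p) < \<epsilon>} p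
        * increment g p)\<^sup>2) \<partial>near_measure)"
proof -
  have [measurable]: "{p :: 'a \<times> 'a. norm (fst p - snd p) < \<epsilon>} \<in> sets borel" by measurable
  have "(\<integral>\<^sup>+x. ennreal ((mollification g \<rho> x - g x)\<^sup>2) \<partial>lborel)
    \<le> (\<integral>\<^sup>+x. \<integral>\<^sup>+z. ennreal (\<rho> z) * ennreal ((g (x - z) - g x)\<^sup>2) \<partial>lborel \<partial>lborel)"
    unfolding mollification_minus
    by (intro nn_integral_mono Jensen_square[where M="2
        * M"] bounds2) (simp_all add: \<rho>_nonneg \<rho>_integrable \<rho>_integral)
  also have "\<dots> = (\<integral>\<^sup>+z. \<integral>\<^sup>+x. ennreal (\<rho> z) * ennreal ((g (x - z) - g x)\<^sup>2) \<partial>lborel \<partial>lborel)"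
    using nn_integral_lborel_pair[of "\<lambda>p. ennreal (\<rho> (snd p))
        * ennreal ((g (fst p - snd p) - g (fst p))\<^sup>2)"]
      nn_integral_lborel_pair'[of "\<lambda>p. ennreal (\<rho> (snd p))
          * ennreal ((g (fst p - snd p) - g (fst p))\<^sup>2)"] by simp
  also have "\<dots> \<le> (\<integral>\<^sup>+z. ennreal C * (ennreal (near_kernel z)
      * (\<integral>\<^sup>+x. ennreal ((indicator {p. norm (fst p - snd p) < \<epsilon>} (x, x - z)
      * increment g (x, x - z))\<^sup>2) \<partial>lborel)) \<partial>lborel)"
  proof (rule nn_integral_mono)
    fix z :: 'a
    let ?J = "\<integral>\<^sup>+x. ennreal ((indicator {p. norm (fst p - snd p) < \<epsilon>} (x, x - z)
        * increment g (x, x - z))\<^sup>2) \<partial>lborel"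
    have e: "(\<integral>\<^sup>+x. ennreal (\<rho> z) * ennreal ((g (x - z) - g x)\<^sup>2) \<partial>lborel) = ennreal (\<rho> z)
        * (\<integral>\<^sup>+x. ennreal ((g (x - z) - g x)\<^sup>2) \<partial>lborel)"
      by (rule nn_integral_cmult) measurable
    show "(\<integral>\<^sup>+x. ennreal (\<rho> z) * ennreal ((g (x - z) - g x)\<^sup>2) \<partial>lborel) \<le> ennreal C
        * (ennreal (near_kernel z) * ?J)"
    proof (cases "norm z < \<epsilon> \<and> z \<noteq> 0")
      case True
      have "(\<integral>\<^sup>+x. ennreal ((g (x - z) - g x)\<^sup>2) \<partial>lborel) = ?J"
        using True by (intro nn_integral_cong) (simp add: power2_commute)
      moreover have "ennreal (\<rho> z) \<le> ennreal C * ennreal (near_kernel z)"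
        using C True by (simp add: ennreal_mult'[symmetric] ennreal_leI)
      ultimately show ?thesis unfolding e mult.assoc[symmetric] by (intro mult_mono) auto
    next
      case False
      then have z0: "ennreal (\<rho> z) * (\<integral>\<^sup>+x. ennreal ((g (x - z) - g x)\<^sup>2) \<partial>lborel) = 0"
        using \<epsilon>[of z] by (cases "z = 0") auto
      show ?thesis unfolding e z0 by simp
    qed
  qed
  also have "\<dots> = ennreal C * (\<integral>\<^sup>+p. ennreal ((indicator {p. norm (fst p - snd p) < \<epsilon>} p
      * increment g p)\<^sup>2) \<partial>near_measure)"
    by (subst nn_integral_near_measure_iterated, measurable, subst nn_integral_cmult, measurable)
  finally show ?thesis .
qed

lemma mollification_borel: "integrable lborel g \<Longrightarrow> compact K \<Longrightarrow> (\<And>x. x \<notin> K \<Longrightarrow> \<rho> x = 0) \<Longrightarrow>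
    mollification g \<rho> \<in> borel_measurable borel"
  using mollification_C_diff[of g K \<rho> 0] \<rho>_smooth by (simp add: borel_measurable_continuous_onI)

text \<open>Jensen's inequality for each translation increment. Translates of g have increments of
  the same norm, so averaging them cannot raise the energy.\<close>

lemma mollification_energy:
  assumes m [measurable]: "mollification g \<rho> \<in> borel_measurable borel"
  shows "(\<integral>\<^sup>+p. ennreal ((increment (mollification g \<rho>) p)\<^sup>2) \<partial>near_measure)
    \<le> (\<integral>\<^sup>+p. ennreal ((increment g p)\<^sup>2) \<partial>near_measure)"
proof -
  have H: "(\<integral>\<^sup>+z. ennreal (\<rho> z) \<partial>lborel) = 1"
    using \<rho>_integrable \<rho>_nonneg by (simp add: nn_integral_eq_integral \<rho>_integral)
  have J: "(\<integral>\<^sup>+x. ennreal ((mollification g \<rho> x - mollification g \<rho> (x - w))\<^sup>2) \<partial>lborel)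
      \<le> (\<integral>\<^sup>+x. ennreal ((g x - g (x - w))\<^sup>2) \<partial>lborel)" for w
  proof -
    let ?J = "\<integral>\<^sup>+x. ennreal ((g x - g (x - w))\<^sup>2) \<partial>lborel"
    have "(\<integral>\<^sup>+x. ennreal ((mollification g \<rho> x - mollification g \<rho> (x - w))\<^sup>2) \<partial>lborel)
      \<le> (\<integral>\<^sup>+x. \<integral>\<^sup>+z. ennreal (\<rho> z) * ennreal ((g (x - z) - g (x - w - z))\<^sup>2) \<partial>lborel \<partial>lborel)"
      unfolding mollification_shift_minus
      by (intro nn_integral_mono Jensen_square[where M="2
          * M"] bounds2) (simp_all add: \<rho>_nonneg \<rho>_integrable \<rho>_integral)
    also have "\<dots> = (\<integral>\<^sup>+z. \<integral>\<^sup>+x. ennreal (\<rho> z) * ennreal ((g (x - z)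
        - g (x - w - z))\<^sup>2) \<partial>lborel \<partial>lborel)"
      using nn_integral_lborel_pair[of "\<lambda>p. ennreal (\<rho> (snd p))
          * ennreal ((g (fst p - snd p) - g (fst p - w - snd p))\<^sup>2)"]
        nn_integral_lborel_pair'[of "\<lambda>p. ennreal (\<rho> (snd p))
            * ennreal ((g (fst p - snd p) - g (fst p - w - snd p))\<^sup>2)"] by simp
    also have "\<dots> = (\<integral>\<^sup>+z. ennreal (\<rho> z) * ?J \<partial>lborel)"
    proof (rule nn_integral_cong)
      fix z
      have "(\<integral>\<^sup>+x. ennreal ((g (x - z) - g (x - w - z))\<^sup>2) \<partial>lborel) = ?J"
        using nn_integral_lborel_shift[of "\<lambda>x. ennreal ((g x - g (x - w))\<^sup>2)" "- z"]
        by (simp add: algebra_simps)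
      then show "(\<integral>\<^sup>+x. ennreal (\<rho> z) * ennreal ((g (x - z) - g (x - w - z))\<^sup>2) \<partial>lborel)
          = ennreal (\<rho> z) * ?J"
        by (subst nn_integral_cmult) simp_all
    qed
    also have "\<dots> = (\<integral>\<^sup>+z. ennreal (\<rho> z) \<partial>lborel) * ?J" by (rule nn_integral_multc) simp
    finally show ?thesis by (simp add: H)
  qed
  have m1: "(\<lambda>p. ennreal ((increment (mollification g \<rho>) p)\<^sup>2)) \<in> borel_measurable borel"
      by measurable
  have m2: "(\<lambda>p. ennreal ((increment g p)\<^sup>2)) \<in> borel_measurable borel" by measurable
  show ?thesis
    unfolding nn_integral_near_measure_iterated[OF m1] nn_integral_near_measure_iterated[OF m2]
        increment_Pair
    by (intro nn_integral_mono mult_left_mono J) simp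
qed

lemma mollification_zero:
  assumes K: "\<And>x. x \<notin> K \<Longrightarrow> g x = 0" and \<epsilon>: "\<And>z. \<epsilon> \<le> norm z \<Longrightarrow> \<rho> z = 0" and x: "x \<notin> (\<Union>y\<in>K. cball y \<epsilon>)"
  shows "mollification g \<rho> x = 0"
proof -
  have zero: "g y * \<rho> (x - y) = 0" for y
  proof (cases "y \<in> K")
    case True
    then have "\<epsilon> \<le> norm (x - y)" using x by (force simp: dist_norm norm_minus_commute)
    then show ?thesis using \<epsilon> by simp
  qed (simp add: K)
  show ?thesis unfolding mollification_def zero by simp
qed

end

text \<open>Mollifications of g are admissible test functions. They converge to g in L^2 while their
  energy stays bounded, and by \<open>paired_class_form_bound\<close> this is enough to carry the
  inequality over to g.\<close>

lemma supersolution_bounded_pairing: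
  fixes u :: "'a::euclidean_space \<Rightarrow> real"
  assumes u: "borel_V \<Omega> u" and \<Omega>: "open \<Omega>" and sup: "weakly_log_superharmonic \<Omega> u"
    and K: "compact K" "K \<subseteq> \<Omega>" and g: "paired_class K g" and g0: "\<And>x. 0 \<le> g x" and gM: "\<And>x. g x \<le> M"
  shows "form_pair u g \<and> 0 \<le> energy_L u g"
proof -
  \<comment> \<open>Two enlargements of K fit into \<Omega>: by e0 for the supports of the
    mollifications, then by d0 for the strip around the diagonal.\<close>
  obtain e0 where e0: "0 < e0" "(\<Union>x\<in>K. cball x e0) \<subseteq> \<Omega>"
    by (rule compact_subset_open_imp_cball_epsilon_subset[OF K(1) \<Omega> K(2) that])
  define K' where "K' = (\<Union>x\<in>K. cball x e0)"
  have K': "compact K'" "K' \<subseteq> \<Omega>" "K \<subseteq> K'"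
    using compact_minkowski_sum_cball[OF K(1)] e0 by (auto simp: K'_def)
  obtain d0 where d0: "0 < d0" "(\<Union>x\<in>K'. cball x d0) \<subseteq> \<Omega>"
    by (rule compact_subset_open_imp_cball_epsilon_subset[OF K'(1) \<Omega> K'(2) that])
  have gsq: "sq_integrable lborel g" and ginc: "sq_integrable near_measure (increment g)"
    and gK: "\<And>x. x \<notin> K \<Longrightarrow> g x = 0" using g by (auto simp: paired_class_def)
  have gm [measurable]: "g \<in> borel_measurable borel" using sq_integrable_measurable[OF gsq] by simp
  have Kf: "K \<in> sets lborel" "emeasure lborel K < \<infinity>"
    using emeasure_bounded_finite[OF compact_imp_bounded[OF K(1)]] K by (auto intro: borel_compact)
  have gi: "integrable lborel g" using sq_integrable_imp_integrable_on[OF gsq Kf] gK by simp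
  have gK': "paired_class K' g" using g K'(3) by (auto simp: paired_class_def)
  define c where "c = log_lap_c DIM('a)"
  have c: "0 < c" using log_lap_c_pos by (simp add: c_def)
  define s where "s \<delta> = (\<integral>p. (indicator {p. norm (fst p - snd p) < \<delta>} p
      * (indicator (\<Omega> \<times> \<Omega>) p * increment u p))\<^sup>2 \<partial>near_measure)" for \<delta>
  define t where "t \<epsilon> = (\<integral>p. (indicator {p. norm (fst p - snd p) < \<epsilon>} p
      * increment g p)\<^sup>2 \<partial>near_measure)" for \<epsilon>
  have s0: "(\<lambda>n. s (1 / real (Suc n))) \<longlonglongrightarrow> 0"
    unfolding s_def by (rule near_diagonal_tendsto_0) (use u in \<open>auto simp: borel_V_def\<close>)
  have t0: "(\<lambda>n. t (1 / real (Suc n))) \<longlonglongrightarrow> 0"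
    unfolding t_def by (rule near_diagonal_tendsto_0[OF ginc]) simp
  define G where "G = (\<integral>p. (increment g p)\<^sup>2 \<partial>near_measure)"
  have G: "0 \<le> G" by (simp add: G_def)
  have K\<delta>: "y \<in> \<Omega>" if "x \<in> K'" "norm (x - y) < \<delta>" "\<delta> \<le> d0" for x y \<delta>
    using that d0 by (force simp: dist_norm)
  have fb: "\<exists>M. \<forall>h. paired_class K' h \<longrightarrow> form_pair u h \<and>
      \<bar>energy_L u h\<bar> \<le> c / 2 * (sqrt (s \<delta>) * sqrt (\<integral>p. (increment h p)\<^sup>2 \<partial>near_measure)) + M
          * sqrt (\<integral>x. (h x)\<^sup>2 \<partial>lborel)"
    if "0 < \<delta>" "\<delta> \<le> d0" for \<delta>
    unfolding s_def c_def using that by (intro paired_class_form_bound[OF u \<Omega> K'(1)] K\<delta>) auto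
  have fg: "form_pair u g" using fb[OF d0(1) order_refl] gK' by blast
  obtain C where C: "0 < C" "\<And>\<epsilon>. 0 < \<epsilon> \<Longrightarrow> \<epsilon> \<le> 1 \<Longrightarrow>
    \<exists>\<rho> :: 'a \<Rightarrow> real. (\<forall>k. C_diff k \<rho>) \<and> (\<forall>z. 0 \<le> \<rho> z) \<and> (\<forall>z. \<epsilon> \<le> norm z \<longrightarrow> \<rho> z = 0) \<and>
      integrable lborel \<rho> \<and> (\<integral>z. \<rho> z \<partial>lborel) = 1 \<and> (\<forall>z. z \<noteq> 0 \<longrightarrow> \<rho> z \<le> C * near_kernel z)"
    by (rule mollifiers_exist[OF that])
  have approx: "\<exists>\<phi>. paired_class K' (\<lambda>x. \<phi> x - g x) \<and> 0 \<le> energy_L u (\<lambda>x. g x + (\<phi> x - g x))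
      \<and> (\<integral>x. (\<phi> x - g x)\<^sup>2 \<partial>lborel) \<le> C * t \<epsilon> \<and> (\<integral>p. (increment (\<lambda>x. \<phi> x - g x) p)\<^sup>2 \<partial>near_measure)
          \<le> 4 * G"
    if \<epsilon>: "0 < \<epsilon>" "\<epsilon> \<le> 1" "\<epsilon> \<le> e0" for \<epsilon>
  proof -
    obtain \<rho> :: "'a \<Rightarrow> real" where \<rho>: "\<And>k. C_diff k \<rho>" "\<And>z. 0 \<le> \<rho> z" "\<And>z. \<epsilon> \<le> norm z \<Longrightarrow> \<rho> z = 0"
      "integrable lborel \<rho>" "(\<integral>z. \<rho> z \<partial>lborel) = 1" "\<And>z. z \<noteq> 0 \<Longrightarrow> \<rho> z \<le> C * near_kernel z"
      using C(2)[OF \<epsilon>(1,2)] by metis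
    interpret mollifier \<rho> g M
      by unfold_locales (use \<rho> g0 gM in auto)
    let ?\<phi> = "mollification g \<rho>"
    have \<rho>K: "\<rho> x = 0" if "x \<notin> cball 0 \<epsilon>" for x using that by (intro \<rho>(3)) simp
    have sm: "C_diff k ?\<phi>" for k
      by (rule mollification_C_diff[OF gi compact_cball[of 0 \<epsilon>] \<rho>(1) \<rho>K])
    have [measurable]: "?\<phi> \<in> borel_measurable borel"
      by (rule mollification_borel[OF gi compact_cball[of 0 \<epsilon>] \<rho>K])
    have p0: "?\<phi> x = 0" if "x \<notin> K'" for x
    proof (rule mollification_zero[OF gK \<rho>(3)])
      show "x \<notin> (\<Union>y\<in>K. cball y \<epsilon>)" using that \<epsilon>(3) by (auto simp: K'_def)
    qed
    have cl: "closure {x. ?\<phi> x \<noteq> 0} \<subseteq> K'"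
      using p0 by (intro closure_minimal compact_imp_closed[OF K'(1)]) auto
    then have "compact (closure {x. ?\<phi> x \<noteq> 0})"
      using bounded_subset[OF compact_imp_bounded[OF K'(1)]]
          by (simp add: compact_eq_bounded_closed)
    then have tf: "?\<phi> \<in> test_functions \<Omega>"
      using sm K'(2) cl by (auto simp: test_functions_def)
    have "0 \<le> ?\<phi> x" for x
      unfolding mollification_def by (intro Bochner_Integration.integral_nonneg mult_nonneg_nonneg
          g0 \<rho>(2))
    then have E: "0 \<le> energy_L u ?\<phi>" using sup tf unfolding weakly_log_superharmonic_def by blast
    have nn1: "(\<integral>\<^sup>+x. ennreal ((?\<phi> x - g x)\<^sup>2) \<partial>lborel) \<le> ennreal (C * t \<epsilon>)"
    proof -
      have [measurable]: "{p :: 'a \<times> 'a. norm (fst p - snd p) < \<epsilon>} \<in> sets borel" by measurable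
      have "sq_integrable near_measure (\<lambda>p. indicator {p. norm (fst p - snd p) < \<epsilon>} p
          * increment g p)"
        by (rule sq_integrable_bound[OF ginc]) (measurable, auto simp: indicator_def)
      then have "(\<integral>\<^sup>+p. ennreal ((indicator {p. norm (fst p - snd p) < \<epsilon>} p
          * increment g p)\<^sup>2) \<partial>near_measure) = ennreal (t \<epsilon>)"
        unfolding t_def by (intro nn_integral_eq_integral sq_integrable_sq) auto
      then show ?thesis
        using mollification_error[of C \<epsilon>] \<rho>(3,6) C(1) by (simp add: ennreal_mult')
    qed
    have d: "sq_integrable lborel (\<lambda>x. ?\<phi> x - g x)"
      using nn1 by (auto simp: sq_integrable_iff_nn intro: le_less_trans)
    have "0 \<le> C * t \<epsilon>" using C(1) by (simp add: t_def)
    then have 1: "(\<integral>x. (?\<phi> x - g x)\<^sup>2 \<partial>lborel) \<le> C * t \<epsilon>"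
      using nn1 sq_integrable_sq[OF d] by (subst (asm) nn_integral_eq_integral)
          (auto simp: ennreal_le_iff)
    have nn2: "(\<integral>\<^sup>+p. ennreal ((increment ?\<phi> p)\<^sup>2) \<partial>near_measure) \<le> ennreal G"
      using mollification_energy sq_integrable_sq[OF ginc]
      unfolding G_def by (subst nn_integral_eq_integral[symmetric]) auto
    have pinc: "sq_integrable near_measure (increment ?\<phi>)"
      using nn2 by (auto simp: sq_integrable_iff_nn intro: le_less_trans)
    have "(\<integral>p. (increment ?\<phi> p)\<^sup>2 \<partial>near_measure) \<le> G"
      using nn2 G sq_integrable_sq[OF pinc] by (subst (asm) nn_integral_eq_integral)
          (auto simp: ennreal_le_iff)
    then have 2: "(\<integral>p. (increment (\<lambda>x. ?\<phi> x - g x) p)\<^sup>2 \<partial>near_measure) \<le> 4 * G"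
      using integral_square_diff_le[OF pinc ginc] unfolding increment_diff G_def by linarith
    have "paired_class K' (\<lambda>x. ?\<phi> x - g x)"
      using d p0 gK K'(3) sq_integrable_diff[OF pinc ginc]
          by (auto simp: paired_class_def increment_diff)
    then show ?thesis using E 1 2 by (intro exI[of _ ?\<phi>]) simp
  qed
  have "0 \<le> energy_L u g"
  proof (rule ccontr)
    assume "\<not> 0 \<le> energy_L u g"
    define \<eta> where "\<eta> = - energy_L u g"
    have \<eta>: "0 < \<eta>" using \<open>\<not> 0 \<le> energy_L u g\<close> by (simp add: \<eta>_def)
    \<comment> \<open>The order of choices matters. First \<delta> makes the energy term smaller
      than \<eta> / 2 for all differences at once, their energy being at most 4 G. The constant A
      belongs to this \<delta>, and only then is \<epsilon> chosen to make the L^2 term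
      small.\<close>
    have "(\<lambda>n. c / 2 * (sqrt (s (1 / real (Suc n))) * sqrt (4 * G))) \<longlonglongrightarrow> c / 2
        * (sqrt 0 * sqrt (4 * G))"
      by (rule tendsto_mult_left[OF tendsto_mult_right[OF tendsto_real_sqrt[OF s0]]])
    then have "\<forall>\<^sub>F n in sequentially. c / 2 * (sqrt (s (1 / real (Suc n))) * sqrt (4 * G)) < \<eta> / 2"
      by (rule order_tendstoD(2)) (use \<eta> in simp)
    moreover have "\<forall>\<^sub>F n in sequentially. inverse (real (Suc n)) < d0"
      using LIMSEQ_inverse_real_of_nat d0 by (intro order_tendstoD(2))
    ultimately have "\<forall>\<^sub>F n in sequentially. c / 2 * (sqrt (s (1 / real (Suc n))) * sqrt (4 * G))
        < \<eta> / 2 \<and> inverse (real (Suc n)) < d0"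
      by (rule eventually_conj)
    then obtain n where n: "c / 2 * (sqrt (s (1 / real (Suc n))) * sqrt (4 * G))
        < \<eta> / 2" "inverse (real (Suc n)) < d0"
      unfolding eventually_sequentially by blast
    define \<delta> where "\<delta> = 1 / real (Suc n)"
    have \<delta>: "0 < \<delta>" "\<delta> \<le> d0" using n(2) by (auto simp: \<delta>_def inverse_eq_divide)
    obtain A where A: "\<And>h. paired_class K' h \<Longrightarrow> form_pair u h" "\<And>h. paired_class K' h \<Longrightarrow>
      \<bar>energy_L u h\<bar> \<le> c / 2 * (sqrt (s \<delta>) * sqrt (\<integral>p. (increment h p)\<^sup>2 \<partial>near_measure)) + A
          * sqrt (\<integral>x. (h x)\<^sup>2 \<partial>lborel)"
      using fb[OF \<delta>] by metis
    have "(\<lambda>n. \<bar>A\<bar> * sqrt (C * t (1 / real (Suc n)))) \<longlonglongrightarrow> \<bar>A\<bar> * sqrt (C * 0)"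
      by (rule tendsto_mult_left[OF tendsto_real_sqrt[OF tendsto_mult_left[OF t0]]])
    then have "\<forall>\<^sub>F n in sequentially. \<bar>A\<bar> * sqrt (C * t (1 / real (Suc n))) < \<eta> / 2"
      by (rule order_tendstoD(2)) (use \<eta> in simp)
    moreover have "\<forall>\<^sub>F n in sequentially. inverse (real (Suc n)) < e0"
      using LIMSEQ_inverse_real_of_nat e0 by (intro order_tendstoD(2))
    ultimately have "\<forall>\<^sub>F n in sequentially. \<bar>A\<bar> * sqrt (C * t (1 / real (Suc n))) < \<eta> / 2
        \<and> inverse (real (Suc n)) < e0"
      by (rule eventually_conj)
    then obtain m where m: "\<bar>A\<bar> * sqrt (C * t (1 / real (Suc m))) < \<eta> / 2" "inverse (real (Suc m))
        < e0"
      unfolding eventually_sequentially by blast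
    define \<epsilon> where "\<epsilon> = 1 / real (Suc m)"
    have \<epsilon>: "0 < \<epsilon>" "\<epsilon> \<le> 1" "\<epsilon> \<le> e0" using m(2) by (auto simp: \<epsilon>_def inverse_eq_divide)
    obtain \<phi> where \<phi>: "paired_class K' (\<lambda>x. \<phi> x - g x)" "0 \<le> energy_L u (\<lambda>x. g x + (\<phi> x - g x))"
      "(\<integral>x. (\<phi> x - g x)\<^sup>2 \<partial>lborel) \<le> C * t \<epsilon>" "(\<integral>p. (increment (\<lambda>x. \<phi> x - g x) p)\<^sup>2 \<partial>near_measure) \<le> 4
          * G"
      using approx[OF \<epsilon>] by blast
    have "0 \<le> energy_L u g + energy_L u (\<lambda>x. \<phi> x - g x)"
      using \<phi>(2) energy_L_add_right(1)[OF fg A(1)[OF \<phi>(1)]] by simp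
    moreover have "\<bar>energy_L u (\<lambda>x. \<phi> x - g x)\<bar> < \<eta>"
    proof -
      let ?a = "\<integral>p. (increment (\<lambda>x. \<phi> x - g x) p)\<^sup>2 \<partial>near_measure" and ?b
          = "\<integral>x. (\<phi> x - g x)\<^sup>2 \<partial>lborel"
      have "s \<delta> \<ge> 0" by (simp add: s_def)
      then have "c / 2 * (sqrt (s \<delta>) * sqrt ?a) \<le> c / 2 * (sqrt (s \<delta>) * sqrt (4 * G))"
        using c \<phi>(4) by (intro mult_left_mono real_sqrt_le_mono) auto
      moreover have "A * sqrt ?b \<le> \<bar>A\<bar> * sqrt (C * t \<epsilon>)"
        using \<phi>(3) by (intro mult_mono real_sqrt_le_mono) auto
      ultimately show ?thesis
        using A(2)[OF \<phi>(1)] n(1) m(1) unfolding \<delta>_def[symmetric] \<epsilon>_def[symmetric] by linarith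
    qed
    ultimately show False by (simp add: \<eta>_def)
  qed
  then show ?thesis using fg by blast
qed

section \<open>A positive eigenvalue forces the maximum principle\<close>

definition boundary_cutoff :: "'a::euclidean_space set \<Rightarrow> nat \<Rightarrow> 'a \<Rightarrow> real" where
  "boundary_cutoff \<Omega> n x = min 1 (max 0 (real n * infdist x (- \<Omega>) - 1))"

lemma boundary_cutoff_range: "0 \<le> boundary_cutoff \<Omega> n x" "boundary_cutoff \<Omega> n x \<le> 1"
  by (auto simp: boundary_cutoff_def)

lemma boundary_cutoff_measurable [measurable]: "boundary_cutoff \<Omega> n \<in> borel_measurable borel"
  unfolding boundary_cutoff_def
  by (intro borel_measurable_continuous_onI continuous_intros)

lemma boundary_cutoff_tendsto:
  assumes "0 < infdist x (- \<Omega>)"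
  shows "(\<lambda>n. boundary_cutoff \<Omega> n x) \<longlonglongrightarrow> 1"
proof (rule tendsto_eventually)
  obtain m :: nat where m: "2 / infdist x (- \<Omega>) \<le> real m" using real_arch_simple by blast
  show "\<forall>\<^sub>F n in sequentially. boundary_cutoff \<Omega> n x = 1"
    using eventually_ge_at_top[of m]
  proof eventually_elim
    case (elim n)
    have "2 / infdist x (- \<Omega>) \<le> real n" using m elim by linarith
    then have "2 \<le> real n * infdist x (- \<Omega>)" using assms by (simp add: divide_le_eq)
    then show ?case by (simp add: boundary_cutoff_def)
  qed
qed

text \<open>For n > 0 the cut-off is 0 up to distance 1 / n and 1 from distance 2 / n on. If both
  points are beyond 2 / n, the increment vanishes; otherwise the slope n is at most 2 over the
  distance of x. So the increment is at most 2 r and at most 1, and either bound gives 2 sqrt r for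
  the square, according to r \<le> 1 or not.\<close>

lemma boundary_cutoff_increment_aux:
  fixes \<Omega> :: "'a::euclidean_space set"
  assumes x: "0 < infdist x (- \<Omega>)" and le: "infdist x (- \<Omega>) \<le> infdist y (- \<Omega>)"
  shows "(boundary_cutoff \<Omega> n x - boundary_cutoff \<Omega> n y)\<^sup>2 \<le> 2
      * sqrt (norm (x - y) / infdist x (- \<Omega>))"
proof (cases "2 \<le> real n * infdist x (- \<Omega>)")
  case True
  have "real n * infdist x (- \<Omega>) \<le> real n * infdist y (- \<Omega>)" using le by (intro mult_left_mono) auto
  then have "boundary_cutoff \<Omega> n x = 1" "boundary_cutoff \<Omega> n y = 1"
    using True by (auto simp: boundary_cutoff_def)
  then show ?thesis using x by simp
next
  case False
  let ?a = "boundary_cutoff \<Omega> n x" and ?b = "boundary_cutoff \<Omega> n y"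
  define r where "r = norm (x - y) / infdist x (- \<Omega>)"
  have r: "0 \<le> r" using x by (simp add: r_def)
  have d1: "\<bar>?a - ?b\<bar> \<le> 1" using boundary_cutoff_range[of \<Omega> n x] boundary_cutoff_range[of \<Omega> n y]
      by linarith
  have "\<bar>?a - ?b\<bar> \<le> \<bar>real n * infdist x (- \<Omega>) - real n * infdist y (- \<Omega>)\<bar>"
    unfolding boundary_cutoff_def by linarith
  also have "\<dots> = real n * \<bar>infdist x (- \<Omega>) - infdist y (- \<Omega>)\<bar>"
    by (simp add: abs_mult right_diff_distrib[symmetric])
  also have "\<dots> \<le> real n * norm (x - y)"
    using infdist_triangle_abs[of x "- \<Omega>" y] by (intro mult_left_mono) (auto simp: dist_norm)
  also have "\<dots> = (real n * infdist x (- \<Omega>)) * r" using x by (simp add: r_def)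
  also have "\<dots> \<le> 2 * r" using False r by (intro mult_right_mono) auto
  finally have d2: "\<bar>?a - ?b\<bar> \<le> 2 * r" .
  have "(?a - ?b)\<^sup>2 \<le> 2 * sqrt r"
  proof (cases "r \<le> 1")
    case True
    have "(?a - ?b)\<^sup>2 \<le> \<bar>?a - ?b\<bar>"
      using mult_left_mono[OF d1 abs_ge_zero[of "?a - ?b"]]
      by (simp only: mult_1_right abs_mult_self_eq power2_eq_square)
    also have "\<dots> \<le> 2 * r" by (rule d2)
    also have "r \<le> sqrt r"
      using True r by (intro real_le_rsqrt) (simp add: power2_eq_square mult_left_le)
    finally show ?thesis by simp
  next
    case False
    have "(?a - ?b)\<^sup>2 \<le> 1" using d1 by (simp add: abs_square_le_1)
    also have "1 \<le> sqrt r" using False by simp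
    finally show ?thesis using real_sqrt_ge_zero[OF r] by linarith
  qed
  then show ?thesis by (simp add: r_def)
qed

lemma boundary_weight_nonneg: "0 \<le> boundary_weight \<Omega> p"
  by (simp add: boundary_weight_def infdist_nonneg)

lemma boundary_cutoff_increment:
  fixes \<Omega> :: "'a::euclidean_space set"
  assumes \<Omega>: "open \<Omega>" "bounded \<Omega>" and x: "x \<in> \<Omega>" and y: "y \<in> \<Omega>"
  shows "(boundary_cutoff \<Omega> n x - boundary_cutoff \<Omega> n y)\<^sup>2
    \<le> 2 * (boundary_weight \<Omega> (x, y) + boundary_weight \<Omega> (y, x))"
proof -
  note px = infdist_compl_pos[OF \<Omega> x] and py = infdist_compl_pos[OF \<Omega> y]
  have nn: "0 \<le> boundary_weight \<Omega> (x, y)" "0 \<le> boundary_weight \<Omega> (y, x)"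
      by (rule boundary_weight_nonneg)+
  show ?thesis
  proof (cases "infdist x (- \<Omega>) \<le> infdist y (- \<Omega>)")
    case True
    show ?thesis using boundary_cutoff_increment_aux[OF px True, of n] nn x
        by (simp add: boundary_weight_def)
  next
    case False
    then have le: "infdist y (- \<Omega>) \<le> infdist x (- \<Omega>)" by simp
    show ?thesis using boundary_cutoff_increment_aux[OF py le, of n] nn y
      by (simp add: boundary_weight_def power2_commute)
  qed
qed

text \<open>The points of a pair crossing the boundary are at least as far apart as x is from the
  complement. So the weight also dominates crossing pairs, on which a bounded function supported in
  \<Omega> then has finite energy.\<close>

lemma boundary_weight_ge_1:
  fixes \<Omega> :: "'a::euclidean_space set"
  assumes \<Omega>: "open \<Omega>" "bounded \<Omega>" and x: "x \<in> \<Omega>" and y: "y \<notin> \<Omega>"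
  shows "1 \<le> boundary_weight \<Omega> (x, y)"
proof -
  have "infdist x (- \<Omega>) \<le> norm (x - y)" using y infdist_le[of y "- \<Omega>" x] by (simp add: dist_norm)
  then show ?thesis using infdist_compl_pos[OF \<Omega> x] x by (simp add: boundary_weight_def)
qed

section \<open>The negative part of a supersolution\<close>

locale negative_part =
  fixes \<Omega> :: "'a::euclidean_space set" and u :: "'a \<Rightarrow> real"
  assumes \<Omega>: "open \<Omega>" "bounded \<Omega>" "lipschitz_boundary \<Omega>"
    and u: "borel_V \<Omega> u" and sup: "weakly_log_superharmonic \<Omega> u" and u0: "\<And>x. x \<notin> \<Omega> \<Longrightarrow> 0 \<le> u x"
begin

definition neg :: "'a \<Rightarrow> real" where "neg x = max 0 (- u x)"

definition neg_trunc :: "nat \<Rightarrow> 'a \<Rightarrow> real" where "neg_trunc k x = min (real k) (neg x)"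

definition neg_cut :: "nat \<Rightarrow> nat \<Rightarrow> 'a \<Rightarrow> real" where "neg_cut k n x = boundary_cutoff \<Omega> n x
    * neg_trunc k x"

definition weight :: "'a \<times> 'a \<Rightarrow> real" where "weight p = boundary_weight \<Omega> p
    + boundary_weight \<Omega> (snd p, fst p)"

definition inner_increment :: "'a \<times> 'a \<Rightarrow> real" where "inner_increment p = indicator (\<Omega> \<times> \<Omega>) p
    * increment u p"

lemma u_borel [measurable]: "u \<in> borel_measurable borel"
  using u by (simp add: borel_V_def)

lemma neg_borel [measurable]: "neg \<in> borel_measurable borel"
  unfolding neg_def by measurable

lemma neg_trunc_borel [measurable]: "neg_trunc k \<in> borel_measurable borel"
  unfolding neg_trunc_def by measurable

lemma neg_cut_borel [measurable]: "neg_cut k n \<in> borel_measurable borel"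
  unfolding neg_cut_def by measurable

lemma \<Omega>_borel [measurable]: "\<Omega> \<in> sets borel" "\<Omega> \<times> \<Omega> \<in> sets borel"
  using \<Omega>(1) by (auto intro: borel_open open_Times)

lemma weight_integrable: "integrable near_measure weight"
  unfolding weight_def by (rule boundary_weight_near_integrable[OF \<Omega>])

lemma weight_nonneg: "0 \<le> weight p"
  by (simp add: weight_def boundary_weight_nonneg)

lemma weight_ge_1_bound:
  assumes "1 \<le> weight p" shows "(real k)\<^sup>2 \<le> 4 * (real k)\<^sup>2 * weight p"
proof -
  have "(real k)\<^sup>2 * 1 \<le> (real k)\<^sup>2 * (4 * weight p)" using assms by (intro mult_left_mono) auto
  then show ?thesis by (simp only: mult_1_right mult.assoc mult.left_commute[of 4])
qed

lemma neg_range: "0 \<le> neg x" "0 \<le> neg_trunc k x" "neg_trunc k x \<le> neg x" "neg_trunc k x \<le> real k"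
  by (auto simp: neg_def neg_trunc_def)

lemma neg_zero: "x \<notin> \<Omega> \<Longrightarrow> neg x = 0"
  using u0[of x] by (simp add: neg_def)

lemma neg_trunc_zero: "x \<notin> \<Omega> \<Longrightarrow> neg_trunc k x = 0"
  using neg_zero[of x] by (simp add: neg_trunc_def)

lemma neg_cut_range: "0 \<le> neg_cut k n x" "neg_cut k n x \<le> neg_trunc k x"
  unfolding neg_cut_def
  by (auto simp: boundary_cutoff_range neg_range intro: mult_left_le_one_le)

lemma neg_cut_zero: "x \<notin> \<Omega> \<Longrightarrow> neg_cut k n x = 0"
  by (simp add: neg_cut_def neg_trunc_zero)

lemma neg_cut_tendsto: "(\<lambda>n. neg_cut k n x) \<longlonglongrightarrow> neg_trunc k x"
proof (cases "x \<in> \<Omega>")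
  case True
  show ?thesis
    unfolding neg_cut_def
    using tendsto_mult_right[OF boundary_cutoff_tendsto[OF infdist_compl_pos[OF \<Omega>(1,2) True]], of
        "neg_trunc k x"] by simp
qed (simp add: neg_cut_zero neg_trunc_zero)

lemma neg_trunc_tendsto: "(\<lambda>k. neg_trunc k x) \<longlonglongrightarrow> neg x"
proof (rule tendsto_eventually)
  obtain m :: nat where m: "neg x \<le> real m" using real_arch_simple by blast
  show "\<forall>\<^sub>F k in sequentially. neg_trunc k x = neg x"
    using eventually_ge_at_top[of m] by eventually_elim (use m in \<open>auto simp: neg_trunc_def\<close>)
qed

lemma u_sq: "sq_integrable lborel (\<lambda>x. indicator \<Omega> x * u x)"
  using u by (simp add: borel_V_def)

lemma inner_increment_sq: "sq_integrable near_measure inner_increment"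
  using u unfolding inner_increment_def borel_V_def by blast

lemma neg_le: "neg x \<le> \<bar>indicator \<Omega> x * u x\<bar>"
  using neg_zero[of x] by (cases "x \<in> \<Omega>") (auto simp: neg_def)

lemma neg_sq: "sq_integrable lborel neg"
  by (rule sq_integrable_bound[OF u_sq]) (use neg_le neg_range(1) in auto)

lemma neg_integrable: "integrable lborel neg"
  using sq_integrable_imp_integrable_on[OF neg_sq, of \<Omega>] emeasure_bounded_finite[OF \<Omega>(2)] neg_zero
      by simp

lemma neg_cut_sq: "sq_integrable lborel (neg_cut k n)"
proof (rule sq_integrable_bound[OF neg_sq])
  have "\<bar>neg_cut k n x\<bar> \<le> \<bar>neg x\<bar>" for x using neg_cut_range[of k n x] neg_range(3)[of k x]
      by linarith
  then show "AE x in lborel. \<bar>neg_cut k n x\<bar> \<le> \<bar>neg x\<bar>" by simp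
qed simp

text \<open>Inside \<Omega> this is a product rule: the cut-off is at most 1 and the truncation at
  most k, so the two terms are bounded by the increment of u and by k^2 times the weight. A crossing
  pair costs at most k^2, and there the weight is at least 1.\<close>

lemma neg_cut_increment_square:
  "(increment (neg_cut k n) p)\<^sup>2 \<le> 2 * (inner_increment p)\<^sup>2 + 4 * (real k)\<^sup>2 * weight p"
proof (cases p)
  case (Pair x y)
  have k: "\<bar>neg_cut k n z\<bar> \<le> real k" for z using neg_cut_range[of k n z] neg_range(4)[of k z]
      by linarith
  have sq: "(neg_cut k n z)\<^sup>2 \<le> (real k)\<^sup>2" for z using k[of z]
      by (metis abs_ge_zero power2_abs power_mono)
  note one = weight_ge_1_bound[of "(x, y)" k]
  consider "x \<in> \<Omega>" "y \<in> \<Omega>" | "x \<in> \<Omega>" "y \<notin> \<Omega>" | "x \<notin> \<Omega>" "y \<in> \<Omega>" | "x \<notin> \<Omega>" "y \<notin> \<Omega>" by blast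
  then show ?thesis
  proof cases
    case 1
    let ?a = "boundary_cutoff \<Omega> n x" and ?b = "boundary_cutoff \<Omega> n y"
    have "increment (neg_cut k n) (x, y) = ?a * (neg_trunc k x - neg_trunc k y) + neg_trunc k y
        * (?a - ?b)"
      by (simp add: neg_cut_def algebra_simps)
    then have "(increment (neg_cut k n) (x, y))\<^sup>2 \<le> 2 * (?a * (neg_trunc k x - neg_trunc k y))\<^sup>2 + 2
        * (neg_trunc k y * (?a - ?b))\<^sup>2"
      using sum_squares_bound[of "?a * (neg_trunc k x - neg_trunc k y)" "neg_trunc k y * (?a - ?b)"]
          by (simp add: power2_sum)
    also have "(?a * (neg_trunc k x - neg_trunc k y))\<^sup>2 \<le> (u x - u y)\<^sup>2"
    proof -
      have "\<bar>neg_trunc k x - neg_trunc k y\<bar> \<le> \<bar>u x - u y\<bar>" unfolding neg_trunc_def neg_def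
          by linarith
      then have "\<bar>?a * (neg_trunc k x - neg_trunc k y)\<bar> \<le> 1 * \<bar>u x - u y\<bar>"
        unfolding abs_mult using boundary_cutoff_range[of \<Omega> n x] by (intro mult_mono) auto
      then show ?thesis by (simp add: abs_le_square_iff)
    qed
    also have "(neg_trunc k y * (?a - ?b))\<^sup>2 \<le> (real k)\<^sup>2 * (2 * weight (x, y))"
      unfolding power_mult_distrib
      using boundary_cutoff_increment[OF \<Omega>(1,2) 1, of n] neg_range(2,4)[of k y]
      by (intro mult_mono power_mono) (auto simp: weight_def)
    finally show ?thesis using 1 Pair by (simp add: inner_increment_def)
  next
    case 2
    have "1 \<le> weight (x, y)"
      using boundary_weight_ge_1[OF \<Omega>(1,2) 2] boundary_weight_nonneg[of \<Omega> "(y, x)"]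
          by (simp add: weight_def)
    from one[OF this] sq[of x] show ?thesis using 2 Pair
        by (simp add: inner_increment_def neg_cut_zero)
  next
    case 3
    have "1 \<le> weight (x, y)"
      using boundary_weight_ge_1[OF \<Omega>(1,2) 3(2,1)] boundary_weight_nonneg[of \<Omega> "(x, y)"]
          by (simp add: weight_def)
    from one[OF this] sq[of y] show ?thesis using 3 Pair
        by (simp add: inner_increment_def neg_cut_zero)
  next
    case 4
    then show ?thesis using Pair weight_nonneg by (simp add: neg_cut_zero)
  qed
qed

text \<open>Finite energy comes from the increment bound; the cut-off vanishes closer than 1 / Suc n
  to the complement. The successor keeps this distance positive.\<close>

lemma neg_cut_paired: "paired_class {x. 1 / real (Suc n) \<le> infdist x (- \<Omega>)} (neg_cut k (Suc n))"
  unfolding paired_class_def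
proof (intro conjI allI impI)
  show "sq_integrable lborel (neg_cut k (Suc n))" by (rule neg_cut_sq)
  have "integrable near_measure (\<lambda>p. (increment (neg_cut k (Suc n)) p)\<^sup>2)"
  proof (rule Bochner_Integration.integrable_bound)
    show "integrable near_measure (\<lambda>p. 2 * (inner_increment p)\<^sup>2 + 4 * (real k)\<^sup>2 * weight p)"
      using sq_integrable_sq[OF inner_increment_sq] weight_integrable by simp
    show "AE p in near_measure. norm ((increment (neg_cut k (Suc n)) p)\<^sup>2)
        \<le> norm (2 * (inner_increment p)\<^sup>2 + 4 * (real k)\<^sup>2 * weight p)"
      using neg_cut_increment_square weight_nonneg
          by (intro AE_I2) (auto intro: order_trans[OF _ abs_ge_self])
  qed measurable
  then show "sq_integrable near_measure (increment (neg_cut k (Suc n)))"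
      by (simp add: sq_integrable_def)
  fix x assume "x \<notin> {x. 1 / real (Suc n) \<le> infdist x (- \<Omega>)}"
  then have "real (Suc n) * infdist x (- \<Omega>) < 1" by (simp add: field_simps)
  then show "neg_cut k (Suc n) x = 0" by (simp add: neg_cut_def boundary_cutoff_def)
qed

lemma neg_cut_support: "compact {x. 1 / real (Suc n) \<le> infdist x (- \<Omega>)}" "{x. 1 / real (Suc n)
    \<le> infdist x (- \<Omega>)} \<subseteq> \<Omega>"
proof -
  show s: "{x. 1 / real (Suc n) \<le> infdist x (- \<Omega>)} \<subseteq> \<Omega>"
  proof
    fix x assume x: "x \<in> {x. 1 / real (Suc n) \<le> infdist x (- \<Omega>)}"
    have "0 < 1 / real (Suc n)" by simp
    also have "\<dots> \<le> infdist x (- \<Omega>)" using x by blast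
    finally show "x \<in> \<Omega>" using infdist_zero[of x "- \<Omega>"] by (cases "x \<in> \<Omega>") auto
  qed
  have "closed {x. 1 / real (Suc n) \<le> infdist x (- \<Omega>)}"
    by (intro closed_Collect_le continuous_intros)
  then show "compact {x. 1 / real (Suc n) \<le> infdist x (- \<Omega>)}"
    using bounded_subset[OF \<Omega>(2) s] by (simp add: compact_eq_bounded_closed)
qed

lemma neg_cut_energy: "form_pair u (neg_cut k (Suc n)) \<and> 0 \<le> energy_L u (neg_cut k (Suc n))"
  by (rule supersolution_bounded_pairing[OF u \<Omega>(1) sup neg_cut_support neg_cut_paired
      neg_cut_range(1), where M="real k"])
     (rule order_trans[OF neg_cut_range(2) neg_range(4)])

text \<open>A minorant of \<open>increment neg p * increment (neg_cut k n) p\<close>; the truncation outside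
  \<open>\<Omega> \<times> \<Omega>\<close> is needed because \<open>neg\<close> itself is not yet known to have finite energy there.\<close>

definition minorant :: "nat \<Rightarrow> nat \<Rightarrow> 'a \<times> 'a \<Rightarrow> real" where
  "minorant k n p = (if p \<in> \<Omega> \<times> \<Omega> then increment neg p * increment (neg_cut k n) p
     else increment (neg_trunc k) p * increment (neg_cut k n) p)"

lemma minorant_borel [measurable]: "minorant k n \<in> borel_measurable borel"
  unfolding minorant_def by measurable

text \<open>Write u = v - neg with v the positive part. The test function vanishes where v is
  positive, so v enters only through the cross terms - v(x) g(y) - v(y) g(x), which are
  nonpositive.\<close>

lemma minorant_le: "increment u p * increment (neg_cut k n) p \<le> - minorant k n p"
proof (cases p)
  case (Pair x y)
  let ?g = "neg_cut k n"
  define v where "v z = max 0 (u z)" for z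
  have v: "u z = v z - neg z" "0 \<le> v z" for z by (auto simp: v_def neg_def)
  have vg: "v z * ?g z = 0" for z
  proof (cases "0 < u z")
    case True
    then have "neg_trunc k z = 0" by (simp add: neg_trunc_def neg_def)
    then show ?thesis by (simp add: neg_cut_def)
  qed (simp add: v_def)
  have "(u x - u y) * (?g x - ?g y)
    = v x * ?g x + v y * ?g y - (v x * ?g y + v y * ?g x) - (neg x - neg y) * (?g x - ?g y)"
    by (simp add: v(1) algebra_simps)
  also have "\<dots> \<le> - ((neg x - neg y) * (?g x - ?g y))"
  proof -
    have "0 \<le> v x * ?g y" "0 \<le> v y * ?g x" by (intro mult_nonneg_nonneg v(2) neg_cut_range(1))+
    then show ?thesis using vg[of x] vg[of y] by linarith
  qed
  finally have 1: "(u x - u y) * (?g x - ?g y) \<le> - ((neg x - neg y) * (?g x - ?g y))" .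
  \<comment> \<open>Outside \<Omega> \<times> \<Omega> at least one point contributes 0 to every
    factor, so at most one product remains and \<open>neg\<close> may be lowered to its truncation
    there.\<close>
  have 2: "(neg_trunc k x - neg_trunc k y) * (?g x - ?g y) \<le> (neg x - neg y)
      * (?g x - ?g y)" if "(x, y) \<notin> \<Omega> \<times> \<Omega>"
  proof -
    have m: "neg_trunc k z * ?g z \<le> neg z * ?g z" for z
        by (intro mult_right_mono neg_range neg_cut_range)
    show ?thesis
      using that m[of x] m[of y] by (auto simp: neg_cut_zero neg_trunc_zero neg_zero)
  qed
  show ?thesis using 1 2 Pair by (auto simp: minorant_def)
qed

text \<open>The majorant is free of n, which permits dominated convergence when the cut-off is
  removed. Inside \<Omega> the product AB is bounded by A^2 + B^2; the first square costs one
  squared increment of u and the second two, whence the 3.\<close>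

lemma minorant_bound: "\<bar>minorant k n p\<bar> \<le> 3 * (inner_increment p)\<^sup>2 + 4 * (real k)\<^sup>2 * weight p"
proof (cases p)
  case (Pair x y)
  have kk: "neg_trunc k z * neg_cut k n z \<le> (real k)\<^sup>2" "0 \<le> neg_trunc k z * neg_cut k n z" for z
    unfolding power2_eq_square
    using neg_range(2,4)[of k z] neg_cut_range[of k n z] by (auto intro!: mult_mono)
  note one = weight_ge_1_bound[of "(x, y)" k]
  consider "x \<in> \<Omega>" "y \<in> \<Omega>" | "x \<in> \<Omega>" "y \<notin> \<Omega>" | "x \<notin> \<Omega>" "y \<in> \<Omega>" | "x \<notin> \<Omega>" "y \<notin> \<Omega>" by blast
  then show ?thesis
  proof cases
    case 1
    let ?A = "increment neg (x, y)" and ?B = "increment (neg_cut k n) (x, y)"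
    have "2 * \<bar>?A * ?B\<bar> \<le> ?A\<^sup>2 + ?B\<^sup>2"
      using sum_squares_bound[of "\<bar>?A\<bar>" "\<bar>?B\<bar>"] by (simp add: abs_mult mult.assoc)
    then have "\<bar>?A * ?B\<bar> \<le> ?A\<^sup>2 + ?B\<^sup>2" using abs_ge_zero[of "?A * ?B"] by linarith
    moreover have "?A\<^sup>2 \<le> (inner_increment (x, y))\<^sup>2"
    proof -
      have "\<bar>neg x - neg y\<bar> \<le> \<bar>u x - u y\<bar>" unfolding neg_def by linarith
      then show ?thesis using 1 by (simp add: inner_increment_def abs_le_square_iff)
    qed
    ultimately show ?thesis using neg_cut_increment_square[of k n "(x, y)"] 1 Pair
        by (simp add: minorant_def)
  next
    case 2
    have "1 \<le> weight (x, y)"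
      using boundary_weight_ge_1[OF \<Omega>(1,2) 2] boundary_weight_nonneg[of \<Omega> "(y, x)"]
          by (simp add: weight_def)
    from one[OF this] kk[of x] show ?thesis using 2 Pair
      by (simp add: inner_increment_def neg_cut_zero neg_trunc_zero minorant_def)
  next
    case 3
    have "1 \<le> weight (x, y)"
      using boundary_weight_ge_1[OF \<Omega>(1,2) 3(2,1)] boundary_weight_nonneg[of \<Omega> "(x, y)"]
          by (simp add: weight_def)
    from one[OF this] kk[of y] show ?thesis using 3 Pair
      by (simp add: inner_increment_def neg_cut_zero neg_trunc_zero minorant_def)
  next
    case 4
    then show ?thesis using Pair weight_nonneg by (simp add: neg_cut_zero minorant_def)
  qed
qed

lemma majorant_integrable: "integrable near_measure (\<lambda>p. 3 * (inner_increment p)\<^sup>2 + 4 * (real k)\<^sup>2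
    * weight p)"
  using sq_integrable_sq[OF inner_increment_sq] weight_integrable by simp

lemma minorant_integrable: "integrable near_measure (minorant k n)"
proof (rule Bochner_Integration.integrable_bound[OF majorant_integrable])
  show "AE p in near_measure. norm (minorant k n p) \<le> norm (3 * (inner_increment p)\<^sup>2 + 4 * (real k)\<^sup>2
      * weight p)"
    using minorant_bound by (intro AE_I2) (auto intro: order_trans[OF _ abs_ge_self])
qed measurable

lemma far_integrable:
  assumes "h \<in> borel_measurable borel" "\<And>x. 0 \<le> h x" "\<And>x. h x \<le> neg x"
  shows "integrable far_measure (\<lambda>p. neg (fst p) * h (snd p))" "integrable lborel (\<lambda>x. neg x * h x)"
proof -
  have "integrable lborel h"
    by (rule Bochner_Integration.integrable_bound[OF neg_integrable])
        (use assms neg_range(1) in auto)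
  then show "integrable far_measure (\<lambda>p. neg (fst p) * h (snd p))"
      by (intro far_product_integrable neg_integrable)
  have "sq_integrable lborel h" by (rule sq_integrable_bound[OF neg_sq])
      (use assms neg_range(1) in auto)
  then show "integrable lborel (\<lambda>x. neg x * h x)" by (intro sq_integrable_mult neg_sq)
qed

lemma neg_cut_le_w: "neg_cut k n x \<le> neg x"
  using neg_cut_range(2)[of k n x] neg_range(3)[of k x] by linarith

text \<open>The inequality for u, tested with the truncation after cut-off and rewritten in terms of
  \<open>neg\<close>: the near part by the minorant, the far part by - u \<le> neg, the last part by
  equality, because the test function lives where u < 0.\<close>

lemma minorant_integral_le:
  "log_lap_c DIM('a) / 2 * (\<integral>p. minorant k (Suc n) p \<partial>near_measure)
    \<le> log_lap_c DIM('a) * (\<integral>p. neg (fst p) * neg_cut k (Suc n) (snd p) \<partial>far_measure)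
      - log_lap_rho DIM('a) * (\<integral>x. neg x * neg_cut k (Suc n) x \<partial>lborel)"
proof -
  let ?g = "neg_cut k (Suc n)" and ?c = "log_lap_c DIM('a)"
  have c: "0 < ?c" by (rule log_lap_c_pos)
  have fp: "form_pair u ?g" and E: "0 \<le> energy_L u ?g" using neg_cut_energy by auto
  note fi = far_integrable[OF neg_cut_borel neg_cut_range(1) neg_cut_le_w, of k "Suc n"]
  have 1: "(\<integral>p. increment u p * increment ?g p \<partial>near_measure) \<le>
      - (\<integral>p. minorant k (Suc n) p \<partial>near_measure)"
  proof -
    have "(\<integral>p. increment u p * increment ?g p \<partial>near_measure)
        \<le> (\<integral>p. - minorant k (Suc n) p \<partial>near_measure)"
      by (intro integral_mono minorant_le) (use fp minorant_integrable in \<open>auto simp: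
          form_pair_def\<close>)
    then show ?thesis by simp
  qed
  have 2: "- (\<integral>p. u (fst p) * ?g (snd p) \<partial>far_measure)
      \<le> (\<integral>p. neg (fst p) * ?g (snd p) \<partial>far_measure)"
  proof -
    have "(\<integral>p. - (u (fst p) * ?g (snd p)) \<partial>far_measure)
        \<le> (\<integral>p. neg (fst p) * ?g (snd p) \<partial>far_measure)"
    proof (rule integral_mono)
      show "integrable far_measure (\<lambda>p. - (u (fst p) * ?g (snd p)))" using fp
          by (simp add: form_pair_def)
      fix p :: "'a \<times> 'a"
      have "- u (fst p) * ?g (snd p) \<le> neg (fst p) * ?g (snd p)"
        by (intro mult_right_mono neg_cut_range) (simp add: neg_def)
      then show "- (u (fst p) * ?g (snd p)) \<le> neg (fst p) * ?g (snd p)" by simp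
    qed (rule fi)
    then show ?thesis by simp
  qed
  have 3: "(\<integral>x. u x * ?g x \<partial>lborel) = - (\<integral>x. neg x * ?g x \<partial>lborel)"
  proof -
    have "u x * ?g x = - (neg x * ?g x)" for x
      by (cases "u x < 0") (auto simp: neg_def neg_cut_def neg_trunc_def)
    then show ?thesis by simp
  qed
  have "0 \<le> ?c / 2 * (\<integral>p. increment u p * increment ?g p \<partial>near_measure)
    + ?c * (- (\<integral>p. u (fst p) * ?g (snd p) \<partial>far_measure)) + log_lap_rho DIM('a)
        * (\<integral>x. u x * ?g x \<partial>lborel)"
    using E by (simp add: energy_L_eq)
  also have "\<dots> \<le> ?c / 2 * (- (\<integral>p. minorant k (Suc n) p \<partial>near_measure))
    + ?c * (\<integral>p. neg (fst p) * ?g (snd p) \<partial>far_measure) + log_lap_rho DIM('a)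
        * (- (\<integral>x. neg x * ?g x \<partial>lborel))"
    unfolding 3
    by (rule add_mono[OF add_mono[OF mult_left_mono[OF 1] mult_left_mono[OF 2]] order_refl])
        (use c in auto)
  finally show ?thesis by simp
qed

definition limit_minorant :: "nat \<Rightarrow> 'a \<times> 'a \<Rightarrow> real" where
  "limit_minorant k p = (if p \<in> \<Omega> \<times> \<Omega> then increment neg p
      * increment (neg_trunc k) p else (increment (neg_trunc k) p)\<^sup>2)"

lemma limit_minorant_borel [measurable]: "limit_minorant k \<in> borel_measurable borel"
  unfolding limit_minorant_def by measurable

lemma minorant_tendsto: "(\<lambda>n. minorant k n p) \<longlonglongrightarrow> limit_minorant k p"
proof -
  have "(\<lambda>n. increment (neg_cut k n) p) \<longlonglongrightarrow> increment (neg_trunc k) p"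
    unfolding increment_def by (rule tendsto_diff[OF neg_cut_tendsto neg_cut_tendsto])
  then show ?thesis
    unfolding minorant_def limit_minorant_def power2_eq_square
    by (cases "p \<in> \<Omega> \<times> \<Omega>") (simp_all add: tendsto_mult_left)
qed

text \<open>Truncation is nondecreasing and 1-Lipschitz, so the increment of \<open>neg\<close> has
  the sign of the truncated one and at least its size.\<close>

lemma limit_minorant_ge: "(increment (neg_trunc k) p)\<^sup>2 \<le> limit_minorant k p"
proof (cases p)
  case (Pair x y)
  have "(neg_trunc k x - neg_trunc k y)\<^sup>2 \<le> (neg x - neg y) * (neg_trunc k x - neg_trunc k y)"
  proof (cases "neg y \<le> neg x")
    case True
    then have "0 \<le> neg_trunc k x - neg_trunc k y" "neg_trunc k x - neg_trunc k y \<le> neg x - neg y"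
        by (auto simp: neg_trunc_def)
    then show ?thesis unfolding power2_eq_square by (intro mult_right_mono)
  next
    case False
    then have "0 \<le> neg_trunc k y - neg_trunc k x" "neg_trunc k y - neg_trunc k x \<le> neg y - neg x"
        by (auto simp: neg_trunc_def)
    then have "(neg_trunc k y - neg_trunc k x) * (neg_trunc k y - neg_trunc k x) \<le> (neg y - neg x)
        * (neg_trunc k y - neg_trunc k x)" by (intro mult_right_mono)
    then show ?thesis by (simp add: power2_eq_square algebra_simps)
  qed
  then show ?thesis using Pair by (simp add: limit_minorant_def)
qed

text \<open>The cut-off is removed at fixed k. On the right-hand side the integrands are dominated
  by products of \<open>neg\<close> with itself, integrable because \<open>neg\<close> is integrable
  and square integrable; the energy of \<open>neg\<close> does not occur.\<close>

lemma truncation_energy: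
  "integrable near_measure (\<lambda>p. (increment (neg_trunc k) p)\<^sup>2)"
  "log_lap_c DIM('a) / 2 * (\<integral>p. (increment (neg_trunc k) p)\<^sup>2 \<partial>near_measure)
    \<le> log_lap_c DIM('a) * (\<integral>p. neg (fst p) * neg_trunc k (snd p) \<partial>far_measure)
      - log_lap_rho DIM('a) * (\<integral>x. neg x * neg_trunc k x \<partial>lborel)"
proof -
  let ?c = "log_lap_c DIM('a)" and ?\<rho> = "log_lap_rho DIM('a)"
  have c: "0 < ?c" by (rule log_lap_c_pos)
  note fw = far_integrable[OF neg_borel neg_range(1) order_refl]
  have L: "integrable near_measure (limit_minorant k)"
    and l1: "(\<lambda>n. \<integral>p. minorant k (Suc n) p \<partial>near_measure) \<longlonglongrightarrow> (\<integral>p. limit_minorant k p \<partial>near_measure)"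
  proof -
    have m: "limit_minorant k \<in> borel_measurable near_measure" "\<And>n. minorant k (Suc n) \<in>
        borel_measurable near_measure"
      by measurable
    have ae: "AE p in near_measure. (\<lambda>n. minorant k (Suc n) p) \<longlonglongrightarrow> limit_minorant k p"
      by (intro AE_I2 LIMSEQ_Suc minorant_tendsto)
    have b: "\<And>n. AE p in near_measure. norm (minorant k (Suc n) p) \<le> 3 * (inner_increment p)\<^sup>2 + 4
        * (real k)\<^sup>2 * weight p"
      by (intro AE_I2) (simp add: minorant_bound)
    show "integrable near_measure (limit_minorant k)"
      by (rule integrable_dominated_convergence[OF m majorant_integrable ae b])
    show "(\<lambda>n. \<integral>p. minorant k (Suc n) p \<partial>near_measure) \<longlonglongrightarrow> (\<integral>p. limit_minorant k p \<partial>near_measure)"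
      by (rule integral_dominated_convergence[OF m majorant_integrable ae b])
  qed
  have l2: "(\<lambda>n. \<integral>p. neg (fst p) * neg_cut k (Suc n) (snd p) \<partial>far_measure)
      \<longlonglongrightarrow> (\<integral>p. neg (fst p) * neg_trunc k (snd p) \<partial>far_measure)"
  proof (rule integral_dominated_convergence[OF _ _ fw(1)])
    show "AE p in far_measure. (\<lambda>n. neg (fst p) * neg_cut k (Suc n) (snd p)) \<longlonglongrightarrow> neg (fst p)
        * neg_trunc k (snd p)"
      by (intro AE_I2 tendsto_mult_left LIMSEQ_Suc[OF neg_cut_tendsto])
    show "AE p in far_measure. norm (neg (fst p) * neg_cut k (Suc n) (snd p)) \<le> neg (fst p)
        * neg (snd p)" for n
      using neg_cut_le_w neg_cut_range(1) neg_range(1)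
          by (intro AE_I2) (auto simp: abs_mult intro!: mult_left_mono)
  qed measurable
  have l3: "(\<lambda>n. \<integral>x. neg x * neg_cut k (Suc n) x \<partial>lborel) \<longlonglongrightarrow> (\<integral>x. neg x * neg_trunc k x \<partial>lborel)"
  proof (rule integral_dominated_convergence[OF _ _ fw(2)])
    show "AE x in lborel. (\<lambda>n. neg x * neg_cut k (Suc n) x) \<longlonglongrightarrow> neg x * neg_trunc k x"
      by (intro AE_I2 tendsto_mult_left LIMSEQ_Suc[OF neg_cut_tendsto])
    show "AE x in lborel. norm (neg x * neg_cut k (Suc n) x) \<le> neg x * neg x" for n
      using neg_cut_le_w neg_cut_range(1) neg_range(1)
          by (intro AE_I2) (auto simp: abs_mult intro!: mult_left_mono)
  qed measurable
  have lim: "?c / 2 * (\<integral>p. limit_minorant k p \<partial>near_measure)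
    \<le> ?c * (\<integral>p. neg (fst p) * neg_trunc k (snd p) \<partial>far_measure) - ?\<rho>
        * (\<integral>x. neg x * neg_trunc k x \<partial>lborel)"
    by (rule LIMSEQ_le[OF tendsto_mult_left[OF l1] tendsto_diff[OF tendsto_mult_left[OF l2]
        tendsto_mult_left[OF l3]]])
       (use minorant_integral_le in blast)
  show i: "integrable near_measure (\<lambda>p. (increment (neg_trunc k) p)\<^sup>2)"
  proof (rule Bochner_Integration.integrable_bound[OF L])
    show "AE p in near_measure. norm ((increment (neg_trunc k) p)\<^sup>2) \<le> norm (limit_minorant k p)"
      by (intro AE_I2) (simp add: order_trans[OF limit_minorant_ge abs_ge_self])
  qed measurable
  have "(\<integral>p. (increment (neg_trunc k) p)\<^sup>2 \<partial>near_measure) \<le> (\<integral>p. limit_minorant k p \<partial>near_measure)"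
    by (intro integral_mono i L limit_minorant_ge)
  then have "?c / 2 * (\<integral>p. (increment (neg_trunc k) p)\<^sup>2 \<partial>near_measure) \<le> ?c / 2
      * (\<integral>p. limit_minorant k p \<partial>near_measure)"
    using c by (intro mult_left_mono) auto
  then show "?c / 2 * (\<integral>p. (increment (neg_trunc k) p)\<^sup>2 \<partial>near_measure)
    \<le> ?c * (\<integral>p. neg (fst p) * neg_trunc k (snd p) \<partial>far_measure) - ?\<rho>
        * (\<integral>x. neg x * neg_trunc k x \<partial>lborel)"
    using lim by linarith
qed

text \<open>As k grows, the right-hand side of \<open>truncation_energy\<close> converges to a
  finite limit r. Fatou then bounds the energy of \<open>neg\<close> by the same expression, which
  yields membership in \<open>borel_H \<Omega>\<close> and the sign of the form together.\<close>

lemma negative_part_energy: "borel_H \<Omega> neg" "energy_L neg neg \<le> 0"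
proof -
  let ?c = "log_lap_c DIM('a)" and ?\<rho> = "log_lap_rho DIM('a)"
  have c: "0 < ?c" by (rule log_lap_c_pos)
  note fw = far_integrable[OF neg_borel neg_range(1) order_refl]
  define r where "r = ?c * (\<integral>p. neg (fst p) * neg (snd p) \<partial>far_measure) - ?\<rho>
      * (\<integral>x. neg x * neg x \<partial>lborel)"
  have l2: "(\<lambda>k. \<integral>p. neg (fst p) * neg_trunc k (snd p) \<partial>far_measure)
      \<longlonglongrightarrow> (\<integral>p. neg (fst p) * neg (snd p) \<partial>far_measure)"
  proof (rule integral_dominated_convergence[OF _ _ fw(1)])
    show "AE p in far_measure. (\<lambda>k. neg (fst p) * neg_trunc k (snd p)) \<longlonglongrightarrow> neg (fst p) * neg (snd p)"
      by (intro AE_I2 tendsto_mult_left neg_trunc_tendsto)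
    show "AE p in far_measure. norm (neg (fst p) * neg_trunc k (snd p)) \<le> neg (fst p)
        * neg (snd p)" for k
      using neg_range by (intro AE_I2) (auto simp: abs_mult intro!: mult_left_mono)
  qed measurable
  have l3: "(\<lambda>k. \<integral>x. neg x * neg_trunc k x \<partial>lborel) \<longlonglongrightarrow> (\<integral>x. neg x * neg x \<partial>lborel)"
  proof (rule integral_dominated_convergence[OF _ _ fw(2)])
    show "AE x in lborel. (\<lambda>k. neg x * neg_trunc k x) \<longlonglongrightarrow> neg x * neg x"
      by (intro AE_I2 tendsto_mult_left neg_trunc_tendsto)
    show "AE x in lborel. norm (neg x * neg_trunc k x) \<le> neg x * neg x" for k
      using neg_range by (intro AE_I2) (auto simp: abs_mult intro!: mult_left_mono)
  qed measurable
  have lr: "(\<lambda>k. ?c * (\<integral>p. neg (fst p) * neg_trunc k (snd p) \<partial>far_measure) - ?\<rho>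
      * (\<integral>x. neg x * neg_trunc k x \<partial>lborel)) \<longlonglongrightarrow> r"
    unfolding r_def by (rule tendsto_diff[OF tendsto_mult_left[OF l2] tendsto_mult_left[OF l3]])
  have key: "integrable near_measure (\<lambda>p. (increment neg p)\<^sup>2)
      \<and> (\<integral>p. (increment neg p)\<^sup>2 \<partial>near_measure) \<le> 2 / ?c * (r + e)"
    if e: "0 < e" for e
  proof (rule integral_tendsto_le[OF truncation_energy(1)])
    show "AE p in near_measure. (\<lambda>k. (increment (neg_trunc k) p)\<^sup>2) \<longlonglongrightarrow> (increment neg p)\<^sup>2"
      unfolding increment_def by (intro AE_I2 tendsto_power tendsto_diff neg_trunc_tendsto)
    have "\<forall>\<^sub>F k in sequentially. ?c * (\<integral>p. neg (fst p) * neg_trunc k (snd p) \<partial>far_measure) - ?\<rho>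
        * (\<integral>x. neg x * neg_trunc k x \<partial>lborel) < r + e"
      by (rule order_tendstoD(2)[OF lr]) (use e in simp)
    then show "\<forall>\<^sub>F k in sequentially. (\<integral>p. (increment (neg_trunc k) p)\<^sup>2 \<partial>near_measure) \<le> 2 / ?c
        * (r + e)"
    proof (rule eventually_mono)
      fix k assume "?c * (\<integral>p. neg (fst p) * neg_trunc k (snd p) \<partial>far_measure) - ?\<rho>
          * (\<integral>x. neg x * neg_trunc k x \<partial>lborel) < r + e"
      then have "?c / 2 * (\<integral>p. (increment (neg_trunc k) p)\<^sup>2 \<partial>near_measure) \<le> r + e"
        using truncation_energy(2)[of k] by linarith
      then show "(\<integral>p. (increment (neg_trunc k) p)\<^sup>2 \<partial>near_measure) \<le> 2 / ?c * (r + e)"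
        using c by (simp add: field_simps)
    qed
  qed (simp, measurable)
  show "borel_H \<Omega> neg" using key[of 1] neg_zero by (simp add: borel_H_def sq_integrable_def)
  have "?c / 2 * (\<integral>p. (increment neg p)\<^sup>2 \<partial>near_measure) \<le> r"
  proof (rule field_le_epsilon)
    fix e :: real assume "0 < e"
    then have "(\<integral>p. (increment neg p)\<^sup>2 \<partial>near_measure) \<le> 2 / ?c * (r + e)" using key by blast
    then show "?c / 2 * (\<integral>p. (increment neg p)\<^sup>2 \<partial>near_measure) \<le> r + e" using c
        by (simp add: field_simps)
  qed
  then show "energy_L neg neg \<le> 0"
    unfolding energy_L_eq[OF neg_borel neg_borel] power2_eq_square[symmetric]
        by (simp add: r_def power2_eq_square)
qed

end

lemma V_space_borel_representative:
  fixes \<Omega> :: "'a::euclidean_space set"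
  assumes v: "v \<in> V_space \<Omega>" and \<Omega>: "open \<Omega>" and v0: "\<And>x. x \<notin> \<Omega> \<Longrightarrow> 0 \<le> v x"
  obtains u where "borel_V \<Omega> u" "\<And>x. x \<notin> \<Omega> \<Longrightarrow> 0 \<le> u x" "AE x in lborel. v x = u x"
proof -
  have loc: "\<And>K. compact K \<Longrightarrow> set_integrable lebesgue K v"
    and wt: "(\<integral>\<^sup>+x. ennreal (\<bar>v x\<bar> / (1 + norm x) ^ DIM('a)) \<partial>lebesgue) < \<infinity>"
    and gag: "gagliardo_log (near_pairs \<inter> \<Omega> \<times> \<Omega>) v < \<infinity>"
    and sq: "(\<integral>\<^sup>+x\<in>\<Omega>. ennreal ((v x)\<^sup>2) \<partial>lebesgue) < \<infinity>"
    using v by (auto simp: V_space_def L10_space_def)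
  \<comment> \<open>\<open>V_space\<close> has no separate measurability clause; measurability is
    recovered from integrability over an exhausting sequence of balls.\<close>
  have vm: "v \<in> borel_measurable lebesgue"
  proof (rule borel_measurable_LIMSEQ_real)
    show "(\<lambda>n. indicat_real (cball 0 (real n)) x *\<^sub>R v x) \<longlonglongrightarrow> v x" for x
    proof (rule tendsto_eventually)
      obtain m :: nat where m: "norm x \<le> real m" using real_arch_simple by blast
      show "\<forall>\<^sub>F n in sequentially. indicat_real (cball 0 (real n)) x *\<^sub>R v x = v x"
        using eventually_ge_at_top[of m]
      proof eventually_elim
        case (elim n)
        then have "norm x \<le> real n" using m by linarith
        then show ?case by simp
      qed
    qed
    show "(\<lambda>x. indicat_real (cball 0 (real n)) x *\<^sub>R v x) \<in> borel_measurable lebesgue" for n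
      using borel_measurable_integrable[OF loc[OF compact_cball, unfolded set_integrable_def]] .
  qed
  obtain g where g: "g \<in> borel_measurable lborel" "AE x in lborel. v x = g x"
    using completion_ex_borel_measurable_real[OF vm] by blast
  \<comment> \<open>The maximum preserves the sign condition at every point outside \<Omega>. Up to
    null sets it changes nothing, because v is nonnegative there.\<close>
  define u where "u x = (if x \<in> \<Omega> then g x else max 0 (g x))" for x
  have [measurable]: "g \<in> borel_measurable borel" "\<Omega> \<in> sets borel" using g \<Omega> by auto
  have O2 [measurable]: "\<Omega> \<times> \<Omega> \<in> sets borel" using \<Omega> by (intro borel_open open_Times)
  have um [measurable]: "u \<in> borel_measurable borel" unfolding u_def by measurable
  have ae: "AE x in lborel. v x = u x"
    using g(2)
  proof eventually_elim
    case (elim x)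
    then show ?case using v0[of x] by (cases "x \<in> \<Omega>") (auto simp: u_def)
  qed
  have "(\<integral>\<^sup>+x. ennreal (\<bar>v x\<bar> / (1 + norm x) ^ DIM('a)) \<partial>lborel)
      = (\<integral>\<^sup>+x. ennreal (\<bar>u x\<bar> / (1 + norm x) ^ DIM('a)) \<partial>lborel)"
    by (rule nn_integral_cong_AE, use ae in eventually_elim) simp
  then have "integrable lborel (\<lambda>x. u x / (1 + norm x) ^ DIM('a))"
    using wt by (simp add: integrable_iff_bounded nn_integral_completion abs_divide power_abs)
  moreover have "sq_integrable near_measure (\<lambda>p. indicator (\<Omega> \<times> \<Omega>) p * increment u p)"
  proof -
    have "(\<integral>\<^sup>+p. ennreal ((indicator (\<Omega> \<times> \<Omega>) p * increment u p)\<^sup>2) \<partial>near_measure)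
      = (\<integral>\<^sup>+p. ennreal ((increment u p)\<^sup>2) * indicator (\<Omega> \<times> \<Omega>) p \<partial>near_measure)"
      by (intro nn_integral_cong) (auto simp: indicator_def)
    also have "\<dots> < \<infinity>"
      using gag gagliardo_log_cong_AE[OF ae] gagliardo_log_eq_near_measure[OF um O2] by simp
    finally show ?thesis by (simp add: sq_integrable_iff_nn)
  qed
  moreover have "sq_integrable lborel (\<lambda>x. indicator \<Omega> x * u x)"
  proof -
    have "(\<integral>\<^sup>+x. ennreal ((indicator \<Omega> x * u x)\<^sup>2) \<partial>lborel) = (\<integral>\<^sup>+x\<in>\<Omega>. ennreal ((v x)\<^sup>2) \<partial>lborel)"
      by (rule nn_integral_cong_AE, use ae in eventually_elim) (auto simp: indicator_def)
    also have "\<dots> < \<infinity>" using sq by (simp add: nn_integral_completion)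
    finally show ?thesis by (simp add: sq_integrable_iff_nn)
  qed
  ultimately have "borel_V \<Omega> u" by (simp add: borel_V_def)
  then show ?thesis using that[of u] ae by (simp add: u_def)
qed

lemma pos_imp_maximum_principle:
  fixes \<Omega> :: "'a::euclidean_space set"
  assumes \<Omega>: "bounded \<Omega>" "open \<Omega>" "\<Omega> \<noteq> {}" and lip: "lipschitz_boundary \<Omega>" and pos: "0
      < first_eigenvalue \<Omega>"
  shows "maximum_principle \<Omega>"
  unfolding maximum_principle_def
proof (intro ballI impI)
  fix v assume v: "v \<in> V_space \<Omega>" "weakly_log_superharmonic \<Omega> v" "\<forall>x. x \<notin> \<Omega> \<longrightarrow> 0 \<le> v x"
  obtain u where u: "borel_V \<Omega> u" "\<And>x. x \<notin> \<Omega> \<Longrightarrow> 0 \<le> u x" "AE x in lborel. v x = u x"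
    by (rule V_space_borel_representative[OF v(1) \<Omega>(2) v(3)[rule_format] that])
  have um: "u \<in> borel_measurable borel" using u(1) by (simp add: borel_V_def)
  have sup: "weakly_log_superharmonic \<Omega> u"
    unfolding weakly_log_superharmonic_def
  proof (intro ballI impI)
    fix \<phi> assume \<phi>: "\<phi> \<in> test_functions \<Omega>" "\<forall>x. 0 \<le> \<phi> x"
    have "energy_L v \<phi> = energy_L u \<phi>"
      using borel_H_measurable[OF test_function_borel_H[OF \<phi>(1)]]
          by (intro energy_L_cong_AE um u(3)) auto
    then show "0 \<le> energy_L u \<phi>" using v(2) \<phi> unfolding weakly_log_superharmonic_def by auto
  qed
  interpret N: negative_part \<Omega> u
    by unfold_locales (use \<Omega> lip u sup in auto)
  obtain e where "borel_H \<Omega> e" "(\<integral>x. (e x)\<^sup>2 \<partial>lborel) = 1" "energy_L e e = first_eigenvalue \<Omega>"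
    and min: "\<And>v. borel_H \<Omega> v \<Longrightarrow> first_eigenvalue \<Omega> * (\<integral>x. (v x)\<^sup>2 \<partial>lborel) \<le> energy_L v v"
    by (rule first_eigenvalue_attained[OF \<Omega> that])
  \<comment> \<open>The Rayleigh inequality becomes available for the negative part only with its
    membership in \<open>borel_H \<Omega>\<close>.\<close>
  have "first_eigenvalue \<Omega> * (\<integral>x. (N.neg x)\<^sup>2 \<partial>lborel) \<le> 0"
    using min[OF N.negative_part_energy(1)] N.negative_part_energy(2) by linarith
  then have "(\<integral>x. (N.neg x)\<^sup>2 \<partial>lborel) \<le> 0" using pos by (simp add: mult_le_0_iff)
  moreover have "0 \<le> (\<integral>x. (N.neg x)\<^sup>2 \<partial>lborel)" by simp
  ultimately have "(\<integral>x. (N.neg x)\<^sup>2 \<partial>lborel) = 0" by linarith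
  then have "AE x in lborel. (N.neg x)\<^sup>2 = 0"
    using sq_integrable_sq[OF N.neg_sq] by (subst (asm) integral_nonneg_eq_0_iff_AE) auto
  then have "AE x in lborel. 0 \<le> v x"
    using u(3) by eventually_elim (auto simp: N.neg_def max_def split: if_splits)
  then show "AE x in lebesgue. 0 \<le> v x" by (rule AE_completion)
qed

theorem theorem1p8:
  fixes \<Omega> :: "'a::euclidean_space set"
  assumes "bounded_lipschitz_domain \<Omega>"
  shows "maximum_principle \<Omega> \<longleftrightarrow> 0 < first_eigenvalue \<Omega>"
proof -
  have \<Omega>: "bounded \<Omega>" "open \<Omega>" "\<Omega> \<noteq> {}" "lipschitz_boundary \<Omega>"
    using assms by (auto simp: bounded_lipschitz_domain_def)
  show ?thesis
    using maximum_principle_imp_pos[OF \<Omega>(1-3)] pos_imp_maximum_principle[OF \<Omega>] by blast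
qed

end
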